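(* Let $O(\ell_2)$ be the group of all invertible linear transformations of the real separable infinite-dimensional Hilbert space $\ell_2$ that preserve the inner product, and let $U(\ell_2)$ be the unitary group of the complex separable infinite-dimensional Hilbert space $\ell_2$, both with the topology of pointwise convergence (the strong operator topology). Then the groups $O(\ell_2)$ and $U(\ell_2)$ have the automatic continuity property, the small index property, and uncountable cofinality.
   Context: A topological group $G$ has: the automatic continuity property if every homomorphism from $G$ into a separable topological group is continuous; the small index property if every subgroup $H\le G$ with $[G:H]<2^{\omega}$ is open in $G$; uncountable cofinality if there is no countably infinite chain $G_1\le G_2\le\ldots\le G$ of proper subgroups of $G$ with $G=\bigcup_k G_k$. *)

theory Defs
  imports "HOL-Analysis.Analysis" "HOL-Algebra.Coset"
begin

section \<open>Topological groups\<close>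

definition topological_group :: "('a, 'm) monoid_scheme \<Rightarrow> 'a topology \<Rightarrow> bool" where
  "topological_group G T \<longleftrightarrow>
     group G \<and> topspace T = carrier G \<and>
     continuous_map (prod_topology T T) T (\<lambda>(x, y). x \<otimes>\<^bsub>G\<^esub> y) \<and>
     continuous_map T T (\<lambda>x. inv\<^bsub>G\<^esub> x)"

text \<open>
  HOL cannot quantify over types inside a formula, so the type \<^typ>\<open>'b\<close> carrying the target
  groups is a parameter. A theorem that leaves \<^typ>\<open>'b\<close> as a free type variable covers
  all separable topological groups. Targets are not required to be Hausdorff.
\<close>

definition automatic_continuity ::
    "'b itself \<Rightarrow> ('a, 'm) monoid_scheme \<Rightarrow> 'a topology \<Rightarrow> bool" where
  "automatic_continuity (_ :: 'b itself) G T \<longleftrightarrow>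
     (\<forall>(H :: 'b monoid) S h.
        topological_group H S \<and> separable_space S \<and> h \<in> hom G H \<longrightarrow> continuous_map T S h)"

definition small_index_property :: "('a, 'm) monoid_scheme \<Rightarrow> 'a topology \<Rightarrow> bool" where
  "small_index_property G T \<longleftrightarrow>
     (\<forall>H. subgroup H G \<and> (rcosets\<^bsub>G\<^esub> H) \<prec> (UNIV :: nat set set) \<longrightarrow> openin T H)"

definition uncountable_cofinality :: "('a, 'm) monoid_scheme \<Rightarrow> bool" where
  "uncountable_cofinality G \<longleftrightarrow>
     \<not> (\<exists>K :: nat \<Rightarrow> 'a set.
          (\<forall>n. subgroup (K n) G \<and> K n \<noteq> carrier G \<and> K n \<subseteq> K (Suc n)) \<and>
          carrier G = (\<Union>n. K n))"


section \<open>The Hilbert space of square-summable sequences\<close>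

typedef (overloaded) 'a ell2 = "{x :: nat \<Rightarrow> 'a::real_inner. summable (\<lambda>n. (norm (x n))\<^sup>2)}"
  morphisms coord Abs_ell2
  by (rule exI[of _ "\<lambda>_. 0"]) simp

lemma summable_coord: "summable (\<lambda>n. (norm (coord x n))\<^sup>2)"
  using coord[of x] by simp

lemma ell2_eqI: "(\<And>n. coord x n = coord y n) \<Longrightarrow> x = y"
  by (metis coord_inject ext)

lemma norm_mult_le_squares: "norm a * norm b \<le> (norm a)\<^sup>2 + (norm b)\<^sup>2"
  using sum_squares_bound[of "norm a" "norm b"]
        mult_nonneg_nonneg[OF norm_ge_zero[of a] norm_ge_zero[of b]] by linarith

lemma norm_add_squares_le: "(norm (a + b))\<^sup>2 \<le> 3 * ((norm a)\<^sup>2 + (norm b)\<^sup>2)"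
proof -
  have "(norm (a + b))\<^sup>2 \<le> (norm a + norm b)\<^sup>2"
    by (intro power_mono norm_triangle_ineq) auto
  also have "\<dots> = (norm a)\<^sup>2 + (norm b)\<^sup>2 + 2 * (norm a * norm b)"
    by (simp add: power2_sum)
  finally show ?thesis
    using norm_mult_le_squares[of a b] unfolding distrib_left by linarith
qed

instantiation ell2 :: (real_inner) real_vector
begin

definition zero_ell2 :: "'a ell2" where "0 = Abs_ell2 (\<lambda>_. 0)"
definition plus_ell2 :: "'a ell2 \<Rightarrow> 'a ell2 \<Rightarrow> 'a ell2"
  where "x + y = Abs_ell2 (\<lambda>n. coord x n + coord y n)"
definition scaleR_ell2 :: "real \<Rightarrow> 'a ell2 \<Rightarrow> 'a ell2"
  where "scaleR r x = Abs_ell2 (\<lambda>n. r *\<^sub>R coord x n)"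
definition uminus_ell2 :: "'a ell2 \<Rightarrow> 'a ell2"
  where "- x = Abs_ell2 (\<lambda>n. - coord x n)"
definition minus_ell2 :: "'a ell2 \<Rightarrow> 'a ell2 \<Rightarrow> 'a ell2"
  where "x - y = x + (- y :: 'a ell2)"

lemma coord_zero [simp]: "coord (0 :: 'a ell2) n = 0"
  by (simp add: zero_ell2_def Abs_ell2_inverse)

lemma coord_add [simp]: "coord (x + y :: 'a ell2) n = coord x n + coord y n"
proof -
  have "summable (\<lambda>n. 3 * ((norm (coord x n))\<^sup>2 + (norm (coord y n))\<^sup>2))"
    by (intro summable_mult summable_add summable_coord)
  then have "summable (\<lambda>n. (norm (coord x n + coord y n))\<^sup>2)"
    by (rule summable_comparison_test') (use norm_add_squares_le in auto)
  then show ?thesis by (simp add: plus_ell2_def Abs_ell2_inverse)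
qed

lemma coord_scaleR [simp]: "coord (r *\<^sub>R x :: 'a ell2) n = r *\<^sub>R coord x n"
  by (simp add: scaleR_ell2_def Abs_ell2_inverse power_mult_distrib summable_mult summable_coord)

lemma coord_uminus [simp]: "coord (- x :: 'a ell2) n = - coord x n"
  by (simp add: uminus_ell2_def Abs_ell2_inverse summable_coord)

lemma coord_diff [simp]: "coord (x - y :: 'a ell2) n = coord x n - coord y n"
  by (simp add: minus_ell2_def)

instance
  by standard (auto intro!: ell2_eqI simp: algebra_simps)

end

lemma summable_inner_coord: "summable (\<lambda>n. inner (coord x n) (coord y n))"
proof (rule summable_comparison_test')
  show "summable (\<lambda>n. (norm (coord x n))\<^sup>2 + (norm (coord y n))\<^sup>2)"
    by (intro summable_add summable_coord)
  show "norm (inner (coord x n) (coord y n)) \<le> (norm (coord x n))\<^sup>2 + (norm (coord y n))\<^sup>2" for n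
    using Cauchy_Schwarz_ineq2[of "coord x n" "coord y n"]
          norm_mult_le_squares[of "coord x n" "coord y n"] by simp
qed

instantiation ell2 :: (real_inner) real_inner
begin

definition inner_ell2 :: "'a ell2 \<Rightarrow> 'a ell2 \<Rightarrow> real"
  where "inner x y = (\<Sum>n. inner (coord x n) (coord y n))"
definition norm_ell2 :: "'a ell2 \<Rightarrow> real" where "norm (x :: 'a ell2) = sqrt (inner x x)"
definition sgn_ell2 :: "'a ell2 \<Rightarrow> 'a ell2" where "sgn (x :: 'a ell2) = x /\<^sub>R norm x"
definition dist_ell2 :: "'a ell2 \<Rightarrow> 'a ell2 \<Rightarrow> real" where "dist x y = norm (x - (y :: 'a ell2))"
definition uniformity_ell2 :: "('a ell2 \<times> 'a ell2) filter"
  where "uniformity = (INF e\<in>{0<..}. principal {(x :: 'a ell2, y). dist x y < e})"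
definition open_ell2 :: "'a ell2 set \<Rightarrow> bool"
  where "open U = (\<forall>x\<in>U. \<forall>\<^sub>F (x' :: 'a ell2, y) in uniformity. x' = x \<longrightarrow> y \<in> U)"

instance
proof
  fix x y z :: "'a ell2" and r :: real
  show "dist x y = norm (x - y)" by (rule dist_ell2_def)
  show "sgn x = x /\<^sub>R norm x" by (rule sgn_ell2_def)
  show "uniformity = (INF e\<in>{0<..}. principal {(x :: 'a ell2, y). dist x y < e})"
    by (rule uniformity_ell2_def)
  show "open U = (\<forall>x\<in>U. \<forall>\<^sub>F (x' :: 'a ell2, y) in uniformity. x' = x \<longrightarrow> y \<in> U)"
    for U :: "'a ell2 set" by (rule open_ell2_def)
  show "inner x y = inner y x" by (simp add: inner_ell2_def inner_commute)
  show "inner (x + y) z = inner x z + inner y z"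
    by (simp add: inner_ell2_def inner_add_left suminf_add summable_inner_coord)
  show "inner (r *\<^sub>R x) y = r * inner x y"
    by (simp add: inner_ell2_def suminf_mult summable_inner_coord)
  show "0 \<le> inner x x"
    by (simp add: inner_ell2_def suminf_nonneg summable_inner_coord)
  show "inner x x = 0 \<longleftrightarrow> x = 0"
  proof
    assume "inner x x = 0"
    then have "inner (coord x n) (coord x n) = 0" for n
      using suminf_eq_zero_iff[OF summable_inner_coord[of x x]] by (simp add: inner_ell2_def)
    then show "x = 0" by (intro ell2_eqI) simp
  qed (simp add: inner_ell2_def)
  show "norm x = sqrt (inner x x)" by (rule norm_ell2_def)
qed

end


subsection \<open>The complex structure\<close>

definition scaleC :: "complex \<Rightarrow> complex ell2 \<Rightarrow> complex ell2"  (infixr \<open>*\<^sub>C\<close> 75) where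
  "c *\<^sub>C x = Abs_ell2 (\<lambda>n. c * coord x n)"

definition cinner :: "complex ell2 \<Rightarrow> complex ell2 \<Rightarrow> complex" where
  "cinner x y = (\<Sum>n. coord x n * cnj (coord y n))"

lemma coord_scaleC [simp]: "coord (c *\<^sub>C x) n = c * coord x n"
  by (simp add: scaleC_def Abs_ell2_inverse norm_mult power_mult_distrib summable_mult summable_coord)

lemma vector_space_scaleC: "vector_space scaleC"
  by standard (auto intro!: ell2_eqI simp: algebra_simps)

lemma scaleC_of_real: "complex_of_real r *\<^sub>C x = r *\<^sub>R x"
  by (rule ell2_eqI) (simp add: scaleR_conv_of_real)

lemma summable_cinner: "summable (\<lambda>n. coord x n * cnj (coord y n))"
proof (rule summable_comparison_test')
  show "summable (\<lambda>n. (norm (coord x n))\<^sup>2 + (norm (coord y n))\<^sup>2)"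
    by (intro summable_add summable_coord)
  show "norm (coord x n * cnj (coord y n)) \<le> (norm (coord x n))\<^sup>2 + (norm (coord y n))\<^sup>2" for n
    using norm_mult_le_squares[of "coord x n" "coord y n"] by (simp add: norm_mult)
qed

text \<open>The real inner product on \<^typ>\<open>complex ell2\<close>, hence its norm and topology, come from \<^const>\<open>cinner\<close>.\<close>

lemma Re_cinner: "Re (cinner x y) = inner x y"
  by (simp add: cinner_def inner_ell2_def inner_complex_def Re_suminf summable_cinner)

lemma cinner_self: "cinner x x = complex_of_real ((norm x)\<^sup>2)"
proof -
  have "cinner x x = (\<Sum>n. complex_of_real (inner (coord x n) (coord x n)))"
    by (simp add: cinner_def complex_mult_cnj inner_complex_def power2_eq_square)
  also have "\<dots> = complex_of_real (inner x x)"
    by (simp add: inner_ell2_def suminf_of_real summable_inner_coord)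
  finally show ?thesis by (simp add: power2_norm_eq_inner)
qed


section \<open>The orthogonal and the unitary group\<close>

definition orthogonal_group :: "(real ell2 \<Rightarrow> real ell2) monoid" where
  "orthogonal_group =
     \<lparr>carrier = {A. linear A \<and> bij A \<and> (\<forall>x y. inner (A x) (A y) = inner x y)},
      monoid.mult = (\<circ>), one = id\<rparr>"

definition unitary_group :: "(complex ell2 \<Rightarrow> complex ell2) monoid" where
  "unitary_group =
     \<lparr>carrier = {A. Vector_Spaces.linear scaleC scaleC A \<and> bij A \<and>
                    (\<forall>x y. cinner (A x) (A y) = cinner x y)},
      monoid.mult = (\<circ>), one = id\<rparr>"

text \<open>
  The library topology on a function type is the product topology, so restricting it to the
  carrier gives the strong operator topology: pointwise convergence with respect to the norm. The
  library constant \<^const>\<open>strong_operator_topology\<close> lives on bounded linear functions instead.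
\<close>

definition pointwise_topology ::
    "('a::real_normed_vector \<Rightarrow> 'a) monoid \<Rightarrow> ('a \<Rightarrow> 'a) topology" where
  "pointwise_topology G = top_of_set (carrier G)"


subsection \<open>Both are topological groups\<close>

lemma topological_group_isometries:
  fixes C :: "('a::real_normed_vector \<Rightarrow> 'a) set"
  assumes id: "id \<in> C"
    and comp: "\<And>A B. A \<in> C \<Longrightarrow> B \<in> C \<Longrightarrow> A \<circ> B \<in> C"
    and inv: "\<And>A. A \<in> C \<Longrightarrow> inv_into UNIV A \<in> C"
    and bij: "\<And>A. A \<in> C \<Longrightarrow> bij A"
    and iso: "\<And>A x y. A \<in> C \<Longrightarrow> dist (A x) (A y) = dist x y"
  defines "G \<equiv> \<lparr>carrier = C, monoid.mult = (\<circ>), one = id\<rparr>"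
  shows "topological_group G (pointwise_topology G)"
proof -
  have grp: "group G"
  proof (rule groupI)
    fix A assume "A \<in> carrier G"
    then have "inv_into UNIV A \<in> carrier G" "inv_into UNIV A \<otimes>\<^bsub>G\<^esub> A = \<one>\<^bsub>G\<^esub>"
      using inv bij by (auto simp: G_def bij_def)
    then show "\<exists>B\<in>carrier G. B \<otimes>\<^bsub>G\<^esub> A = \<one>\<^bsub>G\<^esub>" by blast
  qed (auto simp: G_def id comp comp_assoc)
  have invG: "inv\<^bsub>G\<^esub> A = inv_into UNIV A" if "A \<in> C" for A
    by (rule group.inv_equality[OF grp]) (use that inv bij in \<open>auto simp: G_def bij_def\<close>)
  have lim_at: "((\<lambda>F. F x) \<longlongrightarrow> A x) (at A within S)" for A :: "'a \<Rightarrow> 'a" and x S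
    using continuous_on_subset[OF continuous_on_product_coordinates[of x], of "insert A S"]
    by (auto simp: continuous_on_def intro: tendsto_within_subset)
  have mult: "continuous_on (C \<times> C) (\<lambda>(A, B). A \<circ> B)"
  proof (rule continuous_on_coordinatewise_then_product)
    fix x
    show "continuous_on (C \<times> C) (\<lambda>p. (case p of (A, B) \<Rightarrow> A \<circ> B) x)"
      unfolding continuous_on_def
    proof (safe)
      fix A B assume AB: "A \<in> C" "B \<in> C"
      let ?F = "at (A, B) within C \<times> C"
      have c: "continuous_on (C \<times> C) (\<lambda>p. fst p y)" "continuous_on (C \<times> C) (\<lambda>p. snd p y)" for y
        by (rule continuous_on_compose2[OF continuous_on_product_coordinates[of y]],
            auto intro: continuous_on_fst continuous_on_snd)+
      have "((\<lambda>p. fst p (B x)) \<longlongrightarrow> A (B x)) ?F" "((\<lambda>p. snd p x) \<longlongrightarrow> B x) ?F"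
        using c AB unfolding continuous_on_def by (force, force)
      then have "((\<lambda>p. dist (snd p x) (B x) + dist (fst p (B x)) (A (B x))) \<longlongrightarrow> 0 + 0) ?F"
        by (intro tendsto_add tendsto_dist_iff[THEN iffD1])
      then have lim: "((\<lambda>p. dist (snd p x) (B x) + dist (fst p (B x)) (A (B x))) \<longlongrightarrow> 0) ?F"
        by simp
      have "((\<lambda>p. dist ((case p of (A, B) \<Rightarrow> A \<circ> B) x) (A (B x))) \<longlongrightarrow> 0) ?F"
      proof (rule tendsto_sandwich[OF _ _ tendsto_const lim])
        show "\<forall>\<^sub>F p in ?F. dist ((case p of (A, B) \<Rightarrow> A \<circ> B) x) (A (B x))
                \<le> dist (snd p x) (B x) + dist (fst p (B x)) (A (B x))"
          unfolding eventually_at_filter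
        proof (intro always_eventually allI impI)
          fix p assume "p \<in> C \<times> C"
          then have "dist (fst p (snd p x)) (fst p (B x)) = dist (snd p x) (B x)"
            using iso by auto
          then show "dist ((case p of (A, B) \<Rightarrow> A \<circ> B) x) (A (B x))
                \<le> dist (snd p x) (B x) + dist (fst p (B x)) (A (B x))"
            using dist_triangle[of "fst p (snd p x)" "A (B x)" "fst p (B x)"]
            by (simp add: case_prod_beta)
        qed
      qed simp
      then show "((\<lambda>p. (case p of (A, B) \<Rightarrow> A \<circ> B) x) \<longlongrightarrow> (A \<circ> B) x) ?F"
        by (subst tendsto_dist_iff) simp
    qed
  qed
  have inv_cont: "continuous_on C (inv_into UNIV)"
  proof (rule continuous_on_coordinatewise_then_product)
    fix x
    show "continuous_on C (\<lambda>A. inv_into UNIV A x)"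
      unfolding continuous_on_def
    proof
      fix A assume A: "A \<in> C"
      define y where "y = inv_into UNIV A x"
      have x: "A y = x" using bij[OF A] by (simp add: y_def bij_def surj_f_inv_f)
      have lim: "((\<lambda>B. dist (B y) x) \<longlongrightarrow> 0) (at A within C)"
        using lim_at[of y A C, THEN tendsto_dist_iff[THEN iffD1]] by (simp add: x)
      have "((\<lambda>B. dist (inv_into UNIV B x) y) \<longlongrightarrow> 0) (at A within C)"
      proof (rule Lim_transform_eventually[OF lim], unfold eventually_at_filter,
             intro always_eventually allI impI)
        fix B assume B: "B \<in> C"
        have "dist (inv_into UNIV B x) y = dist (B (inv_into UNIV B x)) (B y)"
          using iso[OF B] by simp
        also have "\<dots> = dist (B y) x"
          using bij[OF B] by (simp add: bij_def surj_f_inv_f dist_commute)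
        finally show "dist (B y) x = dist (inv_into UNIV B x) y" by simp
      qed
      then show "((\<lambda>A. inv_into UNIV A x) \<longlongrightarrow> inv_into UNIV A x) (at A within C)"
        by (subst tendsto_dist_iff) (simp add: y_def)
    qed
  qed
  have C: "carrier G = C" "(\<otimes>\<^bsub>G\<^esub>) = (\<circ>)" by (simp_all add: G_def)
  have "continuous_map (top_of_set C) (top_of_set C) (\<lambda>A. inv\<^bsub>G\<^esub> A)"
    by (rule continuous_map_eq[of _ _ "inv_into UNIV"]) (auto simp: inv_cont inv invG)
  moreover have "continuous_map (prod_topology (top_of_set C) (top_of_set C)) (top_of_set C)
                   (\<lambda>(A, B). A \<circ> B)"
    unfolding prod_topology_subtopology_eu using mult comp by auto
  ultimately show ?thesis
    using grp unfolding topological_group_def pointwise_topology_def C by simp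
qed

lemma topological_group_orthogonal:
  "topological_group orthogonal_group (pointwise_topology orthogonal_group)"
  unfolding orthogonal_group_def
proof (rule topological_group_isometries)
  let ?C = "{A :: real ell2 \<Rightarrow> real ell2. linear A \<and> bij A \<and> (\<forall>x y. inner (A x) (A y) = inner x y)}"
  show "id \<in> ?C" by (simp add: linear_id)
  show "A \<circ> B \<in> ?C" if "A \<in> ?C" "B \<in> ?C" for A B
    using that by (auto intro: linear_compose bij_comp)
  fix A assume "A \<in> ?C"
  then have lin: "linear A" and bij: "bij A" and inn: "\<And>x y. inner (A x) (A y) = inner x y"
    by auto
  show "bij A" by (rule bij)
  have AA: "A (inv_into UNIV A x) = x" for x using bij by (simp add: bij_def surj_f_inv_f)
  have "linear (inv_into UNIV A)"
    by (rule linearI; rule injD[OF bij_is_inj[OF bij]])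
       (simp_all add: AA linear_add[OF lin] linear_scale[OF lin])
  moreover have "inner (inv_into UNIV A x) (inv_into UNIV A y) = inner x y" for x y
    using inn[of "inv_into UNIV A x" "inv_into UNIV A y"] by (simp add: AA)
  ultimately show "inv_into UNIV A \<in> ?C"
    using bij by (simp add: bij_imp_bij_inv)
  show "dist (A x) (A y) = dist x y" for x y
    by (simp add: dist_norm norm_eq_sqrt_inner inn flip: linear_diff[OF lin])
qed

lemma topological_group_unitary:
  "topological_group unitary_group (pointwise_topology unitary_group)"
  unfolding unitary_group_def
proof (rule topological_group_isometries)
  let ?lin = "Vector_Spaces.linear scaleC scaleC"
  let ?C = "{A. ?lin A \<and> bij A \<and> (\<forall>x y. cinner (A x) (A y) = cinner x y)}"
  have lin_iff: "?lin A \<longleftrightarrow> (\<forall>x y. A (x + y) = A x + A y) \<and> (\<forall>c x. A (c *\<^sub>C x) = c *\<^sub>C A x)" for A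
    by (simp add: Vector_Spaces.linear_iff vector_space_scaleC)
  show "id \<in> ?C" by (simp add: lin_iff)
  show "A \<circ> B \<in> ?C" if "A \<in> ?C" "B \<in> ?C" for A B
    using that by (auto simp: lin_iff intro: bij_comp)
  fix A assume "A \<in> ?C"
  then have lin: "?lin A" and bij: "bij A" and inn: "\<And>x y. cinner (A x) (A y) = cinner x y"
    by auto
  show "bij A" by (rule bij)
  have AA: "A (inv_into UNIV A x) = x" for x using bij by (simp add: bij_def surj_f_inv_f)
  have add: "A (x + y) = A x + A y" and scale: "A (c *\<^sub>C x) = c *\<^sub>C A x" for x y c
    using lin by (auto simp: lin_iff)
  have "?lin (inv_into UNIV A)"
    unfolding lin_iff
    by (intro conjI allI; rule injD[OF bij_is_inj[OF bij]]) (simp_all add: AA add scale)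
  moreover have "cinner (inv_into UNIV A x) (inv_into UNIV A y) = cinner x y" for x y
    using inn[of "inv_into UNIV A x" "inv_into UNIV A y"] by (simp add: AA)
  ultimately show "inv_into UNIV A \<in> ?C"
    using bij by (simp add: bij_imp_bij_inv)
  have "linear A"
    by (rule linearI) (simp_all add: add scale flip: scaleC_of_real)
  then show "dist (A x) (A y) = dist x y" for x y
    using inn[of "x - y" "x - y"]
    by (simp add: dist_norm norm_eq_sqrt_inner linear_diff flip: Re_cinner)
qed

end

theory Submission
  imports Defs
begin

text \<open>
  Let \<open>G\<close> be the group of unitary operators of \<open>\<ell>\<^sub>2\<close> over a field of scalars with conjugation; the
  real and the complex numbers give the two groups of the theorem, and the whole argument is the
  same for both. Write \<open>e\<^sub>n\<close> for the standard basis.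

  All three properties come from one notion of largeness. An increasing sequence \<open>P\<close> of
  inverse-closed subsets of \<open>G\<close> is \<^emph>\<open>capturing\<close> if every family \<open>g\<close> in \<open>G\<close> indexed by the subsets of
  the natural numbers has two members with \<open>(g A)\<^sup>-\<^sup>1 (g B)\<close> in some \<open>P n\<close>. Pigeonhole arguments give
  three examples: a subgroup of index less than the continuum (as a constant sequence); a chain of
  subgroups that exhausts \<open>G\<close>; and, for a homomorphism into a separable group and a neighbourhood
  \<open>W\<close> of the identity there, the preimage of \<open>W W\<^sup>-\<^sup>1\<close>. So the point is that capturing sequences
  contain, up to a bounded power, a neighbourhood of the identity (\<open>neighbourhood_captured\<close>). Since
  the captured quotients belong to families that can be chosen at will, exact computations take the
  place of density and category arguments. There are three steps.

  First (\<open>infinite_stabiliser_captured\<close>), split the basis into infinitely many infinite blocks. If on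
  every block some unitary of the block were matched by no element of the corresponding \<open>P n\<close>,
  then gluing these unitaries along all possible patterns would give a family that is not captured.
  So there is a block on which every unitary is matched, but the matching element is arbitrary
  off the block. That defect is removed by a commutator: capturing a family of shifts of the block
  gives an element \<open>q\<close> of \<open>P\<close> that is a shift on a sub-block and the identity off the block, and each
  unitary of a smaller block is a commutator of \<open>q\<close> with a unitary \<open>\<rho>\<close> of the block, in which \<open>\<rho>\<close> may
  be replaced by the element that matches it. Hence \<open>P\<^sup>4\<close> contains the stabiliser of \<open>{e\<^sub>n | n \<in> B}\<close>
  for some \<open>B\<close> with infinite complement.

  Secondly (\<open>finite_stabiliser_captured\<close>), permutations of the basis that carry \<open>B\<close> to continuum many
  almost disjoint sets give an element of \<open>P\<close> that carries \<open>B\<close> to a set \<open>B'\<close> with \<open>F = B \<inter> B'\<close>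
  finite. The stabilisers of \<open>B\<close> and \<open>B'\<close> generate that of \<open>F\<close> in boundedly many factors
  (\<open>stabiliser_of_intersection\<close>), so a power of \<open>P\<close> contains the stabiliser of \<open>F\<close>. For a chain of
  subgroups, a permutation with \<open>F\<close> empty belongs to some member of the chain, which is then all
  of \<open>G\<close>; this is uncountable cofinality.

  Thirdly, capturing a family of rotations gives \<open>v \<in> P\<close> with \<open>\<langle>v e\<^sub>i, e\<^sub>j\<rangle> = c \<delta>\<^sub>i\<^sub>j\<close> on \<open>F\<close> and
  \<open>\<bar>c\<bar> < 1\<close>. Two tuples lie in the same orbit of the stabiliser of \<open>F\<close> exactly if they have the same
  Gram matrix and the same inner products with \<open>F\<close>, and similarly for \<open>v F\<close>. Moving tuples
  alternately by the two stabilisers, one can correct any sufficiently small displacement, because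
  a sufficiently small matrix is always a matrix of inner products between two orthonormal tuples
  (\<open>orthonormal_family_with_prescribed_products\<close>).
\<close>

section \<open>Hilbert spaces over a scalar field with conjugation\<close>

text \<open>
  Real and complex scalars are treated together through these common properties.
\<close>

class hilbert_scalar = real_normed_field + banach + real_inner +
  fixes cj :: "'a \<Rightarrow> 'a"
  assumes cj_add [simp]: "cj (x + y) = cj x + cj y"
    and cj_mult [simp]: "cj (x * y) = cj x * cj y"
    and cj_cj [simp]: "cj (cj x) = x"
    and mult_cj_scaleR: "x * cj x = (norm x)\<^sup>2 *\<^sub>R 1"

instantiation real :: hilbert_scalar
begin
definition cj_real :: "real \<Rightarrow> real" where "cj_real x = x"
instance by standard (auto simp: cj_real_def power2_eq_square)
end

instantiation complex :: hilbert_scalar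
begin
definition cj_complex :: "complex \<Rightarrow> complex" where "cj_complex x = cnj x"
instance
proof
  show "x * cj x = (norm x)\<^sup>2 *\<^sub>R 1" for x :: complex
    unfolding cj_complex_def scaleR_conv_of_real complex_norm_square by simp
qed (simp_all add: cj_complex_def)
end

lemma mult_cj_self: "x * cj x = of_real ((norm (x :: 'a::hilbert_scalar))\<^sup>2)"
  by (simp add: mult_cj_scaleR scaleR_conv_of_real)

lemma cj_0 [simp]: "cj (0 :: 'a::hilbert_scalar) = 0"
  using cj_add[of "0::'a" 0] by (simp del: cj_add)

lemma norm_cj [simp]: "norm (cj (x :: 'a::hilbert_scalar)) = norm x"
proof -
  have "of_real ((norm (cj x))\<^sup>2) = (of_real ((norm x)\<^sup>2) :: 'a)"
    using mult_cj_self[of x] mult_cj_self[of "cj x"] by (simp only: cj_cj mult.commute)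
  then have "(norm (cj x))\<^sup>2 = (norm x)\<^sup>2" by (simp only: of_real_eq_iff)
  then show ?thesis by simp
qed

lemma cj_of_real [simp]: "cj (of_real r :: 'a::hilbert_scalar) = of_real r"
proof (cases "r = 0")
  case False
  have "of_real r * cj (of_real r :: 'a) = of_real r * of_real r"
    by (simp add: mult_cj_self power2_eq_square)
  then show ?thesis using False by simp
qed simp

lemma cj_1 [simp]: "cj (1 :: 'a::hilbert_scalar) = 1"
  using cj_of_real[of 1] by (simp del: cj_of_real)

lemma cj_minus [simp]: "cj (- x :: 'a::hilbert_scalar) = - cj x"
  using cj_add[of x "- x"] by (simp add: add_eq_0_iff del: cj_add)

lemma cj_diff [simp]: "cj (x - y :: 'a::hilbert_scalar) = cj x - cj y"
  using cj_add[of x "- y"] by simp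

lemma cj_sum: "cj (sum f A) = (\<Sum>i\<in>A. cj (f i :: 'a::hilbert_scalar))"
  by (induction A rule: infinite_finite_induct) auto

lemma cj_divide [simp]: "cj (x / y :: 'a::hilbert_scalar) = cj x / cj y"
proof (cases "y = 0")
  case False
  have "cj y \<noteq> 0" using False norm_cj[of y] by (metis norm_eq_zero)
  moreover have "cj (x / y) * cj y = cj x" using False by (simp flip: cj_mult)
  ultimately show ?thesis by (simp add: eq_divide_eq)
qed simp

lemma bounded_linear_cj: "bounded_linear (cj :: 'a::hilbert_scalar \<Rightarrow> 'a)"
  by (rule bounded_linear_intro[where K = 1]) (simp_all add: scaleR_conv_of_real)

definition scal :: "'a::hilbert_scalar \<Rightarrow> 'a ell2 \<Rightarrow> 'a ell2"  (infixr \<open>\<cdot>\<close> 75) where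
  "c \<cdot> x = Abs_ell2 (\<lambda>n. c * coord x n)"

text \<open>
  The scalar-valued inner product, linear in the first argument. It is \<^const>\<open>inner\<close> over the real
  and \<^const>\<open>cinner\<close> over the complex numbers.
\<close>

definition ip :: "'a::hilbert_scalar ell2 \<Rightarrow> 'a ell2 \<Rightarrow> 'a" where
  "ip x y = (\<Sum>n. coord x n * cj (coord y n))"

lemma coord_scal [simp]: "coord (c \<cdot> x) n = c * coord x n"
  by (simp add: scal_def Abs_ell2_inverse norm_mult power_mult_distrib summable_mult summable_coord)

lemma scal_of_real: "of_real r \<cdot> x = r *\<^sub>R x"
  by (rule ell2_eqI) (simp add: scaleR_conv_of_real)

lemma scal_simps [simp]: "1 \<cdot> x = x" "0 \<cdot> x = 0" "c \<cdot> 0 = 0" "c \<cdot> d \<cdot> x = (c * d) \<cdot> x" "(- c) \<cdot> x = - (c \<cdot> x)"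
  "c \<cdot> (- x) = - (c \<cdot> x)"
  by (auto intro!: ell2_eqI)

lemma scal_distribs: "c \<cdot> (x + y) = c \<cdot> x + c \<cdot> y" "(c + d) \<cdot> x = c \<cdot> x + d \<cdot> x"
  "c \<cdot> (x - y) = c \<cdot> x - c \<cdot> y" "(c - d) \<cdot> x = c \<cdot> x - d \<cdot> x"
  by (auto intro!: ell2_eqI simp: algebra_simps)

lemma summable_ip: "summable (\<lambda>n. coord x n * cj (coord y n))"
proof (rule summable_comparison_test')
  show "summable (\<lambda>n. (norm (coord x n))\<^sup>2 + (norm (coord y n))\<^sup>2)"
    by (intro summable_add summable_coord)
  show "norm (coord x n * cj (coord y n)) \<le> (norm (coord x n))\<^sup>2 + (norm (coord y n))\<^sup>2" for n
    using norm_mult_le_squares[of "coord x n" "coord y n"] by (simp add: norm_mult)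
qed

lemma ip_add_left: "ip (x + y) z = ip x z + ip y z"
  by (simp add: ip_def distrib_right suminf_add summable_ip)

lemma ip_scal_left: "ip (c \<cdot> x) y = c * ip x y"
  by (simp add: ip_def mult.assoc suminf_mult summable_ip)

lemma cj_ip: "cj (ip x y) = ip y x"
  unfolding ip_def
  by (subst bounded_linear.suminf[OF bounded_linear_cj summable_ip]) (simp add: mult.commute)

lemma ip_add_right: "ip x (y + z) = ip x y + ip x z"
  by (metis cj_ip cj_add ip_add_left)

lemma ip_scal_right: "ip x (c \<cdot> y) = cj c * ip x y"
  by (metis cj_ip cj_mult ip_scal_left)

lemma ip_0 [simp]: "ip 0 x = 0" "ip x 0 = 0"
  by (simp_all add: ip_def)

lemma ip_minus_left: "ip (- x) y = - ip x y"
  using ip_add_left[of x "- x" y] by (simp add: add_eq_0_iff)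

lemma ip_minus_right: "ip x (- y) = - ip x y"
  using ip_add_right[of x y "- y"] by (simp add: add_eq_0_iff)

lemma ip_diff_left: "ip (x - y) z = ip x z - ip y z"
  using ip_add_left[of x "- y" z] by (simp add: ip_minus_left)

lemma ip_diff_right: "ip x (y - z) = ip x y - ip x z"
  using ip_add_right[of x y "- z"] by (simp add: ip_minus_right)

lemma ip_sum_left: "ip (sum f A) y = (\<Sum>i\<in>A. ip (f i) y)"
  by (induction A rule: infinite_finite_induct) (auto simp: ip_add_left)

lemma ip_sum_right: "ip y (sum f A) = (\<Sum>i\<in>A. ip y (f i))"
  by (induction A rule: infinite_finite_induct) (auto simp: ip_add_right)

lemma norm_ell2_sq: "(norm (x :: 'a::real_inner ell2))\<^sup>2 = (\<Sum>n. (norm (coord x n))\<^sup>2)"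
  by (simp add: power2_norm_eq_inner inner_ell2_def)

lemma ip_self: "ip x x = of_real ((norm x)\<^sup>2)"
  by (simp only: ip_def mult_cj_self norm_ell2_sq suminf_of_real[OF summable_coord])

lemma ip_self_eq_0 [simp]: "ip x x = 0 \<longleftrightarrow> x = 0"
  by (simp add: ip_self)

lemma norm_eq_if_ip_eq: "ip x x = ip y y \<Longrightarrow> norm x = norm y"
  unfolding ip_self of_real_eq_iff by simp

lemma norm_scal: "norm (c \<cdot> x) = norm c * norm x"
proof -
  have "(norm (c \<cdot> x))\<^sup>2 = (norm c * norm x)\<^sup>2"
    by (simp add: norm_ell2_sq norm_mult power_mult_distrib suminf_mult summable_coord)
  then show ?thesis by simp
qed

lemma norm_ip_le: "norm (ip x y) \<le> norm x * norm y"
proof (cases "y = 0")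
  case False
  define t where "t = ip x y / of_real ((norm y)\<^sup>2)"
  have ty: "t * ip y y = ip x y" using False by (simp add: t_def ip_self)
  have "ip (x - t \<cdot> y) (x - t \<cdot> y) = ip x x - cj t * ip x y - t * ip y x + cj t * (t * ip y y)"
    by (simp add: ip_diff_left ip_diff_right ip_scal_left ip_scal_right algebra_simps)
  also have "\<dots> = ip x x - t * cj (ip x y)" by (simp add: ty cj_ip)
  also have "\<dots> = of_real ((norm x)\<^sup>2 - (norm (ip x y))\<^sup>2 / (norm y)\<^sup>2)"
    by (simp add: t_def ip_self mult_cj_self)
  finally have "(norm (x - t \<cdot> y))\<^sup>2 = (norm x)\<^sup>2 - (norm (ip x y))\<^sup>2 / (norm y)\<^sup>2"
    unfolding ip_self of_real_eq_iff .
  then have "(norm (ip x y))\<^sup>2 / (norm y)\<^sup>2 \<le> (norm x)\<^sup>2"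
    by (metis diff_ge_0_iff_ge zero_le_power2)
  then have "(norm (ip x y))\<^sup>2 \<le> (norm x * norm y)\<^sup>2"
    using False by (simp add: divide_le_eq power_mult_distrib)
  then show ?thesis by (rule power2_le_imp_le) simp
qed simp

lemma tendsto_ip:
  fixes x y :: "'a::hilbert_scalar ell2"
  assumes "(f \<longlongrightarrow> x) F" "(g \<longlongrightarrow> y) F"
  shows "((\<lambda>n. ip (f n) (g n)) \<longlongrightarrow> ip x y) F"
proof -
  have "bounded_bilinear (ip :: 'a ell2 \<Rightarrow> 'a ell2 \<Rightarrow> 'a)"
    by (rule bounded_bilinear.intro; (rule exI[of _ 1])?)
       (simp_all add: ip_add_left ip_add_right scaleR_conv_of_real ip_scal_left ip_scal_right norm_ip_le flip: scal_of_real)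
  then show ?thesis using assms by (rule bounded_bilinear.tendsto)
qed

subsection \<open>Completeness\<close>

lemma norm_coord_le: "norm (coord x n) \<le> norm (x :: 'a::real_inner ell2)"
proof -
  have "(norm (coord x n))\<^sup>2 \<le> (\<Sum>n. (norm (coord x n))\<^sup>2)"
    using sum_le_suminf[OF summable_coord[of x], of "{n}"] by simp
  then show ?thesis by (simp flip: norm_ell2_sq)
qed

text \<open>
  Completeness is what turns an orthonormal basis into a unitary operator: the image of a vector
  under the operator is an infinite series.
\<close>

instance ell2 :: ("{real_inner, complete_space}") complete_space
proof
  fix X :: "nat \<Rightarrow> 'a ell2" assume X: "Cauchy X"
  have "Cauchy (\<lambda>k. coord (X k) n)" for n
  proof (rule metric_CauchyI)
    fix e :: real assume "e > 0"
    then obtain M where M: "\<And>k l. k \<ge> M \<Longrightarrow> l \<ge> M \<Longrightarrow> dist (X k) (X l) < e"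
      using X unfolding Cauchy_def by blast
    then show "\<exists>M. \<forall>k\<ge>M. \<forall>l\<ge>M. dist (coord (X k) n) (coord (X l) n) < e"
      by (metis coord_diff dist_norm norm_coord_le order.strict_trans1)
  qed
  then obtain c where c: "\<And>n. (\<lambda>k. coord (X k) n) \<longlonglongrightarrow> c n"
    unfolding Cauchy_convergent_iff convergent_def by metis
  have tail: "(\<Sum>n<N. (norm (coord (X k) n - c n))\<^sup>2) \<le> e\<^sup>2"
    if e: "\<And>l. l \<ge> k \<Longrightarrow> dist (X k) (X l) < e" for k N e
  proof (rule tendsto_upperbound)
    show "(\<lambda>l. \<Sum>n<N. (norm (coord (X k) n - coord (X l) n))\<^sup>2) \<longlonglongrightarrow> (\<Sum>n<N. (norm (coord (X k) n - c n))\<^sup>2)"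
      by (intro tendsto_intros c)
    have "(\<Sum>n<N. (norm (coord (X k) n - coord (X l) n))\<^sup>2) \<le> e\<^sup>2" if "l \<ge> k" for l
    proof -
      have "(\<Sum>n<N. (norm (coord (X k - X l) n))\<^sup>2) \<le> (norm (X k - X l))\<^sup>2"
        unfolding norm_ell2_sq by (rule sum_le_suminf[OF summable_coord]) auto
      also have "\<dots> \<le> e\<^sup>2" using e[OF that] by (intro power_mono) (auto simp: dist_norm)
      finally show ?thesis by simp
    qed
    then show "\<forall>\<^sub>F l in sequentially. (\<Sum>n<N. (norm (coord (X k) n - coord (X l) n))\<^sup>2) \<le> e\<^sup>2"
      by (auto simp: eventually_sequentially)
  qed simp
  have summ: "summable (\<lambda>n. (norm (coord (X k) n - c n))\<^sup>2)"
    if e: "\<And>l. l \<ge> k \<Longrightarrow> dist (X k) (X l) < e" for k e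
    by (rule summableI_nonneg_bounded[of _ "e\<^sup>2"]) (use tail[OF e] in auto)
  obtain K where K: "\<And>k l. k \<ge> K \<Longrightarrow> l \<ge> K \<Longrightarrow> dist (X k) (X l) < 1"
    using X unfolding Cauchy_def by (meson zero_less_one)
  have "summable (\<lambda>n. (norm (coord (X K) n - c n))\<^sup>2)" using K by (intro summ) auto
  then have XK: "coord (Abs_ell2 (\<lambda>n. coord (X K) n - c n)) n = coord (X K) n - c n" for n
    by (simp add: Abs_ell2_inverse)
  define x where "x = X K - Abs_ell2 (\<lambda>n. coord (X K) n - c n)"
  have x: "coord x n = c n" for n by (simp add: x_def XK)
  have "X \<longlonglongrightarrow> x"
  proof (rule metric_LIMSEQ_I)
    fix r :: real assume "r > 0"
    then obtain M where M: "\<And>k l. k \<ge> M \<Longrightarrow> l \<ge> M \<Longrightarrow> dist (X k) (X l) < r / 2"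
      using X unfolding Cauchy_def by (meson half_gt_zero)
    have "dist (X k) x < r" if "k \<ge> M" for k
    proof -
      have e: "\<And>l. l \<ge> k \<Longrightarrow> dist (X k) (X l) < r / 2" using M that by auto
      have "(norm (X k - x))\<^sup>2 \<le> (r / 2)\<^sup>2"
        unfolding norm_ell2_sq by (rule suminf_le_const[OF summable_coord]) (use tail[OF e] in \<open>simp add: x\<close>)
      then have "norm (X k - x) \<le> r / 2" by (rule power2_le_imp_le) (use \<open>r > 0\<close> in simp)
      then show ?thesis using \<open>r > 0\<close> by (simp add: dist_norm)
    qed
    then show "\<exists>no. \<forall>n\<ge>no. dist (X n) x < r" by blast
  qed
  then show "convergent X" by (auto simp: convergent_def)
qed

section \<open>Unitary operators and orthonormal bases\<close>

abbreviation ginv :: "('a \<Rightarrow> 'a) \<Rightarrow> 'a \<Rightarrow> 'a" where "ginv g \<equiv> inv_into UNIV g"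

definition unitaries :: "('a::hilbert_scalar ell2 \<Rightarrow> 'a ell2) set" where
  "unitaries = {g. (\<forall>x y. g (x + y) = g x + g y) \<and> (\<forall>c x. g (c \<cdot> x) = c \<cdot> g x) \<and> bij g \<and>
                   (\<forall>x y. ip (g x) (g y) = ip x y)}"

lemma unitary_add: "g \<in> unitaries \<Longrightarrow> g (x + y) = g x + g y"
  and unitary_scal: "g \<in> unitaries \<Longrightarrow> g (c \<cdot> x) = c \<cdot> g x"
  and unitary_bij: "g \<in> unitaries \<Longrightarrow> bij g"
  and unitary_ip: "g \<in> unitaries \<Longrightarrow> ip (g x) (g y) = ip x y"
  by (auto simp: unitaries_def)

lemma unitary_0: "g \<in> unitaries \<Longrightarrow> g 0 = 0"
  by (metis scal_simps(2) unitary_scal)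

lemma unitary_uminus: "g \<in> unitaries \<Longrightarrow> g (- x) = - g x"
  using unitary_scal[of g "-1" x] by simp

lemma unitary_diff: "g \<in> unitaries \<Longrightarrow> g (x - y) = g x - g y"
  using unitary_add[of g x "- y"] by (simp add: unitary_uminus)

lemma unitary_norm: "g \<in> unitaries \<Longrightarrow> norm (g x) = norm x"
  by (intro norm_eq_if_ip_eq unitary_ip)

lemma unitary_ginv [simp]:
  assumes "g \<in> unitaries" shows "g (ginv g x) = x" "ginv g (g x) = x"
  using unitary_bij[OF assms] by (simp_all add: bij_def surj_f_inv_f)

lemma unitary_inj: "g \<in> unitaries \<Longrightarrow> g x = g y \<longleftrightarrow> x = y"
  by (metis unitary_ginv(2))

lemma id_in_unitaries [simp]: "id \<in> unitaries"
  by (simp add: unitaries_def)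

lemma comp_in_unitaries [simp]: "g \<in> unitaries \<Longrightarrow> h \<in> unitaries \<Longrightarrow> g \<circ> h \<in> unitaries"
  by (auto simp: unitaries_def bij_comp)

lemma ginv_in_unitaries [simp]:
  assumes "g \<in> unitaries" shows "ginv g \<in> unitaries"
proof -
  have "ginv g (x + y) = ginv g x + ginv g y" "ginv g (c \<cdot> x) = c \<cdot> ginv g x" for x y c
    using assms by (simp_all add: unitary_add unitary_scal flip: unitary_inj[OF assms])
  moreover have "ip (ginv g x) (ginv g y) = ip x y" for x y
    using unitary_ip[OF assms, of "ginv g x" "ginv g y"] assms by simp
  ultimately show ?thesis
    using assms by (auto simp: unitaries_def bij_imp_bij_inv)
qed

lemma ginv_comp: "g \<in> unitaries \<Longrightarrow> h \<in> unitaries \<Longrightarrow> ginv (g \<circ> h) = ginv h \<circ> ginv g"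
  by (simp add: unitary_bij o_inv_distrib)

lemma ginv_ginv: "g \<in> unitaries \<Longrightarrow> ginv (ginv g) = g"
  by (simp add: unitary_bij inv_inv_eq)

lemma ip_ginv: "g \<in> unitaries \<Longrightarrow> ip (ginv g x) y = ip x (g y)"
  by (metis unitary_ginv(1) unitary_ip)

definition orthonormal :: "'i set \<Rightarrow> ('i \<Rightarrow> 'a::hilbert_scalar ell2) \<Rightarrow> bool" where
  "orthonormal I b \<longleftrightarrow> (\<forall>i\<in>I. \<forall>j\<in>I. ip (b i) (b j) = (if i = j then 1 else 0))"

text \<open>
  Totality is expressed by a trivial orthogonal complement instead of a dense span. This is the form
  that maximal orthonormal sets have at once.
\<close>

definition total_family :: "'i set \<Rightarrow> ('i \<Rightarrow> 'a::hilbert_scalar ell2) \<Rightarrow> bool" where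
  "total_family I b \<longleftrightarrow> (\<forall>x. (\<forall>i\<in>I. ip x (b i) = 0) \<longrightarrow> x = 0)"

lemma orthonormalD: "orthonormal I b \<Longrightarrow> i \<in> I \<Longrightarrow> j \<in> I \<Longrightarrow> ip (b i) (b j) = (if i = j then 1 else 0)"
  by (simp add: orthonormal_def)

lemma orthonormal_subset: "orthonormal I b \<Longrightarrow> J \<subseteq> I \<Longrightarrow> orthonormal J b"
  unfolding orthonormal_def by blast

lemma orthonormal_inj_on: "orthonormal I b \<Longrightarrow> inj_on b I"
  unfolding inj_on_def orthonormal_def by (metis one_neq_zero)

lemma orthonormal_unitary: "g \<in> unitaries \<Longrightarrow> orthonormal I b \<Longrightarrow> orthonormal I (\<lambda>i. g (b i))"
  by (auto simp: orthonormal_def unitary_ip)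

lemma norm_orthonormal: "orthonormal I b \<Longrightarrow> i \<in> I \<Longrightarrow> norm (b i) = 1"
  using orthonormalD[of I b i i] ip_self[of "b i"]
  by (metis norm_ge_zero of_real_eq_1_iff power2_eq_1_iff power2_eq_square real_sqrt_abs real_sqrt_one abs_norm_cancel)

lemma ip_orthonormal_sums:
  assumes "orthonormal F b" "finite F"
  shows "ip (\<Sum>i\<in>F. c i \<cdot> b i) (\<Sum>i\<in>F. d i \<cdot> b i) = (\<Sum>i\<in>F. c i * cj (d i))"
proof -
  have "ip (\<Sum>i\<in>F. c i \<cdot> b i) (\<Sum>j\<in>F. d j \<cdot> b j) = (\<Sum>i\<in>F. \<Sum>j\<in>F. c i * cj (d j) * ip (b i) (b j))"
    unfolding ip_sum_left unfolding ip_sum_right by (simp add: ip_scal_left ip_scal_right mult_ac)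
  also have "\<dots> = (\<Sum>i\<in>F. \<Sum>j\<in>F. if i = j then c i * cj (d j) else 0)"
    using assms(1) by (intro sum.cong) (auto simp: orthonormal_def)
  finally show ?thesis using assms(2) by simp
qed

lemma ip_orthonormal_sum_right:
  assumes "orthonormal F b" "finite F" "j \<in> F"
  shows "ip (\<Sum>i\<in>F. c i \<cdot> b i) (b j) = c j"
proof -
  have "ip (\<Sum>i\<in>F. c i \<cdot> b i) (b j) = (\<Sum>i\<in>F. if i = j then c i else 0)"
    unfolding ip_sum_left ip_scal_left using assms by (intro sum.cong) (auto simp: orthonormal_def)
  then show ?thesis using assms by simp
qed

lemma norm_orthonormal_sum:
  assumes "orthonormal F b" "finite F"
  shows "(norm (\<Sum>i\<in>F. c i \<cdot> b i))\<^sup>2 = (\<Sum>i\<in>F. (norm (c i))\<^sup>2)"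
proof -
  have "of_real ((norm (\<Sum>i\<in>F. c i \<cdot> b i))\<^sup>2) = (of_real (\<Sum>i\<in>F. (norm (c i))\<^sup>2) :: 'b)"
    unfolding ip_self[symmetric] ip_orthonormal_sums[OF assms] by (simp add: mult_cj_self)
  then show ?thesis by (simp only: of_real_eq_iff)
qed

lemma bessel:
  assumes "orthonormal F b" "finite F"
  shows "(\<Sum>i\<in>F. (norm (ip x (b i)))\<^sup>2) \<le> (norm x)\<^sup>2"
proof -
  define p where "p = (\<Sum>i\<in>F. ip x (b i) \<cdot> b i)"
  have "ip x p = (\<Sum>i\<in>F. ip x (b i) * cj (ip x (b i)))"
    by (simp add: p_def ip_sum_right ip_scal_right mult.commute)
  also have "\<dots> = ip p p" by (simp add: p_def ip_orthonormal_sums[OF assms])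
  finally have xp: "ip x p = ip p p" .
  then have "ip p x = ip p p" by (metis cj_ip)
  with xp have "ip (x - p) (x - p) = ip x x - ip p p"
    by (simp add: ip_diff_left ip_diff_right)
  then have "of_real ((norm (x - p))\<^sup>2) = (of_real ((norm x)\<^sup>2 - (norm p)\<^sup>2) :: 'b)"
    by (simp only: ip_self of_real_diff)
  then have "(norm (x - p))\<^sup>2 = (norm x)\<^sup>2 - (norm p)\<^sup>2"
    by (simp only: of_real_eq_iff)
  moreover have "(norm p)\<^sup>2 = (\<Sum>i\<in>F. (norm (ip x (b i)))\<^sup>2)"
    unfolding p_def by (rule norm_orthonormal_sum[OF assms])
  ultimately show ?thesis using zero_le_power2[of "norm (x - p)"] by linarith
qed

subsection \<open>The standard basis\<close>

definition ket :: "nat \<Rightarrow> 'a::hilbert_scalar ell2" where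
  "ket n = Abs_ell2 (\<lambda>k. if k = n then 1 else 0)"

lemma coord_ket [simp]: "coord (ket n) k = (if k = n then 1 else 0)"
proof -
  have "summable (\<lambda>k. (norm (if k = n then 1 else 0 :: 'a))\<^sup>2)"
    by (rule summable_finite[of "{n}"]) auto
  then show ?thesis by (simp add: ket_def Abs_ell2_inverse)
qed

lemma ip_ket [simp]: "ip x (ket n) = coord x n"
proof -
  have "ip x (ket n) = (\<Sum>k\<in>{n}. coord x k * cj (coord (ket n) k))"
    unfolding ip_def by (rule suminf_finite) auto
  then show ?thesis by simp
qed

lemma ip_ket_left: "ip (ket n) x = cj (coord x n)"
  by (metis ip_ket cj_ip)

lemma orthonormal_ket: "orthonormal I ket"
  by (simp add: orthonormal_def)

definition supp :: "'a::real_inner ell2 \<Rightarrow> nat set" where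
  "supp x = {n. coord x n \<noteq> 0}"

lemma supp_ket [simp]: "supp (ket n) = {n}"
  by (auto simp: supp_def)

lemma ip_disjoint_supp: "supp x \<inter> supp y = {} \<Longrightarrow> ip x y = 0"
proof -
  assume "supp x \<inter> supp y = {}"
  then have "coord x n * cj (coord y n) = 0" for n by (auto simp: supp_def)
  then show ?thesis by (simp only: ip_def suminf_zero)
qed

lemma supp_add: "supp (x + y) \<subseteq> supp x \<union> supp y" and supp_scal: "supp (c \<cdot> z) \<subseteq> supp z"
  by (auto simp: supp_def)

text \<open>
  Any unitary that fixes \<open>e\<^sub>n\<close> for all \<open>n\<close> in \<open>A\<close> fixes the closed span of these vectors pointwise.
  The proof avoids limits: the inverse image of a basis vector outside \<open>A\<close> is again supported
  outside \<open>A\<close>, so its product with \<open>x\<close> vanishes.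
\<close>

lemma unitary_fixes_supported:
  assumes g: "g \<in> unitaries" and fixed: "\<And>n. n \<in> A \<Longrightarrow> g (ket n) = ket n" and x: "supp x \<subseteq> A"
  shows "g x = x"
proof (rule ell2_eqI)
  fix n
  show "coord (g x) n = coord x n"
  proof (cases "n \<in> A")
    case True
    then have "coord (g x) n = ip (g x) (g (ket n))" by (simp add: fixed)
    then show ?thesis by (simp add: unitary_ip[OF g])
  next
    case False
    have "coord (ginv g (ket n)) m = 0" if "m \<in> A" for m
      using that False ip_ginv[OF g, of "ket n" "ket m"] by (auto simp: fixed)
    then have "ip (ginv g (ket n)) x = 0"
      by (intro ip_disjoint_supp) (use x in \<open>auto simp: supp_def\<close>)
    then have "coord (g x) n = 0"
      by (metis cj_0 cj_ip ip_ginv[OF g] ip_ket)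
    moreover have "coord x n = 0" using False x by (auto simp: supp_def)
    ultimately show ?thesis by simp
  qed
qed

lemma unitary_eq_on_supported:
  assumes g: "g \<in> unitaries" and h: "h \<in> unitaries"
    and eq: "\<And>n. n \<in> A \<Longrightarrow> g (ket n) = h (ket n)" and x: "supp x \<subseteq> A"
  shows "g x = h x"
proof -
  have "(ginv h \<circ> g) x = x"
    by (rule unitary_fixes_supported[OF comp_in_unitaries[OF ginv_in_unitaries[OF h] g] _ x])
       (simp add: eq h)
  then show ?thesis using h by (metis comp_apply unitary_ginv(1))
qed

lemma unitary_eqI:
  "g \<in> unitaries \<Longrightarrow> h \<in> unitaries \<Longrightarrow> (\<And>n. g (ket n) = h (ket n)) \<Longrightarrow> g = h"
  by (rule ext, rule unitary_eq_on_supported[of _ _ UNIV]) auto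

lemma unitary_preserves_cosupport:
  assumes g: "g \<in> unitaries" and fixed: "\<And>n. n \<in> A \<Longrightarrow> g (ket n) = ket n" and x: "supp x \<inter> A = {}"
  shows "supp (g x) \<inter> A = {}"
proof -
  have "coord (g x) n = 0" if "n \<in> A" for n
  proof -
    have "coord (g x) n = ip (g x) (g (ket n))" by (simp add: fixed that)
    also have "\<dots> = coord x n" by (simp add: unitary_ip[OF g])
    finally show ?thesis using x that by (auto simp: supp_def)
  qed
  then show ?thesis by (auto simp: supp_def)
qed

subsection \<open>Unitaries from bases\<close>

lemma orthonormal_series_converges:
  assumes b: "orthonormal UNIV b"
  shows "convergent (\<lambda>N. \<Sum>n<N. coord x n \<cdot> b n)"
proof -
  let ?S = "\<lambda>N. \<Sum>n<N. coord x n \<cdot> b n" and ?T = "\<lambda>N. \<Sum>n<N. (norm (coord x n))\<^sup>2"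
  have ord: "(dist (?S M) (?S N))\<^sup>2 = dist (?T M) (?T N)" if "M \<le> N" for M N :: nat
  proof -
    have split: "{..<N} = {..<M} \<union> {M..<N}" "{..<M} \<inter> {M..<N} = {}" using that by auto
    have "dist (?S M) (?S N) = norm (\<Sum>n=M..<N. coord x n \<cdot> b n)"
      unfolding dist_commute[of "?S M"] split(1) by (subst sum.union_disjoint) (auto simp: dist_norm)
    moreover have "dist (?T M) (?T N) = (\<Sum>n=M..<N. (norm (coord x n))\<^sup>2)"
      unfolding dist_commute[of "?T M"] split(1)
      by (subst sum.union_disjoint) (auto simp: dist_norm sum_nonneg abs_of_nonneg)
    ultimately show ?thesis
      using norm_orthonormal_sum[OF orthonormal_subset[OF b], of "{M..<N}"] by simp
  qed
  have dist_eq: "(dist (?S M) (?S N))\<^sup>2 = dist (?T M) (?T N)" for M N :: nat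
    using ord[of M N] ord[of N M] by (cases "M \<le> N") (auto simp: dist_commute)
  have T: "Cauchy ?T"
    using summable_coord[of x] by (simp add: Cauchy_convergent_iff summable_iff_convergent)
  have "Cauchy ?S"
  proof (rule metric_CauchyI)
    fix e :: real assume e: "e > 0"
    then obtain K where "\<And>M N. M \<ge> K \<Longrightarrow> N \<ge> K \<Longrightarrow> dist (?T M) (?T N) < e\<^sup>2"
      using metric_CauchyD[OF T, of "e\<^sup>2"] by auto
    then have "\<And>M N. M \<ge> K \<Longrightarrow> N \<ge> K \<Longrightarrow> (dist (?S M) (?S N))\<^sup>2 < e\<^sup>2" unfolding dist_eq .
    then have "\<And>M N. M \<ge> K \<Longrightarrow> N \<ge> K \<Longrightarrow> dist (?S M) (?S N) < e"
      using e by (meson power2_less_imp_less less_imp_le)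
    then show "\<exists>K. \<forall>M\<ge>K. \<forall>N\<ge>K. dist (?S M) (?S N) < e" by blast
  qed
  then show ?thesis by (rule Cauchy_convergent)
qed

text \<open>
  This is the Riesz-Fischer theorem. Surjectivity is where totality enters: the vector whose
  coordinates are the Fourier coefficients of \<open>y\<close>, which are square summable by Bessel's inequality,
  is mapped to a vector that differs from \<open>y\<close> by something orthogonal to the basis.
\<close>

lemma unitary_of_orthonormal_basis:
  assumes b: "orthonormal UNIV b" and tot: "total_family UNIV b"
  shows "\<exists>g\<in>unitaries. \<forall>n. g (ket n) = b n"
proof -
  define g where "g x = lim (\<lambda>N. \<Sum>n<N. coord x n \<cdot> b n)" for x
  have g: "(\<lambda>N. \<Sum>n<N. coord x n \<cdot> b n) \<longlonglongrightarrow> g x" for x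
    using orthonormal_series_converges[OF b] unfolding g_def convergent_LIMSEQ_iff .
  have ip_g: "ip (g x) (g y) = ip x y" for x y
  proof (rule LIMSEQ_unique)
    show "(\<lambda>N. ip (\<Sum>n<N. coord x n \<cdot> b n) (\<Sum>n<N. coord y n \<cdot> b n)) \<longlonglongrightarrow> ip (g x) (g y)"
      by (intro tendsto_ip g)
    show "(\<lambda>N. ip (\<Sum>n<N. coord x n \<cdot> b n) (\<Sum>n<N. coord y n \<cdot> b n)) \<longlonglongrightarrow> ip x y"
      unfolding ip_orthonormal_sums[OF orthonormal_subset[OF b subset_UNIV] finite_lessThan]
      using summable_LIMSEQ[OF summable_ip[of x y]] by (simp only: ip_def)
  qed
  have g_add: "g (x + y) = g x + g y" for x y
    by (rule LIMSEQ_unique[OF g]) (use tendsto_add[OF g[of x] g[of y]] in \<open>simp add: scal_distribs sum.distrib\<close>)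
  have ket: "g (ket n) = b n" for n
  proof (rule LIMSEQ_unique[OF g])
    have "(\<Sum>k<N. coord (ket n) k \<cdot> b k) = b n" if "N > n" for N
    proof -
      have "(\<Sum>k<N. coord (ket n) k \<cdot> b k) = (\<Sum>k<N. if k = n then b k else 0)"
        by (intro sum.cong) auto
      then show ?thesis using that by simp
    qed
    then show "(\<lambda>N. \<Sum>k<N. coord (ket n) k \<cdot> b k) \<longlonglongrightarrow> b n"
      by (intro tendsto_eventually) (auto simp: eventually_sequentially intro!: exI[of _ "Suc n"])
  qed
  have g_scal: "g (c \<cdot> x) = c \<cdot> g x" for c x
  proof -
    have "ip (g (c \<cdot> x) - c \<cdot> g x) (g (c \<cdot> x) - c \<cdot> g x) = 0"
      by (simp add: ip_diff_left ip_diff_right ip_scal_left ip_scal_right ip_g)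
    then show ?thesis by simp
  qed
  have "inj g"
  proof (rule injI)
    fix x y assume eq: "g x = g y"
    have "ip (x - y) (x - y) = ip (g x) (g x) - ip (g x) (g y) - (ip (g y) (g x) - ip (g y) (g y))"
      by (simp add: ip_diff_left ip_diff_right ip_g)
    then have "ip (x - y) (x - y) = 0" unfolding eq by simp
    then show "x = y" by simp
  qed
  moreover have "surj g"
  proof (rule surjI)
    fix y
    have "summable (\<lambda>n. (norm (ip y (b n)))\<^sup>2)"
      by (rule summableI_nonneg_bounded[of _ "(norm y)\<^sup>2"])
         (use bessel[OF orthonormal_subset[OF b]] in auto)
    then have x: "coord (Abs_ell2 (\<lambda>n. ip y (b n))) n = ip y (b n)" for n
      by (simp add: Abs_ell2_inverse)
    let ?x = "Abs_ell2 (\<lambda>n. ip y (b n))"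
    have "ip (g ?x - y) (b n) = 0" for n
      using ip_g[of ?x "ket n"] by (simp add: ip_diff_left ket x)
    then have "g ?x - y = 0" using tot unfolding total_family_def by blast
    then show "g ?x = y" by simp
  qed
  ultimately have "g \<in> unitaries"
    by (auto simp: unitaries_def bij_def g_add g_scal ip_g)
  then show ?thesis using ket by blast
qed

lemma unitary_change_of_basis:
  assumes "orthonormal UNIV b" "total_family UNIV b" "orthonormal UNIV b'" "total_family UNIV b'"
  shows "\<exists>g\<in>unitaries. \<forall>n::nat. g (b n) = b' n"
proof -
  obtain h h' where h: "h \<in> unitaries" "\<And>n. h (ket n) = b n" and h': "h' \<in> unitaries" "\<And>n. h' (ket n) = b' n"
    using assms unitary_of_orthonormal_basis by metis
  then have "h' \<circ> ginv h \<in> unitaries" "(h' \<circ> ginv h) (b n) = b' n" for n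
    by (simp_all flip: h(2))
  then show ?thesis by blast
qed

text \<open>
  By Bessel's inequality each coordinate exceeds \<open>1 / (k + 1)\<close> on only finitely many members of the set.
\<close>

lemma orthonormal_set_countable:
  assumes T: "orthonormal T (\<lambda>x :: 'a::hilbert_scalar ell2. x)"
  shows "countable T"
proof -
  have fin: "finite {t \<in> T. norm (coord t n) > 1 / Suc k}" for n k
  proof (rule conjunct1[OF finite_if_finite_subsets_card_bdd[of _ "(Suc k)\<^sup>2"]])
    fix F assume F: "F \<subseteq> {t \<in> T. norm (coord t n) > 1 / Suc k}" "finite F"
    have "real (card F) * (1 / Suc k)\<^sup>2 = (\<Sum>t\<in>F. (1 / Suc k)\<^sup>2)" by simp
    also have "\<dots> \<le> (\<Sum>t\<in>F. (norm (ip (ket n) t))\<^sup>2)"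
      using F by (intro sum_mono power_mono) (auto simp: ip_ket_left intro: less_imp_le)
    also have "\<dots> \<le> (norm (ket n :: 'a ell2))\<^sup>2"
      by (rule bessel[OF orthonormal_subset[OF T]]) (use F in auto)
    also have "norm (ket n :: 'a ell2) = 1" by (rule norm_orthonormal[OF orthonormal_ket UNIV_I])
    finally have "real (card F) \<le> (real (Suc k))\<^sup>2" by (simp add: power_divide field_simps)
    then show "card F \<le> (Suc k)\<^sup>2" by (simp only: of_nat_le_iff flip: of_nat_power)
  qed
  have "T \<subseteq> (\<Union>n. \<Union>k. {t \<in> T. norm (coord t n) > 1 / Suc k})"
  proof
    fix t assume t: "t \<in> T"
    then have "t \<noteq> 0" using orthonormalD[OF T t t] by auto
    then obtain n where "coord t n \<noteq> 0" by (metis ell2_eqI coord_zero)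
    then obtain k where "1 / Suc k < norm (coord t n)"
      by (metis nat_approx_posE zero_less_norm_iff)
    then show "t \<in> (\<Union>n. \<Union>k. {t \<in> T. norm (coord t n) > 1 / Suc k})" using t by blast
  qed
  then show ?thesis by (rule countable_subset) (intro countable_UN countableI_type countable_finite fin)
qed

text \<open>
  A maximal orthonormal set is total, since a nonzero vector orthogonal to it could be normalised
  and added.
\<close>

lemma orthonormal_set_extends_to_total:
  fixes S :: "'a::hilbert_scalar ell2 set"
  assumes S: "orthonormal S (\<lambda>x. x)"
  shows "\<exists>T. S \<subseteq> T \<and> orthonormal T (\<lambda>x. x) \<and> total_family T (\<lambda>x. x)"
proof -
  let ?A = "{T. S \<subseteq> T \<and> orthonormal T (\<lambda>x. x)}"
  have "\<exists>M\<in>?A. \<forall>X\<in>?A. M \<subseteq> X \<longrightarrow> X = M"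
  proof (rule subset_Zorn_nonempty)
    show "?A \<noteq> {}" using S by auto
    fix C assume C: "C \<noteq> {}" "subset.chain ?A C"
    have "orthonormal (\<Union>C) (\<lambda>x. x)"
      unfolding orthonormal_def
    proof (intro ballI)
      fix x y assume "x \<in> \<Union>C" "y \<in> \<Union>C"
      then obtain X Y where XY: "X \<in> C" "x \<in> X" "Y \<in> C" "y \<in> Y" by auto
      then obtain Z where "Z \<in> C" "x \<in> Z" "y \<in> Z" using C(2) unfolding subset_chain_def by blast
      then show "ip x y = (if x = y then 1 else 0)"
        using C(2) orthonormalD[of Z "\<lambda>x. x" x y] unfolding subset_chain_def by blast
    qed
    then show "\<Union>C \<in> ?A" using C unfolding subset_chain_def by blast
  qed
  then obtain T where TA: "T \<in> ?A" and max_A: "\<forall>X\<in>?A. T \<subseteq> X \<longrightarrow> X = T" by (rule bexE)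
  have T: "S \<subseteq> T" "orthonormal T (\<lambda>x. x)" using TA by auto
  have max: "X = T" if "orthonormal X (\<lambda>x. x)" "T \<subseteq> X" for X
    using max_A that T(1) by auto
  have "x = 0" if x: "\<And>t. t \<in> T \<Longrightarrow> ip x t = 0" for x
  proof (rule ccontr)
    assume "x \<noteq> 0"
    define y where "y = of_real (1 / norm x) \<cdot> x"
    have "norm y = 1" using \<open>x \<noteq> 0\<close> by (simp add: y_def norm_scal norm_divide)
    then have yy: "ip y y = 1" by (simp add: ip_self)
    have yt: "ip y t = 0" "ip t y = 0" if "t \<in> T" for t
    proof -
      show "ip y t = 0" using x[OF that] by (simp add: y_def ip_scal_left)
      then show "ip t y = 0" by (metis cj_0 cj_ip)
    qed
    have "orthonormal (insert y T) (\<lambda>x. x)"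
      using T(2) yy yt unfolding orthonormal_def by (metis insert_iff one_neq_zero)
    then have "y \<in> T" using max by blast
    then show False using yt yy by simp
  qed
  then show ?thesis using T by (auto simp: total_family_def)
qed

lemma orthonormal_family_extends_to_basis:
  fixes b :: "nat \<Rightarrow> 'a::hilbert_scalar ell2"
  assumes b: "orthonormal A b" and IA: "I \<subseteq> A" and inf: "infinite (A - I)"
  shows "\<exists>c. orthonormal UNIV c \<and> total_family UNIV c \<and> (\<forall>i\<in>I. c i = b i)"
proof -
  have "orthonormal (b ` A) (\<lambda>x. x)"
    using b orthonormal_inj_on[OF b] by (auto simp: orthonormal_def inj_on_def)
  then obtain T where T: "b ` A \<subseteq> T" "orthonormal T (\<lambda>x. x)" "total_family T (\<lambda>x. x)"
    using orthonormal_set_extends_to_total by blast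
  have inj: "inj_on b A" by (rule orthonormal_inj_on[OF b])
  have "b ` (A - I) \<subseteq> T - b ` I" using T(1) IA inj by (auto dest: inj_onD)
  moreover have "infinite (b ` (A - I))"
    using inf inj by (meson Diff_subset finite_imageD inj_on_subset)
  ultimately have "infinite (T - b ` I)" using finite_subset by blast
  moreover have "countable (T - b ` I)" using orthonormal_set_countable[OF T(2)] by blast
  moreover have "infinite (- I)" using inf by (metis Compl_eq_Diff_UNIV Diff_mono finite_subset order_refl top_greatest)
  ultimately obtain \<tau> where \<tau>: "bij_betw \<tau> (- I) (T - b ` I)"
    by (meson bij_betw_from_nat_into bij_betw_trans to_nat_on_infinite countableI_type)
  define c where "c n = (if n \<in> I then b n else \<tau> n)" for n
  have "bij_betw c (I \<union> - I) (b ` I \<union> (T - b ` I))"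
  proof (rule bij_betw_combine)
    have "bij_betw b I (b ` I)" using inj IA by (meson bij_betw_imageI inj_on_subset)
    then show "bij_betw c I (b ` I)" by (rule bij_betw_cong[THEN iffD1, rotated]) (simp add: c_def)
    show "bij_betw c (- I) (T - b ` I)" using \<tau> by (rule bij_betw_cong[THEN iffD1, rotated]) (simp add: c_def)
  qed auto
  moreover have "b ` I \<union> (T - b ` I) = T" using T(1) IA by blast
  ultimately have c: "bij_betw c UNIV T" by simp
  then have "orthonormal UNIV c"
    using T(2) unfolding orthonormal_def bij_betw_def by (auto simp: inj_eq)
  moreover have "total_family UNIV c"
    using T(3) c unfolding total_family_def bij_betw_def by blast
  ultimately show ?thesis by (auto simp: c_def)
qed

text \<open>
  The main source of unitaries. A partial isometry given on an orthonormal family extends if both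
  sides leave infinitely many dimensions free; here this is ensured by the members of the families
  with index in \<open>A - I\<close>, whose images are not prescribed. Without them a total family might have
  to be matched with one that is not total.
\<close>

lemma unitary_extension:
  fixes b b' :: "nat \<Rightarrow> 'a::hilbert_scalar ell2"
  assumes "orthonormal A b" "orthonormal A b'" "I \<subseteq> A" "infinite (A - I)"
  shows "\<exists>g\<in>unitaries. \<forall>i\<in>I. g (b i) = b' i"
proof -
  obtain c where c: "orthonormal UNIV c" "total_family UNIV c" "\<And>i. i \<in> I \<Longrightarrow> c i = b i"
    using orthonormal_family_extends_to_basis[OF assms(1,3,4)] by blast
  obtain c' where c': "orthonormal UNIV c'" "total_family UNIV c'" "\<And>i. i \<in> I \<Longrightarrow> c' i = b' i"
    using orthonormal_family_extends_to_basis[OF assms(2,3,4)] by blast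
  show ?thesis using unitary_change_of_basis[OF c(1,2) c'(1,2)] c(3) c'(3) by metis
qed

lemma unitary_of_permutation:
  assumes "bij \<pi>" shows "\<exists>g\<in>unitaries. \<forall>n. g (ket n) = ket (\<pi> n)"
proof (rule unitary_of_orthonormal_basis)
  show "orthonormal UNIV (\<lambda>n. ket (\<pi> n))"
    using assms by (auto simp: orthonormal_def bij_def inj_eq)
  show "total_family UNIV (\<lambda>n. ket (\<pi> n))"
    unfolding total_family_def
  proof (intro allI impI ell2_eqI)
    fix x n assume "\<forall>i\<in>UNIV. ip x (ket (\<pi> i)) = 0"
    then have "coord x (\<pi> (inv_into UNIV \<pi> n)) = 0" by (simp del: surj_f_inv_f)
    then show "coord x n = coord 0 n" using assms by (simp add: bij_def surj_f_inv_f)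
  qed
qed

text \<open>
  The direct sum of unitaries \<open>h i\<close>, where \<open>h i\<close> acts on the span of the block \<open>{n. blk n = i}\<close>.
\<close>

lemma unitary_of_blocks:
  fixes blk :: "nat \<Rightarrow> 'i"
  assumes h: "\<And>i. h i \<in> unitaries" and fixed: "\<And>i n. blk n \<noteq> i \<Longrightarrow> h i (ket n) = ket n"
  shows "\<exists>g\<in>unitaries. \<forall>n. g (ket n) = h (blk n) (ket n)"
proof (rule unitary_of_orthonormal_basis)
  have supp: "supp (h (blk n) (ket n)) \<subseteq> {m. blk m = blk n}" for n
    using unitary_preserves_cosupport[OF h fixed, of "{m. blk m \<noteq> blk n}" "blk n" "ket n"] by auto
  have "ip (h (blk n) (ket n)) (h (blk m) (ket m)) = (if n = m then 1 else 0)" for n m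
  proof (cases "blk n = blk m")
    case True
    then show ?thesis by (simp add: unitary_ip[OF h])
  next
    case False
    then have "supp (h (blk n) (ket n)) \<inter> supp (h (blk m) (ket m)) = {}"
      using supp[of n] supp[of m] by fastforce
    with False show ?thesis by (auto simp: ip_disjoint_supp)
  qed
  then show "orthonormal UNIV (\<lambda>n. h (blk n) (ket n))" by (simp add: orthonormal_def)
  show "total_family UNIV (\<lambda>n. h (blk n) (ket n))"
    unfolding total_family_def
  proof (intro allI impI ell2_eqI)
    fix x n assume x: "\<forall>i\<in>UNIV. ip x (h (blk i) (ket i)) = 0"
    let ?h = "ginv (h (blk n))"
    have "?h (ket m) = ket m" if "m \<in> {m. blk m \<noteq> blk n}" for m
      using unitary_ginv(2)[OF h, of "blk n" "ket m"] fixed[of m "blk n"] that by simp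
    then have "supp (?h (ket n)) \<inter> {m. blk m \<noteq> blk n} = {}"
      by (rule unitary_preserves_cosupport[OF ginv_in_unitaries[OF h]]) simp_all
    then have "supp (?h (ket n)) \<subseteq> {m. blk m = blk n}" by blast
    moreover have "coord (?h x) m = 0" if "blk m = blk n" for m
    proof -
      have "coord (?h x) m = ip x (h (blk n) (ket m))" using ip_ginv[OF h, of "blk n" x "ket m"] by simp
      also have "\<dots> = 0" using x[rule_format, of m] that by simp
      finally show ?thesis .
    qed
    ultimately have "ip (?h x) (?h (ket n)) = 0"
      by (intro ip_disjoint_supp) (auto simp: supp_def)
    then show "coord x n = coord 0 n" by (simp add: unitary_ip[OF ginv_in_unitaries[OF h]])
  qed
qed

subsection \<open>Orthonormal sequences avoiding finitely many vectors\<close>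

text \<open>
  For one more vector \<open>v\<close> to avoid, combine the members of an orthonormal sequence in pairs: each
  pair spans a unit vector orthogonal to \<open>v\<close>.
\<close>

lemma orthonormal_sequence_avoiding:
  fixes V :: "'a::hilbert_scalar ell2 set"
  assumes "finite V" and Z: "infinite Z"
  shows "\<exists>z :: nat \<Rightarrow> 'a ell2. orthonormal UNIV z \<and> (\<forall>k. supp (z k) \<subseteq> Z) \<and> (\<forall>k. \<forall>v\<in>V. ip (z k) v = 0)"
  using assms(1)
proof induction
  case empty
  have "inj (enumerate Z)" using strict_mono_enumerate[OF Z] by (rule strict_mono_imp_inj_on)
  then have "orthonormal UNIV (\<lambda>k. ket (enumerate Z k) :: 'a ell2)"
    by (auto simp: orthonormal_def inj_eq)
  moreover have "supp (ket (enumerate Z k) :: 'a ell2) \<subseteq> Z" for k using enumerate_in_set[OF Z] by simp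
  ultimately show ?case by (intro exI[of _ "\<lambda>k. ket (enumerate Z k)"]) auto
next
  case (insert v V)
  then obtain z :: "nat \<Rightarrow> 'a ell2"
    where z: "orthonormal UNIV z" "\<And>k. supp (z k) \<subseteq> Z" "\<And>k u. u \<in> V \<Longrightarrow> ip (z k) u = 0" by blast
  have "\<exists>\<alpha> \<beta>. \<alpha> * cj \<alpha> + \<beta> * cj \<beta> = 1 \<and> \<alpha> * ip (z (2 * k)) v + \<beta> * ip (z (2 * k + 1)) v = 0" for k
  proof -
    let ?a = "ip (z (2 * k)) v" and ?b = "ip (z (2 * k + 1)) v"
    show ?thesis
    proof (cases "?a = 0")
      case True
      then show ?thesis by (intro exI[of _ 1] exI[of _ 0]) simp
    next
      case False
      define r where "r = sqrt ((norm ?a)\<^sup>2 + (norm ?b)\<^sup>2)"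
      have r: "r \<noteq> 0" "r\<^sup>2 = (norm ?a)\<^sup>2 + (norm ?b)\<^sup>2"
        using False by (auto simp: r_def add_nonneg_eq_0_iff)
      have "(?b / of_real r) * cj (?b / of_real r) + (- ?a / of_real r) * cj (- ?a / of_real r)
          = of_real (((norm ?a)\<^sup>2 + (norm ?b)\<^sup>2) / r\<^sup>2)"
        by (simp add: mult_cj_self power2_eq_square add_divide_distrib)
      also have "\<dots> = 1" unfolding r(2)[symmetric] using r(1) by simp
      finally show ?thesis
        by (intro exI[of _ "?b / of_real r"] exI[of _ "- ?a / of_real r"]) simp
    qed
  qed
  then obtain \<alpha> \<beta> where \<alpha>\<beta>: "\<And>k. \<alpha> k * cj (\<alpha> k) + \<beta> k * cj (\<beta> k) = 1"
      "\<And>k. \<alpha> k * ip (z (2 * k)) v + \<beta> k * ip (z (2 * k + 1)) v = 0" by metis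
  define y where "y k = \<alpha> k \<cdot> z (2 * k) + \<beta> k \<cdot> z (2 * k + 1)" for k
  have parity: "2 * k \<noteq> Suc (2 * l)" "Suc (2 * k) \<noteq> 2 * l" for k l by presburger+
  have \<alpha>\<beta>': "cj (\<alpha> k) * \<alpha> k + cj (\<beta> k) * \<beta> k = 1" for k
    using \<alpha>\<beta>(1)[of k] by (simp only: mult.commute)
  have "orthonormal UNIV y"
    using z(1) \<alpha>\<beta>'
    by (auto simp: orthonormal_def y_def ip_add_left ip_add_right ip_scal_left ip_scal_right parity)
  moreover have "supp (y k) \<subseteq> Z" for k
    using z(2)[of "2 * k"] z(2)[of "2 * k + 1"] unfolding y_def
    by (meson supp_add supp_scal Un_least order_trans)
  moreover have "ip (y k) u = 0" if "u \<in> insert v V" for k u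
    using that z(3) \<alpha>\<beta>(2) by (auto simp: y_def ip_add_left ip_scal_left)
  ultimately show ?case by blast
qed

section \<open>Pointwise stabilisers of basis vectors in capturing sequences\<close>

definition fixer :: "nat set \<Rightarrow> ('a::hilbert_scalar ell2 \<Rightarrow> 'a ell2) set" where
  "fixer A = {g \<in> unitaries. \<forall>n\<in>A. g (ket n) = ket n}"

primrec pow_set :: "('x \<Rightarrow> 'x) set \<Rightarrow> nat \<Rightarrow> ('x \<Rightarrow> 'x) set" where
  "pow_set P 0 = {id}"
| "pow_set P (Suc n) = {p \<circ> q |p q. p \<in> P \<and> q \<in> pow_set P n}"

definition symmetric :: "('a::hilbert_scalar ell2 \<Rightarrow> 'a ell2) set \<Rightarrow> bool" where
  "symmetric P \<longleftrightarrow> P \<subseteq> unitaries \<and> (\<forall>g\<in>P. ginv g \<in> P)"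

text \<open>
  The sets \<open>P n\<close> are indexed for the sake of chains of subgroups; in the other applications \<open>P\<close> is
  constant. The index type \<^typ>\<open>nat set\<close> has the cardinality of the continuum, and its elements can
  be coded into products of commuting unitaries.
\<close>

definition capturing :: "(nat \<Rightarrow> ('a::hilbert_scalar ell2 \<Rightarrow> 'a ell2) set) \<Rightarrow> bool" where
  "capturing P \<longleftrightarrow> (\<forall>n. symmetric (P n)) \<and> incseq P \<and>
     (\<forall>g :: nat set \<Rightarrow> _. range g \<subseteq> unitaries \<longrightarrow> (\<exists>n A B. A \<noteq> B \<and> ginv (g A) \<circ> g B \<in> P n))"

lemma fixerD: "g \<in> fixer A \<Longrightarrow> g \<in> unitaries" "g \<in> fixer A \<Longrightarrow> n \<in> A \<Longrightarrow> g (ket n) = ket n"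
  by (auto simp: fixer_def)

lemma fixerI: "g \<in> unitaries \<Longrightarrow> (\<And>n. n \<in> A \<Longrightarrow> g (ket n) = ket n) \<Longrightarrow> g \<in> fixer A"
  by (auto simp: fixer_def)

lemma ginv_fixer: "g \<in> fixer A \<Longrightarrow> ginv g \<in> fixer A"
  by (metis fixerD fixerI ginv_in_unitaries unitary_ginv(2))

lemma pow_set_1: "p \<in> P \<Longrightarrow> p \<in> pow_set P 1"
  by simp

lemma pow_set_comp:
  "p \<in> pow_set P m \<Longrightarrow> q \<in> pow_set P n \<Longrightarrow> p \<circ> q \<in> pow_set P (m + n)"
proof (induction m arbitrary: p)
  case (Suc m)
  then obtain a b where p: "p = a \<circ> b" and a: "a \<in> P" and "b \<in> pow_set P m" by auto
  then have "b \<circ> q \<in> pow_set P (m + n)" using Suc by blast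
  then show ?case unfolding p comp_assoc add_Suc pow_set.simps using a by blast
qed simp

lemma pow_set_mono: "P \<subseteq> Q \<Longrightarrow> pow_set P n \<subseteq> pow_set Q n"
  by (induction n) auto

lemma symmetricD: "symmetric P \<Longrightarrow> g \<in> P \<Longrightarrow> g \<in> unitaries" "symmetric P \<Longrightarrow> g \<in> P \<Longrightarrow> ginv g \<in> P"
  by (auto simp: symmetric_def)

lemma capturingD:
  assumes "capturing P"
  shows "symmetric (P n)" "m \<le> n \<Longrightarrow> P m \<subseteq> P n"
  using assms by (simp_all add: capturing_def incseq_def)

lemma capturing_family:
  fixes g :: "nat set \<Rightarrow> 'a::hilbert_scalar ell2 \<Rightarrow> 'a ell2"
  assumes P: "capturing P" and g: "\<And>A. g A \<in> unitaries"
  obtains n A B where "A \<noteq> B" "ginv (g A) \<circ> g B \<in> P n"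
proof -
  have "range g \<subseteq> unitaries" using g by blast
  with P have "\<exists>n A B. A \<noteq> B \<and> ginv (g A) \<circ> g B \<in> P n" unfolding capturing_def by simp
  then show thesis using that by (elim exE conjE)
qed

subsection \<open>Blocks on which all unitaries are matched\<close>

text \<open>
  The blocks are numbered by pairs \<open>(n, k)\<close>. If the unitary \<open>r n p\<close> of the block \<open>p = (n, k)\<close> were
  matched on it by no element of \<open>P n\<close>, for all \<open>n\<close> and \<open>k\<close>, let \<open>g A\<close> be \<open>r n p\<close> on all those blocks
  with \<open>k \<in> A\<close> and the identity on the others. If \<open>k\<close> lies in \<open>B\<close> but not in \<open>A\<close>, then
  \<open>(g A)\<^sup>-\<^sup>1 (g B)\<close> does match \<open>r n p\<close>, for every \<open>n\<close>; so it cannot lie in any \<open>P n\<close>. In the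
  opposite case its inverse matches \<open>r n p\<close>. The
  repetition over \<open>n\<close> is needed because the \<open>n\<close> of the captured quotient is not known in advance.
\<close>

lemma exists_full_block:
  fixes P :: "nat \<Rightarrow> ('a::hilbert_scalar ell2 \<Rightarrow> 'a ell2) set" and blk :: "nat \<Rightarrow> nat"
  assumes P: "capturing P"
  shows "\<exists>n p. \<forall>\<rho>\<in>fixer {m. blk m \<noteq> p}. \<exists>w\<in>P n. \<forall>m. blk m = p \<longrightarrow> w (ket m) = \<rho> (ket m)"
proof (rule ccontr)
  assume neg: "\<not> ?thesis"
  define Q where "Q n p \<rho> \<longleftrightarrow> \<rho> \<in> fixer {m. blk m \<noteq> p} \<and>
      (\<forall>w\<in>P n. \<exists>m. blk m = p \<and> w (ket m) \<noteq> \<rho> (ket m))" for n p \<rho>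
  define r where "r n p = (SOME \<rho>. Q n p \<rho>)" for n p
  have ex: "\<exists>\<rho>. Q n p \<rho>" for n p
  proof (rule ccontr)
    assume "\<nexists>\<rho>. Q n p \<rho>"
    then have "\<forall>\<rho>\<in>fixer {m. blk m \<noteq> p}. \<exists>w\<in>P n. \<forall>m. blk m = p \<longrightarrow> w (ket m) = \<rho> (ket m)"
      unfolding Q_def by simp
    with neg show False by (elim notE) (intro exI)
  qed
  have Q: "Q n p (r n p)" for n p
    unfolding r_def by (rule someI_ex[OF ex])
  have r: "r n p \<in> fixer {m. blk m \<noteq> p}" for n p
    using Q[of n p] by (simp add: Q_def)
  have bad: "\<exists>m. blk m = p \<and> w (ket m) \<noteq> r n p (ket m)" if "w \<in> P n" for n p w
    using Q[of n p] that by (simp add: Q_def)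
  define h where "h A p = (if snd (prod_decode p) \<in> A then r (fst (prod_decode p)) p else id)" for A p
  have hfix: "h A p \<in> fixer {m. blk m \<noteq> p}" for A p
    using r by (auto simp: h_def intro: fixerI)
  have "\<exists>g\<in>unitaries. \<forall>n. g (ket n) = h A (blk n) (ket n)" for A
    using unitary_of_blocks[of "h A" blk] fixerD[OF hfix] by auto
  then obtain g where g: "\<And>A. g A \<in> unitaries" and g_ket: "\<And>A n. g A (ket n) = h A (blk n) (ket n)"
    by metis
  obtain n A B where "A \<noteq> B" and AB: "ginv (g A) \<circ> g B \<in> P n"
    by (rule capturing_family[OF P g])
  then obtain k where k: "k \<in> A \<longleftrightarrow> k \<notin> B" by blast
  let ?p = "prod_encode (n, k)"
  have h: "h C ?p = (if k \<in> C then r n ?p else id)" for C by (simp add: h_def)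
  have claim: False
    if k: "k \<in> B" "k \<notin> A" and AB: "ginv (g A) \<circ> g B \<in> P n" for A B
  proof -
    obtain m where m: "blk m = ?p" "(ginv (g A) \<circ> g B) (ket m) \<noteq> r n ?p (ket m)"
      using bad[OF AB] by blast
    have "supp (r n ?p (ket m)) \<inter> {m. blk m \<noteq> ?p} = {}"
      by (rule unitary_preserves_cosupport[OF fixerD(1)[OF r] fixerD(2)[OF r]]) (use m(1) in auto)
    then have "supp (r n ?p (ket m)) \<subseteq> {m. blk m = ?p}" by blast
    then have "g A (r n ?p (ket m)) = r n ?p (ket m)"
      by (rule unitary_fixes_supported[OF g, rotated]) (use k in \<open>simp add: g_ket h\<close>)
    then have "ginv (g A) (r n ?p (ket m)) = r n ?p (ket m)"
      by (metis g unitary_ginv(2))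
    then show False using m k by (simp add: g_ket h)
  qed
  show False
  proof (cases "k \<in> B")
    case True
    then show False using claim[OF _ _ AB] k by blast
  next
    case False
    have "ginv (ginv (g A) \<circ> g B) \<in> P n" using symmetricD(2)[OF capturingD(1)[OF P] AB] .
    then have "ginv (g B) \<circ> g A \<in> P n" using g by (simp add: ginv_comp ginv_ginv)
    then show False using claim[of A B] False k by blast
  qed
qed

text \<open>
  Although \<open>w\<close> is only known on the block \<open>D\<close>, its conjugate of an operator living on \<open>D\<close> is known:
  \<open>\<rho>\<^sup>-\<^sup>1 w\<close> is the identity on \<open>D\<close> and preserves its orthogonal complement, so it commutes with \<open>q\<close>.
\<close>

lemma conjugate_depends_on_block:
  assumes w: "w \<in> unitaries" and \<rho>: "\<rho> \<in> unitaries" and q: "q \<in> fixer (- D)"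
    and eq: "\<And>n. n \<in> D \<Longrightarrow> w (ket n) = \<rho> (ket n)"
    and inv: "\<And>n. n \<in> D \<Longrightarrow> q (ket n) \<in> ket ` D"
  shows "w \<circ> q \<circ> ginv w = \<rho> \<circ> q \<circ> ginv \<rho>"
proof -
  let ?t = "ginv \<rho> \<circ> w"
  have qU: "q \<in> unitaries" and tU: "?t \<in> unitaries" using q w \<rho> by (auto intro: comp_in_unitaries dest: fixerD)
  have tD: "?t (ket n) = ket n" if "n \<in> D" for n using eq[OF that] \<rho> by simp
  have comm: "?t \<circ> q = q \<circ> ?t"
  proof (rule unitary_eqI)
    show "(?t \<circ> q) (ket n) = (q \<circ> ?t) (ket n)" for n
    proof (cases "n \<in> D")
      case True
      then obtain m where "m \<in> D" "q (ket n) = ket m" using inv by blast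
      then show ?thesis using tD[OF True] tD[of m] by simp
    next
      case False
      have "supp (?t (ket n)) \<inter> D = {}"
        by (rule unitary_preserves_cosupport[OF tU tD]) (use False in auto)
      then have sD: "supp (?t (ket n)) \<subseteq> - D" by blast
      have "q (?t (ket n)) = ?t (ket n)"
        by (rule unitary_fixes_supported[OF qU _ sD]) (rule fixerD(2)[OF q])
      then show ?thesis using False fixerD(2)[OF q, of n] by simp
    qed
  qed (use qU tU in \<open>auto intro: comp_in_unitaries\<close>)
  have "w (q (ginv w x)) = \<rho> (q (ginv \<rho> x))" for x
  proof -
    have "w (q (ginv w x)) = \<rho> (?t (q (ginv w x)))" using \<rho> by simp
    also have "\<dots> = \<rho> (q (?t (ginv w x)))" using comm by (metis comp_apply)
    finally show ?thesis using w by simp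
  qed
  then show ?thesis by (simp add: fun_eq_iff)
qed

subsection \<open>Shifts and commutators\<close>

text \<open>
  A bijection \<open>\<beta>\<close> identifies the block \<open>D\<close> with infinitely many copies \<open>k\<close> of a two-sided infinite
  stack of infinite layers. The shift moves copy \<open>k\<close> of the stack by \<open>\<tau> k\<close> layers.
\<close>

definition shift :: "(nat \<Rightarrow> nat \<times> int \<times> nat) \<Rightarrow> nat set \<Rightarrow> (nat \<Rightarrow> int) \<Rightarrow> nat \<Rightarrow> nat" where
  "shift \<beta> D \<tau> n = (if n \<in> D
     then inv_into D \<beta> (fst (\<beta> n), fst (snd (\<beta> n)) + \<tau> (fst (\<beta> n)), snd (snd (\<beta> n))) else n)"

context
  fixes \<beta> :: "nat \<Rightarrow> nat \<times> int \<times> nat" and D :: "nat set"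
  assumes \<beta>: "bij_betw \<beta> D UNIV"
begin

lemma shift_in: "n \<in> D \<Longrightarrow> shift \<beta> D \<tau> n \<in> D"
  and \<beta>_shift: "n \<in> D \<Longrightarrow> \<beta> (shift \<beta> D \<tau> n) = (fst (\<beta> n), fst (snd (\<beta> n)) + \<tau> (fst (\<beta> n)), snd (snd (\<beta> n)))"
  and shift_notin: "n \<notin> D \<Longrightarrow> shift \<beta> D \<tau> n = n"
  using \<beta> by (auto simp: shift_def bij_betw_def f_inv_into_f inv_into_into)

lemma shift_in_iff: "shift \<beta> D \<tau> n \<in> D \<longleftrightarrow> n \<in> D"
  using shift_in[of n] shift_notin[of n] by (cases "n \<in> D") auto

lemma shift_shift: "shift \<beta> D \<tau> (shift \<beta> D \<sigma> n) = shift \<beta> D (\<lambda>k. \<tau> k + \<sigma> k) n"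
proof (cases "n \<in> D")
  case True
  have "\<beta> (shift \<beta> D \<tau> (shift \<beta> D \<sigma> n)) = \<beta> (shift \<beta> D (\<lambda>k. \<tau> k + \<sigma> k) n)"
    using True by (simp add: \<beta>_shift shift_in)
  then show ?thesis using True \<beta> by (meson bij_betw_def inj_onD shift_in)
qed (simp add: shift_notin)

lemma shift_0: "shift \<beta> D (\<lambda>_. 0) n = n"
  using \<beta> by (simp add: shift_def bij_betw_def)

lemma bij_shift: "bij (shift \<beta> D \<tau>)"
  by (rule o_bij[of "shift \<beta> D (\<lambda>k. - \<tau> k)"]) (simp_all add: fun_eq_iff shift_shift shift_0)

definition shift_op :: "(nat \<Rightarrow> int) \<Rightarrow> 'a::hilbert_scalar ell2 \<Rightarrow> 'a ell2" where
  "shift_op \<tau> = (SOME g. g \<in> unitaries \<and> (\<forall>n. g (ket n) = ket (shift \<beta> D \<tau> n)))"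

lemma shift_op_unitary [simp]: "shift_op \<tau> \<in> unitaries"
  and shift_op_ket [simp]: "shift_op \<tau> (ket n) = ket (shift \<beta> D \<tau> n)"
proof -
  have "\<exists>g. g \<in> unitaries \<and> (\<forall>n. g (ket n) = ket (shift \<beta> D \<tau> n))"
    using unitary_of_permutation[OF bij_shift] by blast
  from someI_ex[OF this]
  show "shift_op \<tau> \<in> unitaries" "shift_op \<tau> (ket n) = ket (shift \<beta> D \<tau> n)"
    unfolding shift_op_def by auto
qed

lemma shift_op_comp: "shift_op \<tau> \<circ> shift_op \<sigma> = shift_op (\<lambda>k. \<tau> k + \<sigma> k)"
  by (rule unitary_eqI) (simp_all add: shift_shift)

lemma shift_op_apply: "shift_op \<tau> (shift_op \<sigma> x) = shift_op (\<lambda>k. \<tau> k + \<sigma> k) x"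
  using shift_op_comp by (metis comp_apply)

lemma shift_op_0: "shift_op (\<lambda>_. 0) x = x"
  by (rule unitary_fixes_supported[where A = UNIV]) (simp_all add: shift_0)

lemma ginv_shift_op: "ginv (shift_op \<tau>) = shift_op (\<lambda>k. - \<tau> k)"
  by (rule inv_unique_comp) (simp_all add: fun_eq_iff shift_op_apply shift_op_0)

text \<open>
  Let \<open>u\<close> act on layer \<open>0\<close> of stack \<open>k\<close>, and let \<open>\<rho>\<close> act like \<open>u\<close> on all layers \<open>j \<ge> 0\<close> of this stack.
  Conjugation by a shift by one layer turns \<open>\<rho>\<close> into the operator that acts like \<open>u\<close> on the layers
  \<open>j \<ge> 1\<close>, so the commutator of \<open>\<rho>\<close> and the shift is \<open>u\<close>.
\<close>

lemma shift_commutator: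
  fixes u :: "'a::hilbert_scalar ell2 \<Rightarrow> 'a ell2"
  assumes \<tau>: "\<tau> k = 1" and u: "u \<in> fixer (- {n \<in> D. \<exists>m. \<beta> n = (k, 0, m)})"
  shows "\<exists>\<rho>\<in>fixer (- D). u = \<rho> \<circ> shift_op \<tau> \<circ> ginv \<rho> \<circ> ginv (shift_op \<tau>)"
proof -
  let ?q = "shift_op \<tau> :: 'a ell2 \<Rightarrow> 'a ell2"
  let ?T = "\<lambda>j :: int. shift_op (\<lambda>_. j) :: 'a ell2 \<Rightarrow> 'a ell2"
  \<comment> \<open>\<open>h j\<close> is the copy of \<open>u\<close> on layer \<open>j\<close>. Everything off the stack is assigned to layer \<open>-1\<close>,
    where \<open>h\<close> is the identity.\<close>
  define h where "h j = (if j < 0 then id else ?T j \<circ> u \<circ> ?T (- j))" for j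
  define blk where "blk n = (if n \<in> D \<and> fst (\<beta> n) = k then fst (snd (\<beta> n)) else - 1)" for n
  note uU = fixerD(1)[OF u]
  have u_fix: "u (ket n) = ket n" if "blk n \<noteq> 0" for n
    using that by (intro fixerD(2)[OF u]) (auto simp: blk_def)
  have hU: "h j \<in> unitaries" for j using uU by (simp add: h_def)
  have h_fix: "h j (ket n) = ket n" if "blk n \<noteq> j" for j n
  proof (cases "j < 0")
    case False
    have "blk (shift \<beta> D (\<lambda>_. - j) n) \<noteq> 0"
      using that False by (cases "n \<in> D") (auto simp: blk_def shift_in \<beta>_shift shift_notin)
    then show ?thesis using False by (simp add: h_def u_fix shift_shift shift_0)
  qed (simp add: h_def)
  obtain \<rho> where \<rho>: "\<rho> \<in> unitaries" "\<And>n. \<rho> (ket n) = h (blk n) (ket n)"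
    using unitary_of_blocks[of h blk] hU h_fix by blast
  have "\<rho> \<in> fixer (- D)"
    using \<rho> by (auto intro!: fixerI simp: blk_def h_def)
  moreover have "u \<circ> (?q \<circ> \<rho>) = \<rho> \<circ> ?q"
  proof (rule unitary_eqI)
    fix n
    let ?n' = "shift \<beta> D \<tau> n"
    show "(u \<circ> (?q \<circ> \<rho>)) (ket n) = (\<rho> \<circ> ?q) (ket n)"
    proof (cases "n \<in> D \<and> fst (\<beta> n) = k")
      case True
      define j where "j = fst (snd (\<beta> n))"
      have j: "blk n = j" "blk ?n' = j + 1" "shift \<beta> D (\<lambda>_. 1) n = ?n'"
        using True \<tau> by (auto simp: j_def blk_def shift_in \<beta>_shift) (simp add: shift_def)
      show ?thesis
      proof (cases "j < 0")
        case True
        then have "\<rho> (ket n) = ket n" by (simp add: \<rho> j h_def)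
        moreover have "u (ket ?n') = \<rho> (ket ?n')"
          using True u_fix[of ?n'] by (cases "j + 1 = 0") (auto simp: \<rho> j h_def shift_op_0)
        ultimately show ?thesis by simp
      next
        case False
        have supp: "supp (h i (ket m)) \<subseteq> {l. blk l = i}" if "blk m = i" for i m
          using unitary_preserves_cosupport[OF hU h_fix, of "{m. blk m \<noteq> i}" i "ket m"] that by auto
        have agree: "?q (ket m) = ?T 1 (ket m)" if "m \<in> {l. blk l = j}" for m
        proof -
          have "m \<in> D" "fst (\<beta> m) = k" using that False by (auto simp: blk_def split: if_splits)
          then show ?thesis using \<tau> by (simp add: shift_def)
        qed
        have "?q (h j (ket n)) = ?T 1 (h j (ket n))"
          by (rule unitary_eq_on_supported[where A = "{l. blk l = j}"]) (simp_all only: shift_op_unitary agree supp[OF j(1)])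
        also have "\<dots> = ?T (j + 1) (u (?T (- j) (ket n)))"
          using False by (simp add: h_def shift_op_apply add.commute del: shift_op_ket)
        also have "?T (- j) (ket n) = ?T (- (j + 1)) (ket ?n')"
          by (simp add: shift_shift flip: j(3))
        also have "?T (j + 1) (u (?T (- (j + 1)) (ket ?n'))) = h (j + 1) (ket ?n')"
          using False by (simp add: h_def del: shift_op_ket)
        finally have "?q (h j (ket n)) = h (j + 1) (ket ?n')" .
        moreover have "u (h (j + 1) (ket ?n')) = h (j + 1) (ket ?n')"
          by (rule unitary_fixes_supported[OF uU u_fix supp[OF j(2)]]) (use False in auto)
        ultimately show ?thesis by (simp add: \<rho> j)
      qed
    next
      case False
      then have "blk n = -1" "blk ?n' = -1"
        by (auto simp: blk_def shift_in_iff) (metis \<beta>_shift fst_conv shift_notin)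
      then show ?thesis by (simp add: \<rho> h_def u_fix)
    qed
  qed (use uU \<rho> in simp_all)
  then have "u x = \<rho> (?q (ginv \<rho> (ginv ?q x)))" for x
    using \<rho>(1) by (metis comp_apply unitary_ginv(1) shift_op_unitary)
  then have "u = \<rho> \<circ> ?q \<circ> ginv \<rho> \<circ> ginv ?q" by (simp add: fun_eq_iff)
  ultimately show ?thesis by blast
qed

end

lemma bij_betw_countably_infinite:
  fixes A :: "'x::countable set" and B :: "'y::countable set"
  assumes "infinite A" "infinite B" shows "\<exists>f. bij_betw f A B"
  using assms by (meson bij_betw_from_nat_into bij_betw_trans to_nat_on_infinite countableI_type)

text \<open>
  The quotient of two shifts whose exponents are the indicator functions of \<open>A\<close> and \<open>B\<close> moves some
  stack by one layer up or down, so a shift \<open>q\<close> to which the commutator lemma applies lies in \<open>P\<close>.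
  By fullness of the block the operator \<open>\<rho>\<close> in the commutator can be replaced by an element \<open>w\<close>
  of \<open>P\<close>, and the commutator \<open>w q w\<^sup>-\<^sup>1 q\<^sup>-\<^sup>1\<close> has four factors.
\<close>

lemma infinite_stabiliser_captured:
  fixes P :: "nat \<Rightarrow> ('a::hilbert_scalar ell2 \<Rightarrow> 'a ell2) set"
  assumes P: "capturing P"
  shows "\<exists>n B. infinite B \<and> infinite (- B) \<and> fixer B \<subseteq> pow_set (P n) 4"
proof -
  let ?blk = "\<lambda>m. fst (prod_decode m)"
  obtain n\<^sub>1 p where full: "\<And>\<rho>. \<rho> \<in> fixer {m. ?blk m \<noteq> p} \<Longrightarrow> \<exists>w\<in>P n\<^sub>1. \<forall>m. ?blk m = p \<longrightarrow> w (ket m) = \<rho> (ket m)"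
    using exists_full_block[OF P, of ?blk] by blast
  define D where "D = {m. ?blk m = p}"
  have "inj (\<lambda>k. prod_encode (p, k))" by (rule injI) (simp add: prod_encode_eq)
  then have "infinite (range (\<lambda>k. prod_encode (p, k)))" by (simp add: finite_image_iff)
  then have "infinite D" by (rule contrapos_nn) (rule finite_subset, auto simp: D_def)
  then obtain \<beta> :: "nat \<Rightarrow> nat \<times> int \<times> nat" where \<beta>: "bij_betw \<beta> D UNIV"
    using bij_betw_countably_infinite[of D "UNIV :: (nat \<times> int \<times> nat) set"] by (auto simp: finite_prod)
  let ?S = "\<lambda>\<tau>. shift_op \<beta> D \<tau> :: 'a ell2 \<Rightarrow> 'a ell2"
  define ind where "ind A k = (if k \<in> A then 1 else 0 :: int)" for A :: "nat set" and k
  obtain n\<^sub>2 A B where "A \<noteq> B" and AB: "ginv (?S (ind A)) \<circ> ?S (ind B) \<in> P n\<^sub>2"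
    by (rule capturing_family[OF P shift_op_unitary[OF \<beta>], of ind])
  have q1: "?S (\<lambda>k. ind B k - ind A k) \<in> P n\<^sub>2"
    using AB by (simp add: ginv_shift_op[OF \<beta>] shift_op_comp[OF \<beta>])
  have q2: "?S (\<lambda>k. ind A k - ind B k) \<in> P n\<^sub>2"
    using symmetricD(2)[OF capturingD(1)[OF P] q1] by (simp add: ginv_shift_op[OF \<beta>])
  obtain \<tau> k where \<tau>: "\<tau> k = 1" and q: "?S \<tau> \<in> P n\<^sub>2"
  proof -
    obtain k where "k \<in> A \<longleftrightarrow> k \<notin> B" using \<open>A \<noteq> B\<close> by blast
    then consider "ind B k - ind A k = 1" | "ind A k - ind B k = 1" by (auto simp: ind_def)
    then show thesis
    proof cases
      case 1
      then show thesis using q1 by (rule that[of "\<lambda>k. ind B k - ind A k"])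
    next
      case 2
      then show thesis using q2 by (rule that[of "\<lambda>k. ind A k - ind B k"])
    qed
  qed
  define C where "C j = {n \<in> D. \<exists>m. \<beta> n = (k, j, m)}" for j
  have "infinite (C j)" for j
  proof -
    have "\<beta> ` C j = range (\<lambda>m :: nat. (k, j, m))"
    proof (intro equalityI subsetI)
      fix t assume "t \<in> range (\<lambda>m :: nat. (k, j, m))"
      then obtain m where "t = (k, j, m)" by blast
      moreover obtain n where "n \<in> D" "\<beta> n = t" using \<beta> unfolding bij_betw_def by (metis UNIV_I imageE)
      ultimately show "t \<in> \<beta> ` C j" by (intro image_eqI[of _ _ n]) (auto simp: C_def)
    qed (auto simp: C_def)
    moreover have "infinite (range (\<lambda>m :: nat. (k, j, m)))" by (simp add: finite_image_iff inj_def)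
    ultimately show ?thesis by (metis finite_imageI)
  qed
  moreover have "C 1 \<subseteq> - C 0" by (auto simp: C_def)
  ultimately have inf: "infinite (- C 0)" "infinite (- (- C 0))"
    using finite_subset by (blast, simp)
  define n where "n = max n\<^sub>1 n\<^sub>2"
  have mono: "P n\<^sub>1 \<subseteq> P n" "P n\<^sub>2 \<subseteq> P n" using capturingD(2)[OF P] by (auto simp: n_def)
  note sym = capturingD(1)[OF P, of n]
  have "u \<in> pow_set (P n) 4" if "u \<in> fixer (- C 0)" for u
  proof -
    obtain \<rho> where \<rho>: "\<rho> \<in> fixer (- D)" "u = \<rho> \<circ> ?S \<tau> \<circ> ginv \<rho> \<circ> ginv (?S \<tau>)"
      using shift_commutator[OF \<beta>, of \<tau> k u] \<tau> \<open>u \<in> fixer (- C 0)\<close> unfolding C_def by blast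
    then obtain w where w: "w \<in> P n" "\<And>m. m \<in> D \<Longrightarrow> w (ket m) = \<rho> (ket m)"
      using full[of \<rho>] mono(1) unfolding D_def by (auto simp: Collect_neg_eq[symmetric])
    have conj: "w \<circ> ?S \<tau> \<circ> ginv w = \<rho> \<circ> ?S \<tau> \<circ> ginv \<rho>"
    proof (rule conjugate_depends_on_block)
      show "?S \<tau> \<in> fixer (- D)"
        by (rule fixerI) (simp_all add: shift_op_unitary[OF \<beta>] shift_op_ket[OF \<beta>] shift_notin[OF \<beta>])
      show "?S \<tau> (ket m) \<in> ket ` D" if "m \<in> D" for m
        using shift_in[OF \<beta> that] by (simp add: shift_op_ket[OF \<beta>])
    qed (use w \<rho>(1) symmetricD(1)[OF sym] fixerD(1) in auto)
    have u: "u = w \<circ> (?S \<tau> \<circ> (ginv w \<circ> ginv (?S \<tau>)))"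
      unfolding \<rho>(2) conj[symmetric] by (simp only: comp_assoc)
    have "w \<in> P n" "?S \<tau> \<in> P n" "ginv w \<in> P n" "ginv (?S \<tau>) \<in> P n"
      using w(1) q mono(2) symmetricD(2)[OF sym] by auto
    then have "u \<in> pow_set (P n) (1 + (1 + (1 + 1)))"
      unfolding u by (intro pow_set_comp pow_set_1)
    then show ?thesis by (simp add: numeral_eq_Suc)
  qed
  then show ?thesis using inf by blast
qed

subsection \<open>Generating by two stabilisers\<close>

lemma infinite_nat_set_splits:
  fixes Y :: "nat set"
  assumes "infinite Y"
  shows "\<exists>Y\<^sub>1 Y\<^sub>2. Y = Y\<^sub>1 \<union> Y\<^sub>2 \<and> Y\<^sub>1 \<inter> Y\<^sub>2 = {} \<and> infinite Y\<^sub>1 \<and> infinite Y\<^sub>2"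
proof -
  have "infinite (UNIV :: (nat + nat) set)" by simp
  then obtain f :: "nat + nat \<Rightarrow> nat" where f: "bij_betw f UNIV Y"
    using bij_betw_countably_infinite[of "UNIV :: (nat + nat) set" Y] assms by blast
  then have inj: "inj f" and Y: "Y = range f" by (auto simp: bij_betw_def)
  have "infinite (f ` range Inl)" "infinite (f ` range Inr)"
    using inj by (auto simp: finite_image_iff inj_on_subset)
  moreover have "Y = f ` range Inl \<union> f ` range Inr"
    unfolding Y by (metis UNIV_sum image_Un)
  moreover have "f ` range Inl \<inter> f ` range Inr = {}" using inj by (auto dest: injD)
  ultimately show ?thesis by blast
qed

text \<open>
  Inside the coordinate subspaces of \<open>Z\<close> and \<open>Y\<close> there are infinite orthonormal sequences \<open>z\<close> and
  \<open>y\<close> for which \<open>g z\<close> is orthogonal to \<open>y\<close>, whatever \<open>g\<close> is: choose the vectors in turn, each one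
  orthogonal to finitely many vectors. It would not do to fix \<open>z\<close> first, since nothing in the
  coordinate subspace of \<open>Y\<close> need be orthogonal to all of \<open>g z\<close>.
\<close>

lemma orthogonal_sequences:
  fixes g :: "'a::hilbert_scalar ell2 \<Rightarrow> 'a ell2"
  assumes g: "g \<in> unitaries" and Z: "infinite Z" and Y: "infinite Y"
  shows "\<exists>z y :: nat \<Rightarrow> 'a ell2. orthonormal UNIV z \<and> orthonormal UNIV y \<and>
           (\<forall>k. supp (z k) \<subseteq> Z \<and> supp (y k) \<subseteq> Y) \<and> (\<forall>k l. ip (g (z k)) (y l) = 0)"
proof -
  \<comment> \<open>The conditions on the pair \<open>r = (z n, y n)\<close>, given the pairs \<open>f k\<close> with \<open>k < n\<close>.\<close>
  define Q where "Q f n r \<longleftrightarrow>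
      ip (fst r) (fst r) = 1 \<and> ip (snd r) (snd r) = 1 \<and> supp (fst r) \<subseteq> Z \<and> supp (snd r) \<subseteq> Y \<and>
      ip (snd r) (g (fst r)) = 0 \<and>
      (\<forall>k<n. ip (fst r) (fst (f k)) = 0 \<and> ip (fst r) (ginv g (snd (f k))) = 0 \<and>
             ip (snd r) (snd (f k)) = 0 \<and> ip (snd r) (g (fst (f k))) = 0)"
    for f :: "nat \<Rightarrow> 'a ell2 \<times> 'a ell2" and n :: nat and r :: "'a ell2 \<times> 'a ell2"
  have avoid: "\<exists>x :: 'a ell2. ip x x = 1 \<and> supp x \<subseteq> W \<and> (\<forall>v\<in>V. ip x v = 0)" if "finite V" "infinite W" for V W
  proof -
    obtain x :: "nat \<Rightarrow> 'a ell2" where "orthonormal UNIV x" "\<And>k. supp (x k) \<subseteq> W" "\<And>k v. v \<in> V \<Longrightarrow> ip (x k) v = 0"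
      using orthonormal_sequence_avoiding[OF \<open>finite V\<close> \<open>infinite W\<close>] by blast
    then show ?thesis by (intro exI[of _ "x 0"]) (auto simp: orthonormal_def)
  qed
  have "\<exists>f. \<forall>n. Q f n (f n)"
  proof (rule dependent_wf_choice[of less_than Q])
    fix f f' :: "nat \<Rightarrow> 'a ell2 \<times> 'a ell2" and n r assume "\<And>k. (k, n) \<in> less_than \<Longrightarrow> f k = f' k"
    then have "f k = f' k" if "k < n" for k using that by simp
    then show "Q f n r = Q f' n r" unfolding Q_def by simp
  next
    fix n and f :: "nat \<Rightarrow> 'a ell2 \<times> 'a ell2"
    define V where "V = (\<lambda>k. fst (f k)) ` {..<n} \<union> (\<lambda>k. ginv g (snd (f k))) ` {..<n}"
    have "finite V" by (simp add: V_def)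
    from avoid[OF this Z] obtain z where z: "ip z z = 1 \<and> supp z \<subseteq> Z \<and> (\<forall>v\<in>V. ip z v = 0)" by (rule exE)
    define V' where "V' = insert (g z) ((\<lambda>k. snd (f k)) ` {..<n} \<union> (\<lambda>k. g (fst (f k))) ` {..<n})"
    have "finite V'" by (simp add: V'_def)
    from avoid[OF this Y] obtain y where y: "ip y y = 1 \<and> supp y \<subseteq> Y \<and> (\<forall>v\<in>V'. ip y v = 0)" by (rule exE)
    show "\<exists>r. Q f n r" unfolding Q_def by (rule exI[of _ "(z, y)"]) (use z y in \<open>auto simp: V_def V'_def\<close>)
  qed simp
  then obtain f where f: "\<And>n. Q f n (f n)" by blast
  define z y where "z n = fst (f n)" and "y n = snd (f n)" for n
  have zy: "ip (z n) (z n) = 1" "ip (y n) (y n) = 1" "supp (z n) \<subseteq> Z" "supp (y n) \<subseteq> Y" "ip (y n) (g (z n)) = 0"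
    and lt: "k < n \<Longrightarrow> ip (z n) (z k) = 0" "k < n \<Longrightarrow> ip (z n) (ginv g (y k)) = 0"
      "k < n \<Longrightarrow> ip (y n) (y k) = 0" "k < n \<Longrightarrow> ip (y n) (g (z k)) = 0" for n k
    using f[of n] by (simp_all add: Q_def z_def y_def)
  have flip0: "ip a b = 0" if "ip b a = 0" for a b :: "'a ell2" using that by (metis cj_0 cj_ip)
  have "orthonormal UNIV z" "orthonormal UNIV y"
    unfolding orthonormal_def using zy lt(1,3) flip0 by (metis nat_neq_iff)+
  moreover have "ip (g (z k)) (y l) = 0" for k l
  proof (cases "l < k")
    case True
    then have "ip (ginv g (g (z k))) (ginv g (y l)) = 0" using lt(2)[of l k] g by simp
    then show ?thesis using unitary_ip[OF ginv_in_unitaries[OF g]] by metis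
  next
    case False
    then have "ip (y l) (g (z k)) = 0" using lt(4)[of k l] zy(5)[of k] by (cases "k = l") auto
    then show ?thesis by (rule flip0)
  qed
  ultimately show ?thesis
    using zy(3,4) by (intro exI[of _ z] exI[of _ y]) simp
qed

text \<open>
  Put \<open>Z = B - B'\<close> and let \<open>Y\<close> be the complement of \<open>B \<union> B'\<close>. It suffices to turn \<open>g\<close> into an element
  that fixes \<open>Z\<close>, by factors that fix \<open>B\<close> or \<open>B'\<close>. With the sequences \<open>z\<close>, \<open>y\<close> of the preceding
  lemma, a first factor \<open>b\<^sub>1\<close> straightens \<open>y\<close> to basis vectors and thereby pushes \<open>g z\<close> away from \<open>Z\<close>
  and from an infinite part \<open>Y\<^sub>2\<close> of \<open>Y\<close>; then \<open>a\<close>, which fixes \<open>B\<close>, can move \<open>b\<^sub>1 g z\<close> to the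
  other part \<open>Y\<^sub>1\<close> of \<open>Y\<close>, and \<open>b\<^sub>2\<close> carries \<open>Y\<^sub>1\<close> to \<open>Z\<close>. Finally \<open>c\<close> carries \<open>z\<close> itself to
  \<open>Z\<close>. Altogether \<open>b\<^sub>2 a b\<^sub>1 g c\<^sup>-\<^sup>1\<close> fixes \<open>Z\<close>.
\<close>

lemma stabiliser_of_intersection:
  fixes g :: "'a::hilbert_scalar ell2 \<Rightarrow> 'a ell2"
  assumes Z: "infinite (B - B')" and Y: "infinite (- (B \<union> B'))" and g: "g \<in> fixer (B \<inter> B')"
  shows "\<exists>b\<^sub>1 a b\<^sub>2 d c. b\<^sub>1 \<in> fixer B' \<and> a \<in> fixer B \<and> b\<^sub>2 \<in> fixer B' \<and> d \<in> fixer B \<and> c \<in> fixer B' \<and>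
           g = b\<^sub>1 \<circ> (a \<circ> (b\<^sub>2 \<circ> (d \<circ> c)))"
proof -
  define Z where "Z = B - B'"
  obtain Y\<^sub>1 Y\<^sub>2 where Y12: "- (B \<union> B') = Y\<^sub>1 \<union> Y\<^sub>2" "Y\<^sub>1 \<inter> Y\<^sub>2 = {}" "infinite Y\<^sub>1" "infinite Y\<^sub>2"
    using infinite_nat_set_splits[OF Y] by blast
  have mem: "n \<in> B' \<or> n \<in> Z \<or> n \<in> Y\<^sub>1 \<or> n \<in> Y\<^sub>2" for n using Y12(1) unfolding Z_def by blast
  have disj: "B' \<inter> Z = {}" "B' \<inter> Y\<^sub>1 = {}" "B' \<inter> Y\<^sub>2 = {}" "Z \<inter> Y\<^sub>1 = {}" "Z \<inter> Y\<^sub>2 = {}" "B \<inter> Y\<^sub>1 = {}" "B \<inter> Y\<^sub>2 = {}"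
    using Y12(1) unfolding Z_def by blast+
  have disjD: "n \<notin> B' \<and> n \<notin> Z" if "n \<in> Y\<^sub>2" for n using disj that by blast
  note gU = fixerD(1)[OF g]
  obtain z y :: "nat \<Rightarrow> 'a ell2" where z: "orthonormal UNIV z" and y: "orthonormal UNIV y"
      and supp: "\<And>k. supp (z k) \<subseteq> Z" "\<And>k. supp (y k) \<subseteq> Y\<^sub>1 \<union> Y\<^sub>2" and gz_y: "\<And>k l. ip (g (z k)) (y l) = 0"
    using orthogonal_sequences[OF gU, of Z "Y\<^sub>1 \<union> Y\<^sub>2"] assms(1) Y12(3) unfolding Z_def by auto
  have coord0: "coord (z k) n = 0" if "n \<notin> Z" for k n using supp(1)[of k] that by (auto simp: supp_def)
  have coord0': "coord (y k) n = 0" if "n \<in> B'" for k n using supp(2)[of k] that disj by (auto simp: supp_def)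
  have "\<exists>b\<^sub>1\<in>unitaries. \<forall>n\<in>- Y\<^sub>1. b\<^sub>1 (if n \<in> B' then ket n else y n) = (ket n :: 'a ell2)"
    using y Y12(3) by (intro unitary_extension[of UNIV])
      (auto simp: orthonormal_def ip_ket_left coord0')
  then obtain b\<^sub>1 where b\<^sub>1: "b\<^sub>1 \<in> unitaries"
      and b\<^sub>1_ket: "\<And>n. n \<notin> Y\<^sub>1 \<Longrightarrow> b\<^sub>1 (if n \<in> B' then ket n else y n) = ket n" by auto
  have b\<^sub>1B: "b\<^sub>1 \<in> fixer B'"
  proof (rule fixerI[OF b\<^sub>1])
    show "b\<^sub>1 (ket n) = ket n" if "n \<in> B'" for n using b\<^sub>1_ket[of n] that disj(2) by auto
  qed
  define s where "s k = b\<^sub>1 (g (z k))" for k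
  have s: "orthonormal UNIV s"
    unfolding s_def by (rule orthonormal_unitary[OF b\<^sub>1 orthonormal_unitary[OF gU z]])
  have s0: "coord (s k) n = 0" if n: "n \<in> B \<union> Y\<^sub>2" for k n
  proof (cases "n \<in> B'")
    case True
    then have n: "n \<in> B \<inter> B'" using n disj by blast
    have "b\<^sub>1 (g (ket n)) = ket n" using n fixerD(2)[OF g] fixerD(2)[OF b\<^sub>1B] by simp
    then have "coord (s k) n = ip (b\<^sub>1 (g (z k))) (b\<^sub>1 (g (ket n)))" by (simp add: s_def)
    also have "\<dots> = coord (z k) n" by (simp add: unitary_ip[OF b\<^sub>1] unitary_ip[OF gU])
    also have "\<dots> = 0" using n by (intro coord0) (auto simp: Z_def)
    finally show ?thesis .
  next
    case False
    moreover have "n \<notin> Y\<^sub>1" using n disj Y12(2) by blast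
    ultimately have "b\<^sub>1 (y n) = ket n" using b\<^sub>1_ket[of n] by simp
    then have "coord (s k) n = ip (b\<^sub>1 (g (z k))) (b\<^sub>1 (y n))" by (simp add: s_def)
    then show ?thesis by (simp add: unitary_ip[OF b\<^sub>1] gz_y)
  qed
  have "\<exists>a\<in>unitaries. \<forall>n\<in>- Y\<^sub>2 \<inter> (B \<union> Y\<^sub>1). a (if n \<in> B \<union> Y\<^sub>2 then ket n else s n) = (ket n :: 'a ell2)"
  proof (rule unitary_extension[of UNIV])
    show "infinite (UNIV - (- Y\<^sub>2 \<inter> (B \<union> Y\<^sub>1)))"
      using Y12(4) by (rule contrapos_nn) (erule finite_subset[rotated], blast)
  qed (use s in \<open>auto simp: orthonormal_def ip_ket_left s0\<close>)
  then obtain a where a: "a \<in> unitaries"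
      and a_all: "\<forall>n\<in>- Y\<^sub>2 \<inter> (B \<union> Y\<^sub>1). a (if n \<in> B \<union> Y\<^sub>2 then ket n else s n) = ket n" by (rule bexE)
  have a_ket: "a (if n \<in> B \<union> Y\<^sub>2 then ket n else s n) = ket n" if "n \<in> - Y\<^sub>2 \<inter> (B \<union> Y\<^sub>1)" for n
    using a_all that by (rule bspec)
  have aB: "a \<in> fixer B"
  proof (rule fixerI[OF a])
    show "a (ket n) = ket n" if "n \<in> B" for n
    proof -
      have "n \<notin> Y\<^sub>2" using that disj by blast
      then show ?thesis using a_ket[of n] that by simp
    qed
  qed
  have a_s: "a (s n) = ket n" if "n \<in> Y\<^sub>1" for n
  proof -
    have "n \<notin> B \<union> Y\<^sub>2" using that disj Y12(2) by blast
    then show ?thesis using a_ket[of n] that by simp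
  qed
  obtain \<nu> where \<nu>: "bij_betw \<nu> Z Y\<^sub>1"
    using bij_betw_countably_infinite[of Z Y\<^sub>1] assms(1) Y12(3) unfolding Z_def by blast
  have \<nu>_in: "\<nu> n \<in> Y\<^sub>1" if "n \<in> Z" for n using \<nu> that by (auto simp: bij_betw_def)
  have \<nu>_inj: "\<nu> n = \<nu> m \<longleftrightarrow> n = m" if "n \<in> Z" "m \<in> Z" for n m
    using \<nu> that by (auto simp: bij_betw_def inj_on_def)
  have "\<exists>b\<^sub>2\<in>unitaries. \<forall>n\<in>B' \<union> Z. b\<^sub>2 (if n \<in> Z then ket (\<nu> n) else ket n) = (ket n :: 'a ell2)"
  proof (rule unitary_extension[of "B' \<union> Z \<union> Y\<^sub>2"])
    show "infinite (B' \<union> Z \<union> Y\<^sub>2 - (B' \<union> Z))"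
      using Y12(4) by (rule contrapos_nn) (erule finite_subset[rotated], blast dest: disjD)
    have "\<nu> n \<noteq> m" if "n \<in> Z" "m \<in> B' \<or> m \<in> Y\<^sub>2" for n m using \<nu>_in[OF that(1)] that(2) disj Y12(2) by blast
    then show "orthonormal (B' \<union> Z \<union> Y\<^sub>2) (\<lambda>n. if n \<in> Z then ket (\<nu> n) else ket n :: 'a ell2)"
      using \<nu>_inj disj by (auto simp: orthonormal_def)
  qed (auto simp: orthonormal_def)
  then obtain b\<^sub>2 where b\<^sub>2: "b\<^sub>2 \<in> unitaries"
      and b\<^sub>2_all: "\<forall>n\<in>B' \<union> Z. b\<^sub>2 (if n \<in> Z then ket (\<nu> n) else ket n) = (ket n :: 'a ell2)" by (rule bexE)
  have b\<^sub>2_ket: "b\<^sub>2 (if n \<in> Z then ket (\<nu> n) else ket n) = ket n" if "n \<in> B' \<union> Z" for n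
    using b\<^sub>2_all that by (rule bspec)
  have b\<^sub>2B: "b\<^sub>2 \<in> fixer B'"
  proof (rule fixerI[OF b\<^sub>2])
    show "b\<^sub>2 (ket n) = ket n" if "n \<in> B'" for n
    proof -
      have "n \<notin> Z" using that disj by blast
      then show ?thesis using b\<^sub>2_ket[of n] that by simp
    qed
  qed
  have "\<exists>c\<in>unitaries. \<forall>n\<in>B' \<union> Z. c (if n \<in> Z then z (\<nu> n) else ket n) = (ket n :: 'a ell2)"
  proof (rule unitary_extension[of UNIV])
    show "infinite (UNIV - (B' \<union> Z))"
      using Y12(4) by (rule contrapos_nn) (erule finite_subset[rotated], blast dest: disjD)
    show "orthonormal UNIV (\<lambda>n. if n \<in> Z then z (\<nu> n) else ket n)"
      using z \<nu>_inj by (auto simp: orthonormal_def ip_ket_left coord0)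
  qed (auto simp: orthonormal_def)
  then obtain c where c: "c \<in> unitaries"
      and c_all: "\<forall>n\<in>B' \<union> Z. c (if n \<in> Z then z (\<nu> n) else ket n) = ket n" by (rule bexE)
  have c_ket: "c (if n \<in> Z then z (\<nu> n) else ket n) = ket n" if "n \<in> B' \<union> Z" for n
    using c_all that by (rule bspec)
  have cB: "c \<in> fixer B'"
  proof (rule fixerI[OF c])
    show "c (ket n) = ket n" if "n \<in> B'" for n
    proof -
      have "n \<notin> Z" using that disj by blast
      then show ?thesis using c_ket[of n] that by simp
    qed
  qed
  define d where "d = b\<^sub>2 \<circ> (a \<circ> (b\<^sub>1 \<circ> (g \<circ> ginv c)))"
  have dB: "d (ket n) = ket n" if "n \<in> B" for n
  proof (cases "n \<in> B'")
    case True
    then show ?thesis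
      using that fixerD(2)[OF ginv_fixer[OF cB]] fixerD(2)[OF g] fixerD(2)[OF b\<^sub>1B] fixerD(2)[OF aB] fixerD(2)[OF b\<^sub>2B]
      by (simp add: d_def)
  next
    case False
    then have n: "n \<in> Z" using that by (simp add: Z_def)
    have cn: "c (z (\<nu> n)) = ket n" using c_ket[of n] n by simp
    have "ginv c (ket n) = z (\<nu> n)" unfolding cn[symmetric] by (rule unitary_ginv(2)[OF c])
    then have "d (ket n) = b\<^sub>2 (a (s (\<nu> n)))" by (simp add: d_def s_def)
    also have "\<dots> = ket n" using a_s[OF \<nu>_in[OF n]] b\<^sub>2_ket[of n] n by simp
    finally show ?thesis .
  qed
  have "d \<in> unitaries"
    unfolding d_def by (intro comp_in_unitaries ginv_in_unitaries b\<^sub>2 a b\<^sub>1 gU c)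
  then have "d \<in> fixer B" using dB by (rule fixerI)
  moreover have "g = ginv b\<^sub>1 \<circ> (ginv a \<circ> (ginv b\<^sub>2 \<circ> (d \<circ> c)))"
    using b\<^sub>1 a b\<^sub>2 c by (simp add: d_def fun_eq_iff)
  ultimately show ?thesis
    using ginv_fixer[OF b\<^sub>1B] ginv_fixer[OF aB] ginv_fixer[OF b\<^sub>2B] cB by (intro exI conjI)
qed

text \<open>
  The stabiliser of \<open>\<sigma> ` B\<close> is the conjugate of that of \<open>B\<close> by \<open>v\<close>, so it lies in the sixth power of
  \<open>P\<close>; the five factors of the preceding lemma need \<open>6 + 4 + 6 + 4 + 6 = 26\<close> elements.
\<close>

lemma stabiliser_captured_by_permutation:
  fixes P :: "('a::hilbert_scalar ell2 \<Rightarrow> 'a ell2) set"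
  assumes P: "symmetric P" and B: "fixer B \<subseteq> pow_set P 4"
    and v: "v \<in> P" and v_ket: "\<And>n. v (ket n) = ket (\<sigma> n)"
    and Z: "infinite (B - \<sigma> ` B)" and Y: "infinite (- (B \<union> \<sigma> ` B))"
  shows "fixer (B \<inter> \<sigma> ` B) \<subseteq> pow_set P 26"
proof
  fix g :: "'a ell2 \<Rightarrow> 'a ell2" assume "g \<in> fixer (B \<inter> \<sigma> ` B)"
  then obtain b\<^sub>1 a b\<^sub>2 d c where *: "b\<^sub>1 \<in> fixer (\<sigma> ` B)" "a \<in> fixer B" "b\<^sub>2 \<in> fixer (\<sigma> ` B)" "d \<in> fixer B" "c \<in> fixer (\<sigma> ` B)"
      "g = b\<^sub>1 \<circ> (a \<circ> (b\<^sub>2 \<circ> (d \<circ> c)))"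
    using stabiliser_of_intersection[OF Z Y] by blast
  have vU: "v \<in> unitaries" using symmetricD(1)[OF P v] .
  have conj: "h \<in> pow_set P (1 + (4 + 1))" if h: "h \<in> fixer (\<sigma> ` B)" for h
  proof -
    have "(ginv v \<circ> (h \<circ> v)) (ket n) = ket n" if "n \<in> B" for n
    proof -
      have "h (v (ket n)) = v (ket n)" unfolding v_ket using that by (intro fixerD(2)[OF h] imageI)
      then show ?thesis using vU by simp
    qed
    then have "ginv v \<circ> (h \<circ> v) \<in> fixer B"
      using vU fixerD(1)[OF h] by (intro fixerI comp_in_unitaries) auto
    then have "v \<circ> ((ginv v \<circ> (h \<circ> v)) \<circ> ginv v) \<in> pow_set P (1 + (4 + 1))"
      using B v symmetricD(2)[OF P v] by (intro pow_set_comp pow_set_1) auto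
    moreover have "v \<circ> ((ginv v \<circ> (h \<circ> v)) \<circ> ginv v) = h" using vU by (simp add: fun_eq_iff)
    ultimately show ?thesis by simp
  qed
  have "g \<in> pow_set P ((1 + (4 + 1)) + (4 + ((1 + (4 + 1)) + (4 + (1 + (4 + 1))))))"
    unfolding *(6) using *(1-5) B by (intro pow_set_comp conj) auto
  then show "g \<in> pow_set P 26" by simp
qed

subsection \<open>Almost disjoint sets\<close>

text \<open>
  The branches of the binary tree: \<open>D A\<close> consists of codes of the finite initial segments of \<open>A\<close>.
\<close>

lemma almost_disjoint_family:
  "\<exists>D :: nat set \<Rightarrow> nat set. (\<forall>A. infinite (D A)) \<and> (\<forall>A A'. A \<noteq> A' \<longrightarrow> finite (D A \<inter> D A')) \<and>
      (\<forall>A A'. infinite (- (D A \<union> D A')))"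
proof -
  define c where "c A k = prod_encode (k, set_encode (A \<inter> {..<k}))" for A :: "nat set" and k
  have c_eq: "c A k = c A' l \<longleftrightarrow> k = l \<and> A \<inter> {..<k} = A' \<inter> {..<l}" for A A' k l
    by (auto simp: c_def prod_encode_eq set_encode_eq)
  have "inj (c A)" for A by (rule injI) (simp add: c_eq)
  then have "infinite (range (c A))" for A by (simp add: finite_image_iff)
  moreover have "finite (range (c A) \<inter> range (c A'))" if neq: "A \<noteq> A'" for A A'
  proof -
    obtain i where i: "i \<in> A \<longleftrightarrow> i \<notin> A'" using neq by blast
    have "k \<le> i" if "A \<inter> {..<k} = A' \<inter> {..<k}" for k using that i by (metis IntE IntI lessThan_iff not_le)
    then have "range (c A) \<inter> range (c A') \<subseteq> c A ` {..i}" by (auto simp: c_eq)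
    then show ?thesis by (rule finite_subset) simp
  qed
  moreover have "infinite (- (range (c A) \<union> range (c A')))" for A A'
  proof -
    \<comment> \<open>These codes lie on no branch, since \<open>{k}\<close> is not a subset of \<open>{..<k}\<close>.\<close>
    let ?d = "\<lambda>k. prod_encode (k, set_encode {k})"
    have "?d k \<noteq> c A l" for k l A
    proof
      assume "?d k = c A l"
      then have kl: "k = l" and "set_encode {k} = set_encode (A \<inter> {..<l})"
        unfolding c_def prod_encode_eq prod.inject by blast+
      then have "{k} = A \<inter> {..<l}" by (subst (asm) set_encode_eq) simp_all
      then show False using kl by auto
    qed
    then have "range ?d \<subseteq> - (range (c A) \<union> range (c A'))" by auto
    moreover have "infinite (range ?d)" by (simp add: finite_image_iff inj_def prod_encode_eq)
    ultimately show ?thesis using finite_subset by blast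
  qed
  ultimately show ?thesis by (intro exI[of _ "\<lambda>A. range (c A)"]) blast
qed

lemma finite_stabiliser_captured:
  fixes P :: "nat \<Rightarrow> ('a::hilbert_scalar ell2 \<Rightarrow> 'a ell2) set"
  assumes P: "capturing P"
  shows "\<exists>n F. finite F \<and> fixer F \<subseteq> pow_set (P n) 26"
proof -
  obtain n\<^sub>1 B where B: "infinite B" "infinite (- B)" "fixer B \<subseteq> pow_set (P n\<^sub>1) 4"
    using infinite_stabiliser_captured[OF P] by blast
  obtain D :: "nat set \<Rightarrow> nat set" where D: "\<And>A. infinite (D A)" "\<And>A A'. A \<noteq> A' \<Longrightarrow> finite (D A \<inter> D A')"
      "\<And>A A'. infinite (- (D A \<union> D A'))"
    using almost_disjoint_family by blast
  have "\<exists>\<pi>. bij \<pi> \<and> \<pi> ` B = D A" for A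
  proof -
    have "infinite (- D A)" using D(3)[of A A] by simp
    then obtain f f' where f: "bij_betw f B (D A)" "bij_betw f' (- B) (- D A)"
      using bij_betw_countably_infinite B(1,2) D(1) by metis
    let ?\<pi> = "\<lambda>n. if n \<in> B then f n else f' n"
    have 1: "bij_betw ?\<pi> B (D A)" using f(1) by (rule bij_betw_cong[THEN iffD1, rotated]) simp
    have 2: "bij_betw ?\<pi> (- B) (- D A)" using f(2) by (rule bij_betw_cong[THEN iffD1, rotated]) simp
    have "bij ?\<pi>" using bij_betw_combine[OF 1 2] by simp
    then show ?thesis using 1 unfolding bij_betw_def by blast
  qed
  then obtain \<pi> where \<pi>: "\<And>A. bij (\<pi> A)" "\<And>A. \<pi> A ` B = D A" by metis
  have "\<forall>A. \<exists>h :: 'a ell2 \<Rightarrow> 'a ell2. h \<in> unitaries \<and> (\<forall>n. h (ket n) = ket (\<pi> A n))"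
    using unitary_of_permutation[OF \<pi>(1)] by blast
  from choice[OF this] obtain g :: "nat set \<Rightarrow> 'a ell2 \<Rightarrow> 'a ell2"
    where "\<forall>A. g A \<in> unitaries \<and> (\<forall>n. g A (ket n) = ket (\<pi> A n))" by (rule exE)
  then have g: "g A \<in> unitaries" "g A (ket n) = ket (\<pi> A n)" for A n by simp_all
  obtain n\<^sub>2 A A' where "A \<noteq> A'" and v: "ginv (g A) \<circ> g A' \<in> P n\<^sub>2"
    by (rule capturing_family[OF P g(1)])
  define \<sigma> where "\<sigma> = inv_into UNIV (\<pi> A) \<circ> \<pi> A'"
  have \<pi>inv: "\<pi> A (inv_into UNIV (\<pi> A) n) = n" "inv_into UNIV (\<pi> A) (\<pi> A n) = n" for n
    using \<pi>(1)[of A] by (simp_all add: bij_def surj_f_inv_f)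
  have v_ket: "(ginv (g A) \<circ> g A') (ket n) = ket (\<sigma> n)" for n
  proof -
    have "g A' (ket n) = g A (ket (\<sigma> n))" by (simp add: g \<sigma>_def \<pi>inv)
    then show ?thesis by (simp add: g(1))
  qed
  have inj: "inj (\<pi> A)" using \<pi>(1) bij_is_inj by blast
  have \<sigma>B: "\<pi> A ` (\<sigma> ` B) = D A'"
    by (simp add: \<sigma>_def image_image \<pi>inv \<pi>(2))
  have "\<pi> A ` (B \<inter> \<sigma> ` B) = D A \<inter> D A'" by (simp add: image_Int[OF inj] \<sigma>B \<pi>(2))
  then have fin: "finite (B \<inter> \<sigma> ` B)"
    using D(2)[OF \<open>A \<noteq> A'\<close>] inj by (metis finite_imageD inj_on_subset subset_UNIV)
  have "\<pi> A ` (- (B \<union> \<sigma> ` B)) = - (D A \<union> D A')"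
    using bij_image_Compl_eq[OF \<pi>(1), of A "B \<union> \<sigma> ` B"] by (simp add: image_Un \<sigma>B \<pi>(2))
  then have inf1: "infinite (- (B \<union> \<sigma> ` B))" using D(3)[of A A'] by (metis finite_imageI)
  have "B = (B - \<sigma> ` B) \<union> (B \<inter> \<sigma> ` B)" by blast
  then have inf2: "infinite (B - \<sigma> ` B)" using B(1) fin by (metis finite_UnI)
  let ?n = "max n\<^sub>1 n\<^sub>2"
  have mono: "P n\<^sub>1 \<subseteq> P ?n" "P n\<^sub>2 \<subseteq> P ?n" using capturingD(2)[OF P] by auto
  have "fixer (B \<inter> \<sigma> ` B) \<subseteq> pow_set (P ?n) 26"
  proof (rule stabiliser_captured_by_permutation[OF capturingD(1)[OF P] _ _ v_ket inf2 inf1])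
    show "fixer B \<subseteq> pow_set (P ?n) 4" using B(3) pow_set_mono[OF mono(1)] by (rule order_trans)
    show "ginv (g A) \<circ> g A' \<in> P ?n" using mono(2) v by (rule subsetD)
  qed
  then show ?thesis using fin by blast
qed

section \<open>Neighbourhoods of the identity\<close>

subsection \<open>Extending isometries between finite families\<close>

text \<open>
  The map fixes the orthogonal complement of \<open>d\<close> and multiplies \<open>d\<close> by \<open>1 - \<langle>d, d\<rangle> / t\<close>. The
  condition on \<open>t\<close> says that this factor, which equals \<open>- cj t / t\<close>, has absolute value \<open>1\<close>; over
  the reals the map is the orthogonal reflection in \<open>d\<close>.
\<close>

lemma reflection_unitary:
  fixes d :: "'a::hilbert_scalar ell2"
  assumes t: "t \<noteq> 0" and td: "t + cj t = ip d d"
  shows "(\<lambda>x. x - (ip x d / t) \<cdot> d) \<in> unitaries"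
proof -
  have t': "cj t \<noteq> 0" using t by (metis norm_cj norm_eq_zero)
  define R where "R t x = x - (ip x d / t) \<cdot> d" for t :: 'a and x
  have inverse: "R a (R b x) = x" if "a \<noteq> 0" "b \<noteq> 0" "a + b = ip d d" for a b x
  proof -
    have "ip (R b x) d = ip x d - ip x d / b * (a + b)"
      by (simp add: R_def ip_diff_left ip_scal_left that(3))
    also have "\<dots> = - (ip x d * a / b)" using that(1,2) by (simp add: field_simps)
    finally have "R a (R b x) = R b x - (- (ip x d / b)) \<cdot> d" using that by (simp add: R_def)
    then show ?thesis by (simp add: R_def)
  qed
  have "bij (R t)"
    by (rule o_bij[of "R (cj t)"]) (use inverse[of t "cj t"] inverse[of "cj t" t] t t' td in \<open>simp_all add: fun_eq_iff add.commute\<close>)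
  moreover have "R t (x + y) = R t x + R t y" for x y
    by (simp add: R_def ip_add_left add_divide_distrib scal_distribs)
  moreover have "R t (c \<cdot> x) = c \<cdot> R t x" for c x
    by (simp add: R_def ip_scal_left scal_distribs)
  moreover have "ip (R t x) (R t y) = ip x y" for x y
  proof -
    have "ip (R t x) (R t y) = ip x y - (ip d y / cj t) * ip x d - (ip x d / t) * ip d y
        + (ip x d / t) * (ip d y / cj t) * ip d d"
      by (simp add: R_def ip_diff_left ip_diff_right ip_scal_left ip_scal_right cj_ip algebra_simps)
    also have "\<dots> = ip x y" unfolding td[symmetric] using t t' by (simp add: field_simps)
    finally show ?thesis .
  qed
  ultimately have "R t \<in> unitaries" by (simp add: unitaries_def)
  then show ?thesis unfolding R_def .
qed

text \<open>
  The reflection in \<open>d = x - y\<close> with \<open>t = \<langle>x, d\<rangle>\<close> takes \<open>x\<close> to \<open>y\<close>, and it fixes \<open>V\<close> because \<open>d\<close> is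
  orthogonal to \<open>V\<close>.
\<close>

lemma unitary_moving_one_vector:
  fixes x y :: "'a::hilbert_scalar ell2"
  assumes n: "ip x x = ip y y" and V: "\<And>v. v \<in> V \<Longrightarrow> ip x v = ip y v"
  shows "\<exists>g\<in>unitaries. g x = y \<and> (\<forall>v\<in>V. g v = v)"
proof (cases "x = y")
  case True
  then show ?thesis by (intro bexI[of _ id]) auto
next
  case False
  define d t where "d = x - y" and "t = ip x d"
  have td: "t + cj t = ip d d"
    using n by (simp add: t_def d_def cj_ip ip_diff_left ip_diff_right)
  have "t \<noteq> 0" using td False by (auto simp: d_def)
  moreover have "ip v d = 0" if "v \<in> V" for v
  proof -
    have "ip d v = 0" using V[OF that] by (simp add: d_def ip_diff_left)
    then show ?thesis by (metis cj_0 cj_ip)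
  qed
  ultimately show ?thesis
    by (intro bexI[OF _ reflection_unitary[OF _ td]]) (auto simp: d_def[symmetric] t_def[symmetric], simp add: d_def)
qed

text \<open>
  Witt's theorem for finite families: adjust one vector at a time by a reflection that does not
  disturb those already in place.
\<close>

lemma unitary_extends_finite_isometry:
  fixes a b :: "'i \<Rightarrow> 'a::hilbert_scalar ell2"
  assumes "finite I" "\<And>i j. i \<in> I \<Longrightarrow> j \<in> I \<Longrightarrow> ip (a i) (a j) = ip (b i) (b j)"
  shows "\<exists>g\<in>unitaries. \<forall>i\<in>I. g (a i) = b i"
  using assms
proof induction
  case empty
  show ?case by (intro bexI[of _ id]) auto
next
  case (insert k I)
  then obtain g where g: "g \<in> unitaries" "\<And>i. i \<in> I \<Longrightarrow> g (a i) = b i" by auto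
  have "ip (g (a k)) (g (a k)) = ip (b k) (b k)" using insert.prems[of k k] by (simp add: unitary_ip[OF g(1)])
  moreover have "ip (g (a k)) v = ip (b k) v" if v: "v \<in> b ` I" for v
  proof -
    obtain i where i: "i \<in> I" "v = b i" using v by blast
    then have "ip (g (a k)) v = ip (g (a k)) (g (a i))" using g(2) by simp
    also have "\<dots> = ip (b k) (b i)" using insert.prems[of k i] i by (simp add: unitary_ip[OF g(1)])
    finally show ?thesis using i by simp
  qed
  ultimately obtain h where h: "h \<in> unitaries" "h (g (a k)) = b k" "\<forall>v\<in>b ` I. h v = v"
    using unitary_moving_one_vector[of "g (a k)" "b k" "b ` I"] by blast
  have "\<forall>i\<in>insert k I. (h \<circ> g) (a i) = b i" using g(2) h(2,3) by simp
  then show ?case using comp_in_unitaries[OF h(1) g(1)] by blast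
qed

lemma unitary_extends_two_finite_isometries:
  fixes a b :: "'i \<Rightarrow> 'a::hilbert_scalar ell2" and c d :: "'j \<Rightarrow> 'a ell2"
  assumes fin: "finite I" "finite J"
    and aa: "\<And>i j. i \<in> I \<Longrightarrow> j \<in> I \<Longrightarrow> ip (a i) (a j) = ip (b i) (b j)"
    and ac: "\<And>i j. i \<in> I \<Longrightarrow> j \<in> J \<Longrightarrow> ip (a i) (c j) = ip (b i) (d j)"
    and cc: "\<And>i j. i \<in> J \<Longrightarrow> j \<in> J \<Longrightarrow> ip (c i) (c j) = ip (d i) (d j)"
  shows "\<exists>g\<in>unitaries. (\<forall>i\<in>I. g (a i) = b i) \<and> (\<forall>j\<in>J. g (c j) = d j)"
proof -
  have ca: "ip (c j) (a i) = ip (d j) (b i)" if "i \<in> I" "j \<in> J" for i j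
    using ac[OF that] by (metis cj_ip)
  have "\<exists>g\<in>unitaries. \<forall>i\<in>I <+> J. g (case_sum a c i) = case_sum b d i"
    by (rule unitary_extends_finite_isometry) (use fin in \<open>auto simp: aa ac cc ca\<close>)
  then obtain g where g: "g \<in> unitaries" "\<forall>i\<in>I <+> J. g (case_sum a c i) = case_sum b d i" by blast
  have "g (a i) = b i" if "i \<in> I" for i using bspec[OF g(2) InlI[OF that]] by simp
  moreover have "g (c j) = d j" if "j \<in> J" for j using bspec[OF g(2) InrI[OF that]] by simp
  ultimately show ?thesis using g(1) by blast
qed

subsection \<open>Families with a prescribed Gram matrix\<close>

text \<open>
  A Hermitian matrix close to the identity is a Gram matrix. Take an orthonormal family \<open>q\<close> indexed
  by pairs of indices. For \<open>i < j\<close> only \<open>\<zeta> i\<close> and \<open>\<zeta> j\<close> have a component along \<open>q (i, j)\<close>, with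
  coefficients \<open>N i j / \<delta>\<close> and \<open>\<delta>\<close>; their product is the required entry. These coefficients are
  at most \<open>\<delta>\<close> in absolute value, so they leave a nonnegative remainder \<open>\<nu> i - s i\<close> of the squared
  norm of \<open>\<zeta> i\<close>, which is supplied by the component along \<open>q (i, i)\<close>.
\<close>

lemma family_with_gram_matrix:
  fixes N :: "nat \<Rightarrow> nat \<Rightarrow> 'a::hilbert_scalar" and V :: "'a ell2 set"
  assumes I: "finite I" and V: "finite V" and \<delta>: "\<delta> > 0" "(real (card I))\<^sup>2 * \<delta>\<^sup>2 \<le> 1 / 2"
    and herm: "\<And>i j. cj (N i j) = N j i"
    and diag: "\<And>i. i \<in> I \<Longrightarrow> N i i = of_real (\<nu> i)" "\<And>i. i \<in> I \<Longrightarrow> \<nu> i \<ge> 1 / 2"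
    and small: "\<And>i j. i \<in> I \<Longrightarrow> j \<in> I \<Longrightarrow> i \<noteq> j \<Longrightarrow> norm (N i j) \<le> \<delta>\<^sup>2"
  shows "\<exists>\<zeta>. (\<forall>i\<in>I. \<forall>j\<in>I. ip (\<zeta> i) (\<zeta> j) = N i j) \<and> (\<forall>i. \<forall>v\<in>V. ip (\<zeta> i) v = 0)"
proof -
  obtain z :: "nat \<Rightarrow> 'a ell2" where z: "orthonormal UNIV z" "\<And>k v. v \<in> V \<Longrightarrow> ip (z k) v = 0"
    using orthonormal_sequence_avoiding[OF V infinite_UNIV_nat] by blast
  define q where "q = z \<circ> prod_encode"
  have q: "orthonormal (I \<times> I) q"
    using z(1) by (auto simp: orthonormal_def q_def prod_encode_eq)
  define e where "e i p = (if fst p = i \<and> i < snd p then N i (snd p) / of_real \<delta>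
      else if snd p = i \<and> fst p < i then of_real \<delta> else 0)" for i and p :: "nat \<times> nat"
  define s where "s i = (\<Sum>p\<in>I \<times> I. (norm (e i p))\<^sup>2)" for i
  have s_le: "s i \<le> 1 / 2" if i: "i \<in> I" for i
  proof -
    have "(norm (e i p))\<^sup>2 \<le> \<delta>\<^sup>2" if "p \<in> I \<times> I" for p
    proof -
      have "norm (e i p) \<le> \<delta>"
      proof (cases "fst p = i \<and> i < snd p")
        case True
        then have "norm (N i (snd p)) \<le> \<delta>\<^sup>2" using small[OF i, of "snd p"] that by auto
        then show ?thesis using True \<delta>(1) by (simp add: e_def norm_divide divide_le_eq power2_eq_square)
      next
        case False
        then show ?thesis using \<delta>(1) by (auto simp: e_def)
      qed
      then show ?thesis by (intro power_mono) auto
    qed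
    then have "s i \<le> (\<Sum>p\<in>I \<times> I. \<delta>\<^sup>2)" unfolding s_def by (rule sum_mono)
    also have "\<dots> = (real (card I))\<^sup>2 * \<delta>\<^sup>2" by (simp add: card_cartesian_product power2_eq_square)
    finally show ?thesis using \<delta>(2) by linarith
  qed
  define r where "r i = sqrt (\<nu> i - s i)" for i
  have r: "(r i)\<^sup>2 = \<nu> i - s i" if "i \<in> I" for i using s_le[OF that] diag(2)[OF that] by (simp add: r_def)
  define c where "c i p = (if p = (i, i) then of_real (r i) else e i p)" for i p
  define \<zeta> where "\<zeta> i = (\<Sum>p\<in>I \<times> I. c i p \<cdot> q p)" for i
  have finI: "finite (I \<times> I)" using I by simp
  have ip_\<zeta>: "ip (\<zeta> i) (\<zeta> j) = (\<Sum>p\<in>I \<times> I. c i p * cj (c j p))" for i j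
    unfolding \<zeta>_def by (rule ip_orthonormal_sums[OF q finI])
  have lt: "ip (\<zeta> i) (\<zeta> j) = N i j" if "i \<in> I" "j \<in> I" "i < j" for i j
  proof -
    have "ip (\<zeta> i) (\<zeta> j) = (\<Sum>p\<in>I \<times> I. if p = (i, j) then N i j else 0)"
      unfolding ip_\<zeta> using that \<delta>(1) by (intro sum.cong refl) (auto simp: c_def e_def)
    then show ?thesis using that finI by simp
  qed
  have eq: "ip (\<zeta> i) (\<zeta> i) = N i i" if i: "i \<in> I" for i
  proof -
    have "c i p * cj (c i p) = of_real ((norm (e i p))\<^sup>2) + (if p = (i, i) then of_real ((r i)\<^sup>2) else 0)" for p
    proof (cases "p = (i, i)")
      case True
      then show ?thesis by (simp add: c_def e_def power2_eq_square)
    next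
      case False
      then show ?thesis by (simp add: c_def mult_cj_self)
    qed
    then have "ip (\<zeta> i) (\<zeta> i) = of_real (s i) + of_real ((r i)\<^sup>2)"
      unfolding ip_\<zeta> s_def using i finI by (simp only: sum.distrib of_real_sum) simp
    then show ?thesis using r[OF i] diag(1)[OF i] by simp
  qed
  have "ip (\<zeta> i) (\<zeta> j) = N i j" if "i \<in> I" "j \<in> I" for i j
  proof (rule linorder_cases[of i j])
    assume "j < i"
    then have "ip (\<zeta> j) (\<zeta> i) = N j i" using lt that by blast
    then show ?thesis by (metis cj_ip herm)
  qed (use that lt eq in auto)
  moreover have "ip (\<zeta> i) v = 0" if "v \<in> V" for i v
    using z(2)[OF that] by (simp add: \<zeta>_def q_def ip_sum_left ip_scal_left)
  ultimately show ?thesis by blast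
qed

text \<open>
  The prescribed products determine the component \<open>\<eta> i\<close> of \<open>z i\<close> in the span of \<open>p\<close>. The component
  \<open>\<zeta> i\<close> orthogonal to it must correct the Gram matrix of \<open>\<eta>\<close> to the identity, which is possible
  because that Gram matrix is small.
\<close>

lemma orthonormal_family_with_prescribed_products:
  fixes I :: "nat set"
  assumes I: "finite I"
  shows "\<exists>\<epsilon>>0. \<forall>(p :: nat \<Rightarrow> 'a::hilbert_scalar ell2) W M. orthonormal I p \<longrightarrow> finite W \<longrightarrow>
      (\<forall>i\<in>I. \<forall>w\<in>W. ip (p i) w = 0) \<longrightarrow> (\<forall>i\<in>I. \<forall>j\<in>I. norm (M i j) < \<epsilon>) \<longrightarrow>
      (\<exists>z. orthonormal I z \<and> (\<forall>i\<in>I. \<forall>j\<in>I. ip (z i) (p j) = M i j) \<and> (\<forall>i\<in>I. \<forall>w\<in>W. ip (z i) w = 0))"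
proof -
  define m where "m = real (card I) + 1"
  have m: "m > 0" "real (card I) \<le> m" "1 \<le> m" by (simp_all add: m_def)
  define \<delta> where "\<delta> = 1 / (2 * m)"
  define \<epsilon> where "\<epsilon> = \<delta> / m"
  have \<delta>: "\<delta> > 0" using m by (simp add: \<delta>_def)
  have \<epsilon>: "\<epsilon> > 0" using \<delta> m by (simp add: \<epsilon>_def)
  have card: "0 \<le> real (card I) / m" "real (card I) / m \<le> 1" using m by simp_all
  have "(real (card I))\<^sup>2 * \<delta>\<^sup>2 = (real (card I) / m)\<^sup>2 / 4"
    by (simp add: \<delta>_def power_divide power_mult_distrib)
  also have "\<dots> \<le> 1 / 4" using card by (simp add: power_le_one)
  finally have \<delta>2: "(real (card I))\<^sup>2 * \<delta>\<^sup>2 \<le> 1 / 2" by simp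
  have "real (card I) * \<epsilon>\<^sup>2 = (real (card I) / m) * (\<delta>\<^sup>2 / m)"
    by (simp add: \<epsilon>_def power2_eq_square)
  also have "\<dots> \<le> 1 * \<delta>\<^sup>2"
    by (intro mult_mono card) (use m in \<open>auto simp: divide_le_eq mult_le_cancel_left1\<close>)
  finally have \<epsilon>2: "real (card I) * \<epsilon>\<^sup>2 \<le> \<delta>\<^sup>2" by simp
  have "\<delta> \<le> 1 / 2" using m by (simp add: \<delta>_def divide_le_eq)
  then have \<delta>half: "\<delta>\<^sup>2 \<le> 1 / 2" using \<delta> power_mono[of \<delta> "1/2" 2] by (simp add: power2_eq_square)
  have ex: "\<exists>z. orthonormal I z \<and> (\<forall>i\<in>I. \<forall>j\<in>I. ip (z i) (p j) = M i j) \<and> (\<forall>i\<in>I. \<forall>w\<in>W. ip (z i) w = 0)"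
    if p: "orthonormal I p" and W: "finite W" and pW: "\<And>i w. i \<in> I \<Longrightarrow> w \<in> W \<Longrightarrow> ip (p i) w = 0"
      and M: "\<And>i j. i \<in> I \<Longrightarrow> j \<in> I \<Longrightarrow> norm (M i j) < \<epsilon>"
    for p :: "nat \<Rightarrow> 'a ell2" and W M
  proof -
    define S where "S i j = (\<Sum>l\<in>I. M i l * cj (M j l))" for i j
    define N where "N i j = (if i = j then 1 else 0) - S i j" for i j
    have S_le: "norm (S i j) \<le> \<delta>\<^sup>2" if "i \<in> I" "j \<in> I" for i j
    proof -
      have "norm (S i j) \<le> (\<Sum>l\<in>I. norm (M i l * cj (M j l)))" unfolding S_def by (rule norm_sum)
      also have "\<dots> \<le> (\<Sum>l\<in>I. \<epsilon>\<^sup>2)"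
      proof (rule sum_mono)
        fix l assume l: "l \<in> I"
        have "norm (M i l) * norm (M j l) \<le> \<epsilon> * \<epsilon>"
          using M[OF that(1) l] M[OF that(2) l] \<epsilon> by (intro mult_mono) simp_all
        then show "norm (M i l * cj (M j l)) \<le> \<epsilon>\<^sup>2" by (simp add: norm_mult power2_eq_square)
      qed
      also have "\<dots> \<le> \<delta>\<^sup>2" using \<epsilon>2 by simp
      finally show ?thesis .
    qed
    define \<sigma> where "\<sigma> i = (\<Sum>l\<in>I. (norm (M i l))\<^sup>2)" for i
    have S_diag: "S i i = of_real (\<sigma> i)" for i by (simp add: S_def \<sigma>_def mult_cj_self)
    have \<sigma>_le: "\<sigma> i \<le> 1 / 2" if "i \<in> I" for i
    proof -
      have "\<bar>\<sigma> i\<bar> \<le> \<delta>\<^sup>2" using S_le[OF that that] by (simp add: S_diag)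
      then show ?thesis using \<delta>half by linarith
    qed
    have "\<exists>\<zeta>. (\<forall>i\<in>I. \<forall>j\<in>I. ip (\<zeta> i) (\<zeta> j) = N i j) \<and> (\<forall>i. \<forall>v\<in>W \<union> p ` I. ip (\<zeta> i) v = 0)"
    proof (rule family_with_gram_matrix[OF I _ \<delta> \<delta>2])
      show "finite (W \<union> p ` I)" using W I by simp
      show "cj (N i j) = N j i" for i j by (simp add: N_def S_def cj_sum mult.commute)
      show "N i i = of_real (1 - \<sigma> i)" if "i \<in> I" for i by (simp add: N_def S_diag)
      show "1 - \<sigma> i \<ge> 1 / 2" if "i \<in> I" for i using \<sigma>_le[OF that] by simp
      show "norm (N i j) \<le> \<delta>\<^sup>2" if "i \<in> I" "j \<in> I" "i \<noteq> j" for i j using S_le that by (simp add: N_def)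
    qed
    then obtain \<zeta> where \<zeta>: "\<And>i j. i \<in> I \<Longrightarrow> j \<in> I \<Longrightarrow> ip (\<zeta> i) (\<zeta> j) = N i j"
        "\<And>i v. v \<in> W \<union> p ` I \<Longrightarrow> ip (\<zeta> i) v = 0" by blast
    define \<eta> where "\<eta> i = (\<Sum>l\<in>I. M i l \<cdot> p l)" for i
    define z where "z i = \<eta> i + \<zeta> i" for i
    have \<zeta>_\<eta>: "ip (\<zeta> i) (\<eta> j) = 0" for i j
      using \<zeta>(2) by (simp add: \<eta>_def ip_sum_right ip_scal_right)
    then have \<eta>_\<zeta>: "ip (\<eta> j) (\<zeta> i) = 0" for i j by (metis cj_0 cj_ip)
    have "ip (\<eta> i) (\<eta> j) = S i j" for i j
      unfolding \<eta>_def S_def by (rule ip_orthonormal_sums[OF p I])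
    then have "ip (z i) (z j) = S i j + N i j" if "i \<in> I" "j \<in> I" for i j
      using \<zeta>(1)[OF that] by (simp add: z_def ip_add_left ip_add_right \<zeta>_\<eta> \<eta>_\<zeta>)
    then have "orthonormal I z" by (simp add: orthonormal_def N_def)
    moreover have "ip (z i) (p j) = M i j" if "i \<in> I" "j \<in> I" for i j
      using ip_orthonormal_sum_right[OF p I that(2), of "M i"] \<zeta>(2)[of "p j" i] that
      by (simp add: z_def ip_add_left \<eta>_def)
    moreover have "ip (z i) w = 0" if "i \<in> I" "w \<in> W" for i w
      using \<zeta>(2)[of w i] pW that by (simp add: z_def ip_add_left \<eta>_def ip_sum_left ip_scal_left)
    ultimately show ?thesis by blast
  qed
  show ?thesis
  proof (intro exI[of _ \<epsilon>] conjI allI impI)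
    fix p :: "nat \<Rightarrow> 'a ell2" and W and M :: "nat \<Rightarrow> nat \<Rightarrow> 'a"
    assume "orthonormal I p" "finite W" "\<forall>i\<in>I. \<forall>w\<in>W. ip (p i) w = 0" "\<forall>i\<in>I. \<forall>j\<in>I. norm (M i j) < \<epsilon>"
    then show "\<exists>z. orthonormal I z \<and> (\<forall>i\<in>I. \<forall>j\<in>I. ip (z i) (p j) = M i j) \<and> (\<forall>i\<in>I. \<forall>w\<in>W. ip (z i) w = 0)"
      by (intro ex) simp_all
  qed (rule \<epsilon>)
qed

subsection \<open>From a stabiliser to a neighbourhood\<close>

text \<open>
  Rotate each \<open>e\<^sub>i\<close> with \<open>i \<in> F\<close> by the angle \<open>\<theta> A\<close> in the plane spanned by \<open>e\<^sub>i\<close> and a further basis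
  vector \<open>e\<^bsub>i+K\<^esub>\<close>. The quotient for \<open>A\<close> and \<open>B\<close> has the stated form with \<open>c = cos (\<theta> B - \<theta> A)\<close>.
\<close>

lemma rotation_captured:
  fixes P :: "nat \<Rightarrow> ('a::hilbert_scalar ell2 \<Rightarrow> 'a ell2) set"
  assumes P: "capturing P" and F: "finite F"
  shows "\<exists>n. \<exists>v\<in>P n. \<exists>c. c\<^sup>2 < 1 \<and> (\<forall>i\<in>F. \<forall>j\<in>F. ip (v (ket i)) (ket j) = (if i = j then of_real c else 0))"
proof -
  obtain \<theta> :: "nat set \<Rightarrow> real" where \<theta>: "inj \<theta>" "\<And>A. 0 \<le> \<theta> A" "\<And>A. \<theta> A < 1"
    using nat_sets_lepoll_reals01 unfolding lepoll_def by (force simp: image_subset_iff)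
  obtain K where K: "\<And>i. i \<in> F \<Longrightarrow> i < K" using F by (metis finite_nat_set_iff_bounded)
  define b where "b A i = of_real (cos (\<theta> A)) \<cdot> ket i + of_real (sin (\<theta> A)) \<cdot> (ket (i + K) :: 'a ell2)" for A i
  have b: "ip (b A i) (b B j) = (if i = j then of_real (cos (\<theta> A - \<theta> B)) else 0)" if "i \<in> F" "j \<in> F" for A B i j
    using K[OF that(1)] K[OF that(2)]
    by (auto simp: b_def ip_add_left ip_add_right ip_scal_left ip_scal_right cos_diff)
  have "\<exists>g\<in>unitaries. \<forall>i\<in>F. g (ket i) = b A i" for A
    by (rule unitary_extends_finite_isometry[OF F]) (use b in auto)
  then have "\<forall>A. \<exists>g. g \<in> unitaries \<and> (\<forall>i\<in>F. g (ket i) = b A i)" by blast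
  from choice[OF this] obtain g where "\<forall>A. g A \<in> unitaries \<and> (\<forall>i\<in>F. g A (ket i) = b A i)" by (rule exE)
  then have g: "g A \<in> unitaries" "i \<in> F \<Longrightarrow> g A (ket i) = b A i" for A i by simp_all
  obtain n A B where "A \<noteq> B" and v: "ginv (g A) \<circ> g B \<in> P n"
    by (rule capturing_family[OF P g(1)])
  let ?x = "\<theta> B - \<theta> A"
  have "?x \<noteq> 0" using \<open>A \<noteq> B\<close> \<theta>(1) by (auto dest: injD)
  moreover have "\<bar>?x\<bar> < pi"
    using \<theta>(2)[of A] \<theta>(3)[of A] \<theta>(2)[of B] \<theta>(3)[of B] pi_gt3 by linarith
  ultimately have "sin ?x \<noteq> 0"
    by (simp add: sin_zero_pi_iff)
  then have "(cos ?x)\<^sup>2 < 1" using sin_cos_squared_add[of ?x] by (smt (verit) zero_less_power2)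
  moreover have "ip ((ginv (g A) \<circ> g B) (ket i)) (ket j) = (if i = j then of_real (cos ?x) else 0)"
    if "i \<in> F" "j \<in> F" for i j
  proof -
    have "ip (ginv (g A) (g B (ket i))) (ket j) = ip (g B (ket i)) (g A (ket j))"
      by (rule ip_ginv[OF g(1)])
    then show ?thesis using b[OF that] g(2) that by simp
  qed
  ultimately show ?thesis using v by blast
qed

text \<open>
  Let \<open>U\<close> and \<open>U'\<close> be the stabilisers of \<open>e\<^sub>i\<close> and of \<open>f' i = v e\<^sub>i\<close> for \<open>i \<in> F\<close>. In the notation of the
  proof, \<open>e\<^sub>i = c f' i + s p i\<close> with \<open>p i\<close> orthogonal to all \<open>f' j\<close>. If \<open>u \<in> U'\<close> maps \<open>p\<close> to \<open>z\<close>, then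
  \<open>\<langle>u e\<^sub>i, e\<^sub>j\<rangle> = c\<^sup>2 \<delta>\<^sub>i\<^sub>j + s\<^sup>2 \<langle>z i, p j\<rangle>\<close>. So by a suitable choice of \<open>z\<close> the tuples \<open>u e\<close>
  realise all matrices of products with \<open>e\<close> in a ball around \<open>c\<^sup>2\<close> times the identity matrix. The
  centre is realised by some \<open>y = u\<^sub>0 e\<close>. If \<open>g\<close> moves \<open>y\<close> only little, then the matrix of \<open>g y\<close> is in
  that ball, so \<open>g y\<close> and some \<open>u e\<close> are in the same orbit of \<open>U\<close>, which means that
  \<open>g \<in> U u U u\<^sub>0\<^sup>-\<^sup>1\<close>. Working around \<open>y\<close> instead of \<open>e\<close> is essential: the matrix of \<open>e\<close> is the
  identity, which is on the boundary of the set of contractions. The exponent is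
  \<open>26 + 28 + 26 + 28 = 108\<close>.
\<close>

lemma neighbourhood_captured:
  fixes P :: "nat \<Rightarrow> ('a::hilbert_scalar ell2 \<Rightarrow> 'a ell2) set"
  assumes P: "capturing P"
  shows "\<exists>n X \<epsilon>. finite X \<and> \<epsilon> > 0 \<and>
           (\<forall>g\<in>unitaries. (\<forall>x\<in>X. norm (g x - x) < \<epsilon>) \<longrightarrow> g \<in> pow_set (P n) 108)"
proof -
  obtain n\<^sub>1 F where F: "finite F" and FP: "fixer F \<subseteq> pow_set (P n\<^sub>1) 26"
    using finite_stabiliser_captured[OF P] by blast
  obtain n\<^sub>2 v c where v: "v \<in> P n\<^sub>2" and c: "c\<^sup>2 < 1"
      and v_ket: "\<And>i j. i \<in> F \<Longrightarrow> j \<in> F \<Longrightarrow> ip (v (ket i)) (ket j) = (if i = j then of_real c else 0)"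
    using rotation_captured[OF P F] by blast
  define n where "n = max n\<^sub>1 n\<^sub>2"
  have mono: "P n\<^sub>1 \<subseteq> P n" "P n\<^sub>2 \<subseteq> P n" using capturingD(2)[OF P] by (auto simp: n_def)
  note sym = capturingD(1)[OF P, of n]
  have vP: "v \<in> P n" using v mono(2) by blast
  then have vU: "v \<in> unitaries" by (rule symmetricD(1)[OF sym])
  have fixer_P: "fixer F \<subseteq> pow_set (P n) 26" using FP pow_set_mono[OF mono(1)] by (rule order_trans)
  define f' where "f' i = v (ket i)" for i
  have fixer'_P: "u \<in> pow_set (P n) (1 + (26 + 1))" if u: "u \<in> unitaries" "\<And>i. i \<in> F \<Longrightarrow> u (f' i) = f' i" for u
  proof -
    have "ginv v \<circ> (u \<circ> v) \<in> unitaries" by (intro comp_in_unitaries ginv_in_unitaries vU u(1))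
    moreover have "(ginv v \<circ> (u \<circ> v)) (ket i) = ket i" if "i \<in> F" for i
      using u(2)[OF that] vU by (simp add: f'_def)
    ultimately have "ginv v \<circ> (u \<circ> v) \<in> fixer F" by (rule fixerI)
    then have "v \<circ> ((ginv v \<circ> (u \<circ> v)) \<circ> ginv v) \<in> pow_set (P n) (1 + (26 + 1))"
      using fixer_P by (intro pow_set_comp pow_set_1 vP symmetricD(2)[OF sym]) blast
    moreover have "v \<circ> ((ginv v \<circ> (u \<circ> v)) \<circ> ginv v) = u" using vU by (simp add: fun_eq_iff)
    ultimately show ?thesis by simp
  qed
  define s where "s = sqrt (1 - c\<^sup>2)"
  have s: "s > 0" "s\<^sup>2 = 1 - c\<^sup>2" using c by (simp_all add: s_def)
  let ?c = "of_real c :: 'a" and ?s = "of_real s :: 'a"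
  have cs: "?c * ?c + ?s * ?s = 1"
    using s(2) by (simp add: power2_eq_square flip: of_real_mult of_real_add)
  have s0: "?s \<noteq> 0" using s(1) by simp
  have ff: "ip (f' i) (f' j) = (if i = j then 1 else 0)" for i j
    by (simp add: f'_def unitary_ip[OF vU])
  have f'_ket: "ip (f' i) (ket j) = (if i = j then ?c else 0)" if "i \<in> F" "j \<in> F" for i j
    using v_ket[OF that] by (simp add: f'_def)
  have ket_f': "ip (ket j) (f' i) = (if i = j then ?c else 0)" if "i \<in> F" "j \<in> F" for i j
    using cj_ip[of "f' i" "ket j", symmetric] f'_ket[OF that] by (cases "i = j") (simp_all del: ip_ket)
  \<comment> \<open>The normalised component of \<open>e\<^sub>i\<close> orthogonal to \<open>f'\<close>.\<close>
  define p where "p i = (1 / ?s) \<cdot> (ket i - ?c \<cdot> f' i)" for i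
  have ket_eq: "ket i = ?c \<cdot> f' i + ?s \<cdot> p i" for i using s0 by (simp add: p_def)
  have f'_p: "ip (f' i) (p j) = 0" if "i \<in> F" "j \<in> F" for i j
    using that by (simp add: p_def ip_scal_right ip_diff_right ff f'_ket del: ip_ket)
  then have p_f': "ip (p j) (f' i) = 0" if "i \<in> F" "j \<in> F" for i j using that by (metis cj_0 cj_ip)
  have pp: "ip (p i) (p j) = (if i = j then 1 else 0)" if "i \<in> F" "j \<in> F" for i j
  proof -
    have "ip (ket i) (ket j :: 'a ell2) = ?c * ?c * ip (f' i) (f' j) + ?s * ?s * ip (p i) (p j)"
      unfolding ket_eq using f'_p p_f' that
      by (simp add: ip_add_left ip_add_right ip_scal_left ip_scal_right)
    then have "?s * ?s * ip (p i) (p j) = (if i = j then 1 - ?c * ?c else 0)"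
      by (cases "i = j") (simp_all add: ff eq_diff_eq add.commute)
    also have "\<dots> = ?s * ?s * (if i = j then 1 else 0)" using cs by (auto simp: algebra_simps)
    finally show ?thesis using s0 by simp
  qed
  have ortho_p: "orthonormal F p" using pp by (simp add: orthonormal_def)
  obtain w :: "nat \<Rightarrow> 'a ell2" where w: "orthonormal UNIV w"
      and w0: "\<And>k x. x \<in> ket ` F \<union> f' ` F \<Longrightarrow> ip (w k) x = 0"
    using orthonormal_sequence_avoiding[of "ket ` F \<union> f' ` F" UNIV] F by auto
  have w0': "ip x (w k) = 0" if "x \<in> ket ` F \<union> f' ` F" for x k using w0[OF that] by (metis cj_0 cj_ip)
  have "\<exists>u\<in>unitaries. (\<forall>i\<in>F. u (f' i) = f' i) \<and> (\<forall>i\<in>F. u (p i) = w i)"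
    by (rule unitary_extends_two_finite_isometries[OF F F])
       (use w in \<open>simp_all add: f'_p w0' pp orthonormal_def\<close>)
  then obtain u\<^sub>0 where u\<^sub>0: "u\<^sub>0 \<in> unitaries" "\<And>i. i \<in> F \<Longrightarrow> u\<^sub>0 (f' i) = f' i" "\<And>i. i \<in> F \<Longrightarrow> u\<^sub>0 (p i) = w i"
    by blast
  define y where "y i = u\<^sub>0 (ket i)" for i
  have y_eq: "y i = ?c \<cdot> f' i + ?s \<cdot> w i" if "i \<in> F" for i
    unfolding y_def ket_eq[of i] using u\<^sub>0 that by (simp add: unitary_add unitary_scal)
  have y_ket: "ip (y i) (ket j) = (if i = j then ?c * ?c else 0)" if "i \<in> F" "j \<in> F" for i j
    using that by (simp add: y_eq ip_add_left ip_scal_left f'_ket w0 del: ip_ket)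
  from orthonormal_family_with_prescribed_products[OF F]
  obtain \<epsilon> where ex: "\<epsilon> > 0 \<and> (\<forall>(p :: nat \<Rightarrow> 'a ell2) W M. orthonormal F p \<longrightarrow> finite W \<longrightarrow>
      (\<forall>i\<in>F. \<forall>w\<in>W. ip (p i) w = 0) \<longrightarrow> (\<forall>i\<in>F. \<forall>j\<in>F. norm (M i j) < \<epsilon>) \<longrightarrow>
      (\<exists>z. orthonormal F z \<and> (\<forall>i\<in>F. \<forall>j\<in>F. ip (z i) (p j) = M i j) \<and> (\<forall>i\<in>F. \<forall>w\<in>W. ip (z i) w = 0)))"
    by (rule exE)
  then have \<epsilon>: "\<epsilon> > 0" by (rule conjunct1)
  have "g \<in> pow_set (P n) 108" if g: "g \<in> unitaries" and near: "\<forall>x\<in>y ` F. norm (g x - x) < s\<^sup>2 * \<epsilon>" for g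
  proof -
    \<comment> \<open>The products \<open>\<langle>z i, p j\<rangle>\<close> for which \<open>u e\<close> and \<open>g y\<close> have the same products with \<open>e\<close>.\<close>
    define M where "M i j = (ip (g (y i)) (ket j) - ip (y i) (ket j)) / (?s * ?s)" for i j
    have M: "norm (M i j) < \<epsilon>" if "i \<in> F" "j \<in> F" for i j
    proof -
      have "norm (ip (g (y i) - y i) (ket j)) \<le> norm (g (y i) - y i) * norm (ket j :: 'a ell2)"
        by (rule norm_ip_le)
      also have "norm (ket j :: 'a ell2) = 1" by (rule norm_orthonormal[OF orthonormal_ket UNIV_I])
      also have "norm (g (y i) - y i) * 1 < s\<^sup>2 * \<epsilon>" using near that by simp
      finally show ?thesis
        using s(1) by (simp add: M_def ip_diff_left norm_divide norm_mult divide_less_eq power2_eq_square mult.commute del: ip_ket)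
    qed
    have "\<exists>z. orthonormal F z \<and> (\<forall>i\<in>F. \<forall>j\<in>F. ip (z i) (p j) = M i j) \<and> (\<forall>i\<in>F. \<forall>w\<in>f' ` F. ip (z i) w = 0)"
      using conjunct2[OF ex, THEN spec[of _ p], THEN spec[of _ "f' ` F"], THEN spec[of _ M]] ortho_p F M p_f'
      by simp
    then obtain z where z: "orthonormal F z" "\<And>i j. i \<in> F \<Longrightarrow> j \<in> F \<Longrightarrow> ip (z i) (p j) = M i j"
        "\<And>i j. i \<in> F \<Longrightarrow> j \<in> F \<Longrightarrow> ip (z i) (f' j) = 0" by blast
    have f'_z: "ip (f' j) (z i) = 0" if "i \<in> F" "j \<in> F" for i j using z(3)[OF that] by (metis cj_0 cj_ip)
    have "\<exists>u\<in>unitaries. (\<forall>i\<in>F. u (f' i) = f' i) \<and> (\<forall>i\<in>F. u (p i) = z i)"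
      by (rule unitary_extends_two_finite_isometries[OF F F])
         (use z(1) in \<open>simp_all add: f'_p f'_z pp orthonormal_def\<close>)
    then obtain u where u: "u \<in> unitaries" "\<And>i. i \<in> F \<Longrightarrow> u (f' i) = f' i" "\<And>i. i \<in> F \<Longrightarrow> u (p i) = z i"
      by blast
    have u_ket: "u (ket i) = ?c \<cdot> f' i + ?s \<cdot> z i" if "i \<in> F" for i
      unfolding ket_eq[of i] using u that by (simp add: unitary_add unitary_scal)
    have u_ket_ket: "ip (u (ket i)) (ket j) = ip (g (y i)) (ket j)" if "i \<in> F" "j \<in> F" for i j
    proof -
      have "ip (z i) (ket j) = ?s * M i j"
        unfolding ket_eq[of j] using z(2,3) that by (simp add: ip_add_right ip_scal_right)
      then have "ip (u (ket i)) (ket j) = (if i = j then ?c * ?c else 0) + ?s * ?s * M i j"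
        using that by (simp add: u_ket ip_add_left ip_scal_left f'_ket mult.assoc del: ip_ket)
      also have "\<dots> = ip (g (y i)) (ket j)"
        using s0 y_ket[OF that] by (simp add: M_def del: ip_ket)
      finally show ?thesis .
    qed
    have ket_u_ket: "ip (ket j) (u (ket i)) = ip (ket j) (g (y i))" if "i \<in> F" "j \<in> F" for i j
      using u_ket_ket[OF that] by (metis cj_ip)
    have "\<exists>k\<in>unitaries. (\<forall>i\<in>F. k (ket i) = ket i) \<and> (\<forall>i\<in>F. k (u (ket i)) = g (y i))"
    proof (rule unitary_extends_two_finite_isometries[OF F F])
      show "ip (u (ket i)) (u (ket j)) = ip (g (y i)) (g (y j))" for i j
        by (simp add: y_def unitary_ip[OF u(1)] unitary_ip[OF g] unitary_ip[OF u\<^sub>0(1)])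
    qed (rule refl, rule ket_u_ket)
    then obtain k where k: "k \<in> unitaries" "\<And>i. i \<in> F \<Longrightarrow> k (ket i) = ket i" "\<And>i. i \<in> F \<Longrightarrow> k (u (ket i)) = g (y i)"
      by blast
    define h where "h = ginv u \<circ> (ginv k \<circ> (g \<circ> u\<^sub>0))"
    have hU: "h \<in> unitaries" unfolding h_def by (intro comp_in_unitaries ginv_in_unitaries u k u\<^sub>0 g)
    have "h (ket i) = ket i" if "i \<in> F" for i
    proof -
      have "h (ket i) = ginv u (ginv k (g (y i)))" by (simp add: h_def y_def)
      also have "\<dots> = ket i" unfolding k(3)[OF that, symmetric] using k(1) u(1) by simp
      finally show ?thesis .
    qed
    then have "h \<in> fixer F" by (rule fixerI[OF hU])
    moreover have "k \<in> fixer F" using k by (intro fixerI)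
    moreover have "ginv u\<^sub>0 \<in> pow_set (P n) (1 + (26 + 1))"
    proof (rule fixer'_P)
      show "ginv u\<^sub>0 \<in> unitaries" using u\<^sub>0(1) by simp
      show "ginv u\<^sub>0 (f' i) = f' i" if "i \<in> F" for i
        using unitary_ginv(2)[OF u\<^sub>0(1), of "f' i"] u\<^sub>0(2)[OF that] by simp
    qed
    ultimately have "k \<circ> (u \<circ> (h \<circ> ginv u\<^sub>0)) \<in> pow_set (P n) (26 + ((1 + (26 + 1)) + (26 + (1 + (26 + 1)))))"
      using fixer_P fixer'_P[OF u(1,2)] by (intro pow_set_comp) auto
    moreover have "k \<circ> (u \<circ> (h \<circ> ginv u\<^sub>0)) = g"
      using k(1) u(1) u\<^sub>0(1) by (simp add: h_def fun_eq_iff)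
    ultimately show ?thesis by simp
  qed
  then show ?thesis using \<epsilon> s(1) F
    by (intro exI[of _ n] exI[of _ "y ` F"] exI[of _ "s\<^sup>2 * \<epsilon>"]) simp
qed

section \<open>Consequences for the group of all unitaries\<close>

definition isometry_group :: "('a::hilbert_scalar ell2 \<Rightarrow> 'a ell2) monoid" where
  "isometry_group = \<lparr>carrier = unitaries, monoid.mult = (\<circ>), one = id\<rparr>"

lemma isometry_group_simps [simp]:
  "carrier isometry_group = unitaries" "g \<otimes>\<^bsub>isometry_group\<^esub> h = g \<circ> h" "\<one>\<^bsub>isometry_group\<^esub> = id"
  by (simp_all add: isometry_group_def)

lemma group_isometry_group: "group isometry_group"
proof (rule groupI)
  show "\<exists>h\<in>carrier isometry_group. h \<otimes>\<^bsub>isometry_group\<^esub> g = \<one>\<^bsub>isometry_group\<^esub>"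
    if "g \<in> carrier isometry_group" for g :: "'a ell2 \<Rightarrow> 'a ell2"
    using that by (intro bexI[of _ "ginv g"]) (auto simp: fun_eq_iff)
qed (auto simp: comp_assoc comp_in_unitaries simp del: id_apply)

lemma inv_isometry_group: "g \<in> unitaries \<Longrightarrow> inv\<^bsub>isometry_group\<^esub> g = ginv g"
  by (rule group.inv_equality[OF group_isometry_group]) (auto simp: fun_eq_iff)

lemma open_pointwise_ball:
  fixes a :: "'a::hilbert_scalar ell2 \<Rightarrow> 'a ell2"
  assumes "finite X" shows "open {f :: 'a ell2 \<Rightarrow> 'a ell2. \<forall>x\<in>X. norm (f x - a x) < \<epsilon>}"
proof -
  have "open ((\<lambda>f :: 'a ell2 \<Rightarrow> 'a ell2. f x) -` ball (a x) \<epsilon>)" for x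
    by (rule open_vimage[OF open_ball continuous_on_product_coordinates])
  then have "open (\<Inter>x\<in>X. (\<lambda>f :: 'a ell2 \<Rightarrow> 'a ell2. f x) -` ball (a x) \<epsilon>)"
    using assms by (intro open_INT) auto
  moreover have "(\<Inter>x\<in>X. (\<lambda>f :: 'a ell2 \<Rightarrow> 'a ell2. f x) -` ball (a x) \<epsilon>) = {f. \<forall>x\<in>X. norm (f x - a x) < \<epsilon>}"
    by (auto simp: dist_norm norm_minus_commute)
  ultimately show ?thesis by simp
qed

text \<open>
  A basis of neighbourhoods of \<open>a\<close> in the strong operator topology is given by closeness to \<open>a\<close> on
  finitely many vectors.
\<close>

lemma openin_pointwise_topologyI:
  fixes A :: "('a::hilbert_scalar ell2 \<Rightarrow> 'a ell2) set"
  assumes A: "A \<subseteq> unitaries"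
    and nbhd: "\<And>a. a \<in> A \<Longrightarrow> \<exists>X \<epsilon>. finite X \<and> \<epsilon> > 0 \<and> (\<forall>g\<in>unitaries. (\<forall>x\<in>X. norm (g x - a x) < \<epsilon>) \<longrightarrow> g \<in> A)"
  shows "openin (pointwise_topology isometry_group) A"
  unfolding pointwise_topology_def isometry_group_simps
proof (subst openin_subopen, intro ballI)
  fix a assume a: "a \<in> A"
  obtain X \<epsilon> where X: "finite X" "\<epsilon> > 0" and sub: "\<forall>g\<in>unitaries. (\<forall>x\<in>X. norm (g x - a x) < \<epsilon>) \<longrightarrow> g \<in> A"
    using nbhd[OF a] by blast
  let ?O = "{f. \<forall>x\<in>X. norm (f x - a x) < \<epsilon>}"
  show "\<exists>T. openin (top_of_set unitaries) T \<and> a \<in> T \<and> T \<subseteq> A"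
  proof (intro exI conjI)
    show "openin (top_of_set unitaries) (unitaries \<inter> ?O)"
      by (rule openin_open_Int[OF open_pointwise_ball[OF X(1)]])
    show "a \<in> unitaries \<inter> ?O" using a A X(2) by auto
    show "unitaries \<inter> ?O \<subseteq> A" using sub by blast
  qed
qed

lemma nearby_unitaries_differ_by_captured:
  fixes P :: "nat \<Rightarrow> ('a::hilbert_scalar ell2 \<Rightarrow> 'a ell2) set"
  assumes P: "capturing P"
  shows "\<exists>n X \<epsilon>. finite X \<and> \<epsilon> > 0 \<and> (\<forall>a\<in>unitaries. \<forall>g\<in>unitaries.
           (\<forall>x\<in>X. norm (g x - a x) < \<epsilon>) \<longrightarrow> ginv a \<circ> g \<in> pow_set (P n) 108)"
proof -
  obtain n X \<epsilon> where X: "finite X" "\<epsilon> > 0"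
      and nbhd: "\<forall>g\<in>unitaries. (\<forall>x\<in>X. norm (g x - x) < \<epsilon>) \<longrightarrow> g \<in> pow_set (P n) 108"
    using neighbourhood_captured[OF P] by blast
  have "ginv a \<circ> g \<in> pow_set (P n) 108"
    if a: "a \<in> unitaries" and g: "g \<in> unitaries" and near: "\<forall>x\<in>X. norm (g x - a x) < \<epsilon>" for a g
  proof -
    have "norm ((ginv a \<circ> g) x - x) = norm (g x - a x)" for x
    proof -
      have "norm (g x - a x) = norm (ginv a (g x - a x))"
        by (rule unitary_norm[OF ginv_in_unitaries[OF a], symmetric])
      also have "ginv a (g x - a x) = (ginv a \<circ> g) x - x"
        using unitary_diff[OF ginv_in_unitaries[OF a], of "g x" "a x"] a by simp
      finally show ?thesis by simp
    qed
    then have "\<forall>x\<in>X. norm ((ginv a \<circ> g) x - x) < \<epsilon>" using near by simp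
    then show ?thesis using nbhd comp_in_unitaries[OF ginv_in_unitaries[OF a] g] by blast
  qed
  then show ?thesis using X by blast
qed

lemma countable_range_not_inj:
  assumes "countable (range (f :: nat set \<Rightarrow> 'b))" shows "\<exists>A B. A \<noteq> B \<and> f A = f B"
proof (rule ccontr)
  assume "\<not> ?thesis"
  then have "inj f" by (meson injI)
  then have "countable (UNIV :: nat set set)" using assms countable_image_inj_on by blast
  then have "range (from_nat_into (UNIV :: nat set set)) = Pow UNIV"
    by (simp add: range_from_nat_into)
  then show False using Cantors_theorem by blast
qed

text \<open>
  Bounded powers of a subgroup stay in it, so for subgroups the captured power is the subgroup.
\<close>

lemma subgroup_isometry_groupD:
  assumes "subgroup H isometry_group"
  shows "symmetric H" "id \<in> H" "g \<in> H \<Longrightarrow> h \<in> H \<Longrightarrow> g \<circ> h \<in> H" "pow_set H n \<subseteq> H"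
proof -
  show sym: "symmetric H"
    unfolding symmetric_def
  proof (intro conjI ballI)
    show "H \<subseteq> unitaries" using subgroup.subset[OF assms] by simp
    then show "ginv g \<in> H" if "g \<in> H" for g
      using subgroup.m_inv_closed[OF assms that] that inv_isometry_group[of g] by auto
  qed
  show 1: "id \<in> H" using subgroup.one_closed[OF assms] by simp
  show 2: "g \<circ> h \<in> H" if "g \<in> H" "h \<in> H" for g h using subgroup.m_closed[OF assms that] by simp
  show "pow_set H n \<subseteq> H" by (induction n) (use 1 2 in auto)
qed

subsection \<open>Small index property\<close>

text \<open>
  A family indexed by all sets of natural numbers has two members whose inverses are in the same
  right coset of \<open>H\<close>, so the constant sequence \<open>H\<close> is capturing.
\<close>

theorem small_index_property_isometry_group:
  "small_index_property isometry_group (pointwise_topology (isometry_group :: ('a::hilbert_scalar ell2 \<Rightarrow> 'a ell2) monoid))"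
  unfolding small_index_property_def
proof (intro allI impI, elim conjE)
  fix H :: "('a ell2 \<Rightarrow> 'a ell2) set"
  assume H: "subgroup H isometry_group" and index: "rcosets\<^bsub>isometry_group\<^esub> H \<prec> (UNIV :: nat set set)"
  note HD = subgroup_isometry_groupD[OF H]
  have HU: "H \<subseteq> unitaries" using HD(1) by (simp add: symmetric_def)
  have "\<exists>n A B. A \<noteq> B \<and> ginv (g A) \<circ> g B \<in> H" if g: "range g \<subseteq> unitaries" for g :: "nat set \<Rightarrow> 'a ell2 \<Rightarrow> 'a ell2"
  proof -
    have gU: "g A \<in> unitaries" for A using g by blast
    let ?c = "\<lambda>A. H #>\<^bsub>isometry_group\<^esub> ginv (g A)"
    have "\<not> inj ?c"
    proof
      assume "inj ?c"
      moreover have "range ?c \<subseteq> rcosets\<^bsub>isometry_group\<^esub> H"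
        using ginv_in_unitaries[OF gU] by (auto simp: RCOSETS_def)
      ultimately have "(UNIV :: nat set set) \<lesssim> rcosets\<^bsub>isometry_group\<^esub> H" unfolding lepoll_def by blast
      then show False using index lepoll_antisym unfolding lesspoll_def by blast
    qed
    then obtain A B where "A \<noteq> B" and eq: "?c A = ?c B" unfolding inj_def by blast
    have "ginv (g A) \<in> ?c A" using HD(2) unfolding r_coset_def by (auto intro: bexI[of _ id])
    then have "ginv (g A) \<in> ?c B" by (simp only: eq)
    then obtain h where "h \<in> H" and h: "ginv (g A) = h \<circ> ginv (g B)" unfolding r_coset_def by auto
    have "ginv (g A) \<circ> g B = h" unfolding h using gU by (simp add: fun_eq_iff)
    then show ?thesis using \<open>A \<noteq> B\<close> \<open>h \<in> H\<close> by blast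
  qed
  then have "capturing (\<lambda>_. H)" using HD(1) by (simp add: capturing_def)
  then obtain X \<epsilon> where X: "finite X" "\<epsilon> > 0"
      and near: "\<forall>a\<in>unitaries. \<forall>g\<in>unitaries. (\<forall>x\<in>X. norm (g x - a x) < \<epsilon>) \<longrightarrow> ginv a \<circ> g \<in> pow_set H 108"
    using nearby_unitaries_differ_by_captured by blast
  show "openin (pointwise_topology isometry_group) H"
  proof (rule openin_pointwise_topologyI[OF HU])
    fix a assume a: "a \<in> H"
    have "g \<in> H" if g: "g \<in> unitaries" "\<forall>x\<in>X. norm (g x - a x) < \<epsilon>" for g
    proof -
      have "a \<in> unitaries" using a HU by (rule subsetD[rotated])
      then have "ginv a \<circ> g \<in> pow_set H 108" using near g by simp
      then have "ginv a \<circ> g \<in> H" by (rule subsetD[OF HD(4)])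
      then have "a \<circ> (ginv a \<circ> g) \<in> H" by (rule HD(3)[OF a])
      moreover have "a \<circ> (ginv a \<circ> g) = g" using a HU by (auto simp: fun_eq_iff subset_iff)
      ultimately show ?thesis by simp
    qed
    then show "\<exists>X \<epsilon>. finite X \<and> \<epsilon> > 0 \<and> (\<forall>g\<in>unitaries. (\<forall>x\<in>X. norm (g x - a x) < \<epsilon>) \<longrightarrow> g \<in> H)"
      using X by (intro exI[of _ X] exI[of _ \<epsilon>]) simp
  qed
qed

subsection \<open>Uncountable cofinality\<close>

text \<open>
  Two members of a continuum family first appear in the same member of the chain \<open>K\<close>, so \<open>K\<close> is
  capturing and some \<open>K n\<^sub>1\<close> contains the stabiliser of \<open>B\<close>. A permutation that moves \<open>B\<close> off itself
  lies in a later member of the chain, which therefore contains the stabiliser of the empty set.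
\<close>

theorem uncountable_cofinality_isometry_group:
  "uncountable_cofinality (isometry_group :: ('a::hilbert_scalar ell2 \<Rightarrow> 'a ell2) monoid)"
  unfolding uncountable_cofinality_def
proof (rule notI, elim exE conjE)
  fix K :: "nat \<Rightarrow> ('a ell2 \<Rightarrow> 'a ell2) set"
  assume K: "\<forall>n. subgroup (K n) isometry_group \<and> K n \<noteq> carrier isometry_group \<and> K n \<subseteq> K (Suc n)"
    and "carrier isometry_group = (\<Union>n. K n)"
  then have UK: "unitaries = (\<Union>n. K n)" by simp
  have sub: "subgroup (K n) isometry_group" and proper: "K n \<noteq> unitaries" for n using K by auto
  note KD = subgroup_isometry_groupD[OF sub]
  have inc: "incseq K" using K by (intro incseq_SucI) auto
  have "\<exists>n A B. A \<noteq> B \<and> ginv (g A) \<circ> g B \<in> K n" if g: "range g \<subseteq> unitaries" for g :: "nat set \<Rightarrow> 'a ell2 \<Rightarrow> 'a ell2"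
  proof -
    have "\<forall>A. \<exists>n. g A \<in> K n" using g UK by blast
    from choice[OF this] obtain f where f: "\<forall>A. g A \<in> K (f A)" by (rule exE)
    obtain A B where "A \<noteq> B" "f A = f B" using countable_range_not_inj[of f] by blast
    then have "g A \<in> K (f A)" "g B \<in> K (f A)" using f by (blast, metis)
    then have "ginv (g A) \<circ> g B \<in> K (f A)" using KD(3) symmetricD(2)[OF KD(1)] by blast
    then show ?thesis using \<open>A \<noteq> B\<close> by blast
  qed
  then have "capturing K" using KD(1) inc by (simp add: capturing_def)
  then obtain n\<^sub>1 B where B: "infinite B" "infinite (- B)" "fixer B \<subseteq> pow_set (K n\<^sub>1) 4"
    using infinite_stabiliser_captured by blast
  obtain Y\<^sub>1 Y\<^sub>2 where Y: "- B = Y\<^sub>1 \<union> Y\<^sub>2" "Y\<^sub>1 \<inter> Y\<^sub>2 = {}" "infinite Y\<^sub>1" "infinite Y\<^sub>2"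
    using infinite_nat_set_splits[OF B(2)] by blast
  have "- Y\<^sub>1 = B \<union> Y\<^sub>2" using Y(1,2) by blast
  then have "infinite (- Y\<^sub>1)" using B(1) by simp
  then obtain f f' where f: "bij_betw f B Y\<^sub>1" "bij_betw f' (- B) (- Y\<^sub>1)"
    using bij_betw_countably_infinite B(1,2) Y(3) by metis
  define \<sigma> where "\<sigma> = (\<lambda>n. if n \<in> B then f n else f' n)"
  have 1: "bij_betw \<sigma> B Y\<^sub>1" using f(1) by (rule bij_betw_cong[THEN iffD1, rotated]) (simp add: \<sigma>_def)
  have 2: "bij_betw \<sigma> (- B) (- Y\<^sub>1)" using f(2) by (rule bij_betw_cong[THEN iffD1, rotated]) (simp add: \<sigma>_def)
  have "bij \<sigma>" using bij_betw_combine[OF 1 2] by simp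
  have \<sigma>B: "\<sigma> ` B = Y\<^sub>1" using 1 by (simp add: bij_betw_def)
  obtain v :: "'a ell2 \<Rightarrow> 'a ell2" where v: "v \<in> unitaries" "\<forall>n. v (ket n) = ket (\<sigma> n)"
    using unitary_of_permutation[OF \<open>bij \<sigma>\<close>] by blast
  obtain n\<^sub>2 where n\<^sub>2: "v \<in> K n\<^sub>2" using v(1) UK by blast
  define n where "n = max n\<^sub>1 n\<^sub>2"
  have mono: "K n\<^sub>1 \<subseteq> K n" "K n\<^sub>2 \<subseteq> K n" using inc by (auto simp: n_def incseq_def)
  have disj: "B \<inter> \<sigma> ` B = {}" "B - \<sigma> ` B = B" "- (B \<union> \<sigma> ` B) = Y\<^sub>2" using Y(1,2) unfolding \<sigma>B by blast+
  have "fixer (B \<inter> \<sigma> ` B) \<subseteq> pow_set (K n) 26"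
  proof (rule stabiliser_captured_by_permutation[OF KD(1)])
    show "fixer B \<subseteq> pow_set (K n) 4" using B(3) pow_set_mono[OF mono(1)] by (rule order_trans)
    show "v \<in> K n" using mono(2) n\<^sub>2 by (rule subsetD)
    show "v (ket m) = ket (\<sigma> m)" for m using v(2) by simp
    show "infinite (B - \<sigma> ` B)" unfolding disj(2) by (rule B(1))
    show "infinite (- (B \<union> \<sigma> ` B))" unfolding disj(3) by (rule Y(4))
  qed
  then have "unitaries \<subseteq> K n" using KD(4) by (auto simp: disj fixer_def)
  moreover have "K n \<subseteq> unitaries" using UK by blast
  ultimately show False using proper by blast
qed

subsection \<open>Automatic continuity\<close>

primrec group_pow_set :: "('b, 'm) monoid_scheme \<Rightarrow> 'b set \<Rightarrow> nat \<Rightarrow> 'b set" where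
  "group_pow_set H W 0 = {\<one>\<^bsub>H\<^esub>}"
| "group_pow_set H W (Suc n) = {a \<otimes>\<^bsub>H\<^esub> b |a b. a \<in> W \<and> b \<in> group_pow_set H W n}"

lemma group_pow_set_mono: "V \<subseteq> W \<Longrightarrow> group_pow_set H V n \<subseteq> group_pow_set H W n"
  by (induction n) auto

text \<open>
  The function \<open>f\<close> is multiplication in one application and division in the other.
\<close>

lemma topological_group_small_neighbourhoods:
  fixes H :: "('b, 'm) monoid_scheme"
  assumes H: "topological_group H S" and f: "continuous_map (prod_topology S S) S (\<lambda>(x, y). f x y)"
    and V: "openin S V" "f \<one>\<^bsub>H\<^esub> \<one>\<^bsub>H\<^esub> \<in> V"
  shows "\<exists>W. openin S W \<and> \<one>\<^bsub>H\<^esub> \<in> W \<and> (\<forall>a\<in>W. \<forall>b\<in>W. f a b \<in> V)"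
proof -
  have one: "\<one>\<^bsub>H\<^esub> \<in> topspace S"
    using H by (auto simp: topological_group_def intro: group.is_monoid monoid.one_closed)
  let ?O = "{p \<in> topspace (prod_topology S S). (case p of (x, y) \<Rightarrow> f x y) \<in> V}"
  have "openin (prod_topology S S) ?O"
    using openin_continuous_map_preimage[OF f V(1)] .
  moreover have "(\<one>\<^bsub>H\<^esub>, \<one>\<^bsub>H\<^esub>) \<in> {p \<in> topspace (prod_topology S S). (case p of (x, y) \<Rightarrow> f x y) \<in> V}"
    using one V(2) by simp
  ultimately have "\<exists>U\<^sub>1 U\<^sub>2. openin S U\<^sub>1 \<and> openin S U\<^sub>2 \<and> \<one>\<^bsub>H\<^esub> \<in> U\<^sub>1 \<and> \<one>\<^bsub>H\<^esub> \<in> U\<^sub>2 \<and> U\<^sub>1 \<times> U\<^sub>2 \<subseteq> ?O"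
    unfolding openin_prod_topology_alt by blast
  then obtain U\<^sub>1 U\<^sub>2 where U: "openin S U\<^sub>1" "openin S U\<^sub>2" "\<one>\<^bsub>H\<^esub> \<in> U\<^sub>1" "\<one>\<^bsub>H\<^esub> \<in> U\<^sub>2" "U\<^sub>1 \<times> U\<^sub>2 \<subseteq> ?O"
    by (elim exE conjE)
  have "f a b \<in> V" if "a \<in> U\<^sub>1 \<inter> U\<^sub>2" "b \<in> U\<^sub>1 \<inter> U\<^sub>2" for a b
  proof -
    have "(a, b) \<in> U\<^sub>1 \<times> U\<^sub>2" using that by simp
    with U(5) have "(a, b) \<in> ?O" by (rule subsetD)
    then show ?thesis by simp
  qed
  moreover have "openin S (U\<^sub>1 \<inter> U\<^sub>2)" "\<one>\<^bsub>H\<^esub> \<in> U\<^sub>1 \<inter> U\<^sub>2" using U(1-4) by auto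
  ultimately show ?thesis by (intro exI[of _ "U\<^sub>1 \<inter> U\<^sub>2"] conjI ballI)
qed

lemma topological_group_roots:
  fixes H :: "('b, 'm) monoid_scheme"
  assumes H: "topological_group H S"
  shows "openin S V \<Longrightarrow> \<one>\<^bsub>H\<^esub> \<in> V \<Longrightarrow> \<exists>W. openin S W \<and> \<one>\<^bsub>H\<^esub> \<in> W \<and> group_pow_set H W n \<subseteq> V"
proof (induction n arbitrary: V)
  case 0
  then show ?case by auto
next
  case (Suc n)
  have mult: "continuous_map (prod_topology S S) S (\<lambda>(x, y). x \<otimes>\<^bsub>H\<^esub> y)" and "group H"
    using H by (auto simp: topological_group_def)
  then have "\<one>\<^bsub>H\<^esub> \<otimes>\<^bsub>H\<^esub> \<one>\<^bsub>H\<^esub> = \<one>\<^bsub>H\<^esub>" by (simp add: group.is_monoid monoid.l_one monoid.one_closed)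
  then obtain A where A: "openin S A" "\<one>\<^bsub>H\<^esub> \<in> A" "\<forall>a\<in>A. \<forall>b\<in>A. a \<otimes>\<^bsub>H\<^esub> b \<in> V"
    using topological_group_small_neighbourhoods[OF H mult Suc.prems(1)] Suc.prems(2) by auto
  obtain W where W: "openin S W" "\<one>\<^bsub>H\<^esub> \<in> W" "group_pow_set H W n \<subseteq> A" using Suc.IH[OF A(1,2)] by blast
  have "group_pow_set H (W \<inter> A) n \<subseteq> A" using group_pow_set_mono[of "W \<inter> A" W H n] W(3) by blast
  then have "group_pow_set H (W \<inter> A) (Suc n) \<subseteq> V" using A(3) by auto
  then show ?case using A W by (intro exI[of _ "W \<inter> A"]) auto
qed

text \<open>
  By continuity of the group operations in \<open>H\<close> it is enough to consider the preimage \<open>P\<close> of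
  \<open>W W\<^sup>-\<^sup>1\<close> for a neighbourhood \<open>W\<close> of the identity that is so small that
  the \<open>108\<close>th power of \<open>W W\<^sup>-\<^sup>1\<close> is inside the given neighbourhood. The constant sequence \<open>P\<close> is
  capturing: for each \<open>A\<close> the set \<open>h (g A) W\<close> meets a countable dense set in some \<open>d A\<close>, and if
  \<open>d A = d B\<close> then \<open>(h (g A))\<^sup>-\<^sup>1 (h (g B)) \<in> W W\<^sup>-\<^sup>1\<close>.
\<close>

theorem automatic_continuity_isometry_group:
  "automatic_continuity TYPE('b) isometry_group (pointwise_topology (isometry_group :: ('a::hilbert_scalar ell2 \<Rightarrow> 'a ell2) monoid))"
  unfolding automatic_continuity_def
proof (intro allI impI, elim conjE)
  fix H :: "'b monoid" and S and h :: "('a ell2 \<Rightarrow> 'a ell2) \<Rightarrow> 'b"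
  assume H: "topological_group H S" and sep: "separable_space S" and h: "h \<in> hom isometry_group H"
  have grp: "group H" and top: "topspace S = carrier H"
    and mult: "continuous_map (prod_topology S S) S (\<lambda>(x, y). x \<otimes>\<^bsub>H\<^esub> y)"
    and inv: "continuous_map S S (\<lambda>x. inv\<^bsub>H\<^esub> x)"
    using H by (auto simp: topological_group_def)
  interpret H: group H by (rule grp)
  have hU: "h g \<in> carrier H" if "g \<in> unitaries" for g using h that by (auto simp: hom_def Pi_iff)
  have h_comp: "h (g \<circ> g') = h g \<otimes>\<^bsub>H\<^esub> h g'" if "g \<in> unitaries" "g' \<in> unitaries" for g g'
    using hom_mult[OF h, of g g'] that by simp
  have h_id: "h id = \<one>\<^bsub>H\<^esub>"
    using hom_one[OF h group_isometry_group grp] by simp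
  have h_inv: "h (ginv g) = inv\<^bsub>H\<^esub> h g" if "g \<in> unitaries" for g
  proof (rule H.inv_equality[symmetric])
    show "h (ginv g) \<otimes>\<^bsub>H\<^esub> h g = \<one>\<^bsub>H\<^esub>"
      using h_comp[of "ginv g" g] that h_id by (simp add: fun_eq_iff[symmetric] o_def id_def)
  qed (use that hU in auto)
  have left: "continuous_map S S (\<lambda>y. a \<otimes>\<^bsub>H\<^esub> y)" if "a \<in> carrier H" for a
  proof -
    have "continuous_map S (prod_topology S S) (\<lambda>y. (a, y))"
      using that by (intro continuous_map_pairedI) (auto simp: top)
    from continuous_map_compose[OF this mult] show ?thesis by (simp add: o_def)
  qed
  have div: "continuous_map (prod_topology S S) S (\<lambda>(x, y). x \<otimes>\<^bsub>H\<^esub> inv\<^bsub>H\<^esub> y)"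
  proof -
    have "continuous_map (prod_topology S S) (prod_topology S S) (\<lambda>p. (fst p, inv\<^bsub>H\<^esub> (snd p)))"
      using continuous_map_compose[OF continuous_map_snd inv, of S]
      by (intro continuous_map_pairedI continuous_map_fst) (simp add: o_def)
    from continuous_map_compose[OF this mult] show ?thesis by (simp add: o_def case_prod_unfold)
  qed
  have open_preimage: "openin (pointwise_topology isometry_group) {g \<in> unitaries. h g \<in> V}" if V: "openin S V" for V
  proof (rule openin_pointwise_topologyI)
    fix a assume "a \<in> {g \<in> unitaries. h g \<in> V}"
    then have a: "a \<in> unitaries" and haV: "h a \<in> V" by auto
    define V' where "V' = {y \<in> topspace S. h a \<otimes>\<^bsub>H\<^esub> y \<in> V}"
    have V': "openin S V'" "\<one>\<^bsub>H\<^esub> \<in> V'"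
      using openin_continuous_map_preimage[OF left[OF hU[OF a]] V] hU[OF a] haV by (auto simp: V'_def top)
    obtain Q where Q: "openin S Q" "\<one>\<^bsub>H\<^esub> \<in> Q" "group_pow_set H Q 108 \<subseteq> V'"
      using topological_group_roots[OF H V'] by blast
    have "\<one>\<^bsub>H\<^esub> \<otimes>\<^bsub>H\<^esub> inv\<^bsub>H\<^esub> \<one>\<^bsub>H\<^esub> \<in> Q" using Q(2) by simp
    then obtain W where W: "openin S W" "\<one>\<^bsub>H\<^esub> \<in> W" "\<forall>a\<in>W. \<forall>b\<in>W. a \<otimes>\<^bsub>H\<^esub> inv\<^bsub>H\<^esub> b \<in> Q"
      using topological_group_small_neighbourhoods[OF H div Q(1)] by blast
    have Wc: "W \<subseteq> carrier H" using openin_subset[OF W(1)] by (simp add: top)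
    define P where "P = {g \<in> unitaries. \<exists>x\<in>W. \<exists>y\<in>W. h g = x \<otimes>\<^bsub>H\<^esub> inv\<^bsub>H\<^esub> y}"
    have "symmetric P"
      unfolding symmetric_def
    proof (intro conjI ballI)
      show "P \<subseteq> unitaries" by (auto simp: P_def)
      fix g assume "g \<in> P"
      then obtain x y where g: "g \<in> unitaries" and xy: "x \<in> W" "y \<in> W" "h g = x \<otimes>\<^bsub>H\<^esub> inv\<^bsub>H\<^esub> y" by (auto simp: P_def)
      have "h (ginv g) = y \<otimes>\<^bsub>H\<^esub> inv\<^bsub>H\<^esub> x"
        using xy Wc by (simp add: h_inv[OF g] H.inv_mult_group subset_iff)
      then show "ginv g \<in> P" using g xy unfolding P_def by auto
    qed
    moreover have "\<exists>n A B. A \<noteq> B \<and> ginv (g A) \<circ> g B \<in> P" if "range g \<subseteq> unitaries" for g :: "nat set \<Rightarrow> 'a ell2 \<Rightarrow> 'a ell2"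
    proof -
      have g: "g A \<in> unitaries" for A using that by blast
      obtain D where D: "countable D" "D \<subseteq> topspace S" "S closure_of D = topspace S"
        using sep unfolding separable_space_def by blast
      have "\<exists>d. d \<in> D \<and> inv\<^bsub>H\<^esub> (h (g A)) \<otimes>\<^bsub>H\<^esub> d \<in> W" for A
      proof -
        have c: "inv\<^bsub>H\<^esub> (h (g A)) \<in> carrier H" using hU[OF g] by simp
        define O' where "O' = {y \<in> topspace S. inv\<^bsub>H\<^esub> (h (g A)) \<otimes>\<^bsub>H\<^esub> y \<in> W}"
        have "openin S O'"
          unfolding O'_def by (rule openin_continuous_map_preimage[OF left[OF c] W(1)])
        moreover have "h (g A) \<in> O'" using hU[OF g] W(2) by (simp add: O'_def top)
        moreover have "h (g A) \<in> S closure_of D" using D(3) hU[OF g] by (simp add: top)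
        ultimately have "\<exists>d\<in>D. d \<in> O'" unfolding in_closure_of by blast
        then show ?thesis by (auto simp: O'_def)
      qed
      then have "\<forall>A. \<exists>d. d \<in> D \<and> inv\<^bsub>H\<^esub> (h (g A)) \<otimes>\<^bsub>H\<^esub> d \<in> W" by blast
      from choice[OF this] obtain d where d: "\<forall>A. d A \<in> D \<and> inv\<^bsub>H\<^esub> (h (g A)) \<otimes>\<^bsub>H\<^esub> d A \<in> W" by (rule exE)
      have "countable (range d)" using D(1) d by (meson countable_subset image_subsetI)
      then obtain A B where "A \<noteq> B" and dAB: "d A = d B" using countable_range_not_inj by blast
      let ?x = "inv\<^bsub>H\<^esub> (h (g A)) \<otimes>\<^bsub>H\<^esub> d A" and ?y = "inv\<^bsub>H\<^esub> (h (g B)) \<otimes>\<^bsub>H\<^esub> d A"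
      have xy: "?x \<in> W" "?y \<in> W" using d dAB by (blast, metis)
      have dA: "d A \<in> carrier H" using d D(2) top by blast
      have "inv\<^bsub>H\<^esub> ?y = inv\<^bsub>H\<^esub> (d A) \<otimes>\<^bsub>H\<^esub> h (g B)"
        using dA hU[OF g] by (simp add: H.inv_mult_group)
      then have "?x \<otimes>\<^bsub>H\<^esub> inv\<^bsub>H\<^esub> ?y = inv\<^bsub>H\<^esub> (h (g A)) \<otimes>\<^bsub>H\<^esub> (d A \<otimes>\<^bsub>H\<^esub> (inv\<^bsub>H\<^esub> (d A) \<otimes>\<^bsub>H\<^esub> h (g B)))"
        using dA hU[OF g] by (simp add: H.m_assoc)
      also have "d A \<otimes>\<^bsub>H\<^esub> (inv\<^bsub>H\<^esub> (d A) \<otimes>\<^bsub>H\<^esub> h (g B)) = h (g B)"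
        using dA hU[OF g] by (simp flip: H.m_assoc)
      also have "inv\<^bsub>H\<^esub> (h (g A)) \<otimes>\<^bsub>H\<^esub> h (g B) = h (ginv (g A) \<circ> g B)"
        using g by (simp add: h_comp h_inv)
      finally have "h (ginv (g A) \<circ> g B) = ?x \<otimes>\<^bsub>H\<^esub> inv\<^bsub>H\<^esub> ?y" by (rule sym)
      then have "\<exists>x\<in>W. \<exists>y\<in>W. h (ginv (g A) \<circ> g B) = x \<otimes>\<^bsub>H\<^esub> inv\<^bsub>H\<^esub> y"
        using xy by (intro bexI[of _ ?x] bexI[of _ ?y])
      then have "ginv (g A) \<circ> g B \<in> P"
        unfolding P_def using comp_in_unitaries[OF ginv_in_unitaries[OF g] g] by (intro CollectI conjI)
      then show ?thesis using \<open>A \<noteq> B\<close> by blast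
    qed
    ultimately have "capturing (\<lambda>_. P)" by (simp add: capturing_def)
    then obtain X \<epsilon> where X: "finite X" "\<epsilon> > 0"
        and near: "\<forall>a\<in>unitaries. \<forall>g\<in>unitaries. (\<forall>x\<in>X. norm (g x - a x) < \<epsilon>) \<longrightarrow> ginv a \<circ> g \<in> pow_set P 108"
      using nearby_unitaries_differ_by_captured by blast
    have PQ: "u \<in> unitaries \<and> h u \<in> group_pow_set H Q n" if "u \<in> pow_set P n" for u n
      using that
    proof (induction n arbitrary: u)
      case (Suc n)
      then obtain q r where u: "u = q \<circ> r" and q: "q \<in> P" and "r \<in> pow_set P n" by auto
      with Suc.IH have r: "r \<in> unitaries" "h r \<in> group_pow_set H Q n" by auto
      have "q \<in> unitaries" "h q \<in> Q" using q W(3) by (auto simp: P_def)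
      then show ?case using r by (auto simp: u h_comp simp del: comp_apply)
    qed (simp add: h_id)
    have "h g \<in> V" if g: "g \<in> unitaries" "\<forall>x\<in>X. norm (g x - a x) < \<epsilon>" for g
    proof -
      have "ginv a \<circ> g \<in> pow_set P 108" using near a g by simp
      then have "h (ginv a \<circ> g) \<in> group_pow_set H Q 108" using PQ by simp
      then have "h a \<otimes>\<^bsub>H\<^esub> h (ginv a \<circ> g) \<in> V" using Q(3) by (auto simp: V'_def)
      then have "h (a \<circ> (ginv a \<circ> g)) \<in> V" using a g(1) by (simp add: h_comp)
      moreover have "a \<circ> (ginv a \<circ> g) = g" using a by (simp add: fun_eq_iff)
      ultimately show ?thesis by simp
    qed
    then show "\<exists>X \<epsilon>. finite X \<and> \<epsilon> > 0 \<and> (\<forall>g\<in>unitaries. (\<forall>x\<in>X. norm (g x - a x) < \<epsilon>) \<longrightarrow> g \<in> {g \<in> unitaries. h g \<in> V})"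
      using X by (intro exI[of _ X] exI[of _ \<epsilon>]) simp
  qed auto
  show "continuous_map (pointwise_topology isometry_group) S h"
    unfolding continuous_map_def
    using open_preimage hU by (simp add: pointwise_topology_def top)
qed

section \<open>The orthogonal and the unitary group\<close>

lemma orthogonal_group_eq: "orthogonal_group = isometry_group"
proof -
  have "ip x y = inner x y" for x y :: "real ell2" by (simp add: ip_def inner_ell2_def cj_real_def)
  moreover have "c \<cdot> x = c *\<^sub>R x" for c and x :: "real ell2" using scal_of_real[of c x] by simp
  ultimately show ?thesis
    by (auto simp: orthogonal_group_def isometry_group_def unitaries_def linear_iff)
qed

lemma unitary_group_eq: "unitary_group = isometry_group"
proof -
  have "ip x y = cinner x y" for x y by (simp add: ip_def cinner_def cj_complex_def)
  moreover have "c \<cdot> x = c *\<^sub>C x" for c x by (simp add: scal_def scaleC_def)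
  ultimately show ?thesis
    by (auto simp: unitary_group_def isometry_group_def unitaries_def Vector_Spaces.linear_iff vector_space_scaleC)
qed

theorem theorem14:
  shows "automatic_continuity TYPE('b) orthogonal_group (pointwise_topology orthogonal_group)
       \<and> small_index_property orthogonal_group (pointwise_topology orthogonal_group)
       \<and> uncountable_cofinality orthogonal_group
       \<and> automatic_continuity TYPE('b) unitary_group (pointwise_topology unitary_group)
       \<and> small_index_property unitary_group (pointwise_topology unitary_group)
       \<and> uncountable_cofinality unitary_group"
  unfolding orthogonal_group_eq unitary_group_eq
  by (intro conjI automatic_continuity_isometry_group small_index_property_isometry_group
      uncountable_cofinality_isometry_group)

end
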